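(* Let $(X_t)_{t\ge 0}$ be a one-dimensional Lévy process with characteristic exponent $\psi$, such that $X_t$ has a transition density $p_t$ with respect to Lebesgue measure for all $t>0$, and such that $p_t>0$ for some $t>0$. Assume that either (a) $\psi$ is of class $C^\infty$ and $n\ge 2$ is an arbitrary integer, or (b) $p_t\in C_b^1(\mathbb{R})$ for all $t>0$, and $\mathbb{E}|X_1|^{n+\epsilon}<\infty$ for some $\epsilon>0$ and some integer $n\ge 2$. Let $f:\mathbb{R}\to\mathbb{R}$ be a Borel measurable function with $|f(x)|\le c_0(1+|x|^n)$ for all $x\in\mathbb{R}$ and some constant $c_0>0$. If the process $f(X_t)-\mathbb{E}f(X_t)$, $t\ge 0$, is a martingale, then there is a continuous function $\tilde f$ such that $f=\tilde f$ Lebesgue almost everywhere and $A\tilde f$ is constant, where $A$ is the (weakly extended) generator of $(X_t)_{t\ge0}$. In fact, $\tilde f(x)=ax^2+bx+c$ for suitable constants $a,b,c\in\mathbb{R}$.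
   Context: A Lévy process is a real-valued càdlàg process with stationary and independent increments and $X_0=0$ a.s. Its characteristic exponent $\psi$ is given by $\mathbb{E}e^{i\xi X_t}=e^{-t\psi(\xi)}$ and has the Lévy–Khintchine representation $\psi(\xi)=-ib\xi+\frac12\sigma^2\xi^2+\int_{y\ne0}(1-e^{iy\xi}+iy\xi\mathbf{1}_{(0,1)}(|y|))\,\nu(dy)$ with Lévy triplet $(b,\sigma^2,\nu)$, where $b\in\mathbb{R}$, $\sigma^2\ge0$ and $\nu$ is a measure on $\mathbb{R}\setminus\{0\}$ with $\int\min\{y^2,1\}\,\nu(dy)<\infty$. Martingales are with respect to the natural filtration $\mathcal{F}_t=\sigma(X_s:s\le t)$. $C_b^1(\mathbb{R})$ denotes the bounded $C^1$ functions with bounded derivative. The generator acts on $u\in C_c^\infty(\mathbb{R})$ by $Au(x)=bu'(x)+\frac12\sigma^2u''(x)+\int_{y\ne0}[u(x+y)-u(x)-yu'(x)\mathbf{1}_{(0,1)}(|y|)]\,\nu(dy)$. Its formal adjoint $A^*$ is the generator of the Lévy process $(-X_t)_{t\ge0}$. For polynomially bounded Borel $f$ with growth compatible with the moments of $X_t$, the weakly extended generator is defined by $\langle Af,\phi\rangle:=\langle f,A^*\phi\rangle=\int f\,A^*\phi\,dx$ for $\phi\in C_c^\infty(\mathbb{R})$; thus $Af=k$ for a constant $k$ means $\int f A^*\phi\,dx=k\int\phi\,dx$ for all $\phi\in C_c^\infty(\mathbb{R})$. *)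

theory Defs
  imports "HOL-Probability.Probability"
begin

definition smooth :: "(real \<Rightarrow> 'a::real_normed_vector) \<Rightarrow> bool" where
  "smooth u \<longleftrightarrow> (\<exists>D :: nat \<Rightarrow> real \<Rightarrow> 'a. D 0 = u \<and>
     (\<forall>k x. (D k has_vector_derivative D (Suc k) x) (at x)))"

definition test_functions :: "(real \<Rightarrow> real) set" where
  "test_functions = {u. smooth u \<and> (\<exists>R. \<forall>x. \<bar>x\<bar> > R \<longrightarrow> u x = 0)}"

definition Cb1 :: "(real \<Rightarrow> real) set" where
  "Cb1 = {u. u C1_differentiable_on UNIV \<and> bounded (range u) \<and> bounded (range (deriv u))}"

text \<open>Time is indexed by the reals, but only indices \<open>t \<ge> 0\<close> are ever constrained or used.\<close>

definition cadlag :: "(real \<Rightarrow> real) \<Rightarrow> bool" where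
  "cadlag w \<longleftrightarrow> (\<forall>t\<ge>0. (w \<longlongrightarrow> w t) (at_right t)) \<and>
                (\<forall>t>0. \<exists>l. (w \<longlongrightarrow> l) (at_left t))"

definition stationary_increments :: "'a measure \<Rightarrow> (real \<Rightarrow> 'a \<Rightarrow> real) \<Rightarrow> bool" where
  "stationary_increments M X \<longleftrightarrow> (\<forall>s\<ge>0. \<forall>h\<ge>0.
     distr M borel (\<lambda>\<omega>. X (s + h) \<omega> - X s \<omega>) = distr M borel (\<lambda>\<omega>. X h \<omega> - X 0 \<omega>))"

definition independent_increments :: "'a measure \<Rightarrow> (real \<Rightarrow> 'a \<Rightarrow> real) \<Rightarrow> bool" where
  "independent_increments M X \<longleftrightarrow> (\<forall>(m::nat) (\<tau> :: nat \<Rightarrow> real).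
     0 \<le> \<tau> 0 \<longrightarrow> (\<forall>i<m. \<tau> i < \<tau> (Suc i)) \<longrightarrow>
     prob_space.indep_vars M (\<lambda>_. borel) (\<lambda>i \<omega>. X (\<tau> (Suc i)) \<omega> - X (\<tau> i) \<omega>) {..<m})"

definition levy_process :: "'a measure \<Rightarrow> (real \<Rightarrow> 'a \<Rightarrow> real) \<Rightarrow> bool" where
  "levy_process M X \<longleftrightarrow>
     prob_space M \<and>
     (\<forall>t\<ge>0. X t \<in> borel_measurable M) \<and>
     (AE \<omega> in M. cadlag (\<lambda>t. X t \<omega>)) \<and>
     (AE \<omega> in M. X 0 \<omega> = 0) \<and>
     stationary_increments M X \<and>
     independent_increments M X"

definition characteristic_exponent ::
  "'a measure \<Rightarrow> (real \<Rightarrow> 'a \<Rightarrow> real) \<Rightarrow> (real \<Rightarrow> complex) \<Rightarrow> bool" where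
  "characteristic_exponent M X \<psi> \<longleftrightarrow>
     (\<forall>t\<ge>0. \<forall>\<xi>. char (distr M borel (X t)) \<xi> = exp (- complex_of_real t * \<psi> \<xi>))"

text \<open>A measure on the punctured line is encoded as a Borel measure on the whole line
  without mass at the origin.\<close>

definition levy_measure :: "real measure \<Rightarrow> bool" where
  "levy_measure \<nu> \<longleftrightarrow> sets \<nu> = sets borel \<and> emeasure \<nu> {0} = 0 \<and> integrable \<nu> (\<lambda>y. min (y\<^sup>2) 1)"

text \<open>The second component of the triplet is the variance \<open>\<sigma>\<^sup>2\<close>, written \<open>s2\<close>.\<close>

definition levy_khintchine :: "real \<Rightarrow> real \<Rightarrow> real measure \<Rightarrow> real \<Rightarrow> complex" where
  "levy_khintchine b s2 \<nu> \<xi> =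
     - \<i> * complex_of_real (b * \<xi>) + complex_of_real (s2 * \<xi>\<^sup>2 / 2)
     + (CLINT y|\<nu>. 1 - iexp (y * \<xi>) + \<i> * complex_of_real (y * \<xi> * indicator {0<..<1} \<bar>y\<bar>))"

definition levy_triplet :: "(real \<Rightarrow> complex) \<Rightarrow> real \<Rightarrow> real \<Rightarrow> real measure \<Rightarrow> bool" where
  "levy_triplet \<psi> b s2 \<nu> \<longleftrightarrow> s2 \<ge> 0 \<and> levy_measure \<nu> \<and> (\<forall>\<xi>. \<psi> \<xi> = levy_khintchine b s2 \<nu> \<xi>)"

definition levy_generator ::
  "real \<Rightarrow> real \<Rightarrow> real measure \<Rightarrow> (real \<Rightarrow> real) \<Rightarrow> real \<Rightarrow> real" where
  "levy_generator b s2 \<nu> u x =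
     b * deriv u x + s2 / 2 * deriv (deriv u) x
     + (LINT y|\<nu>. u (x + y) - u x - y * deriv u x * indicator {0<..<1} \<bar>y\<bar>)"

text \<open>If \<open>(X\<^sub>t)\<close> has triplet \<open>(b, s2, \<nu>)\<close>, then \<open>(-X\<^sub>t)\<close> has drift \<open>-b\<close>, the same variance, and
  the reflected jump measure; no drift correction arises because the truncation is symmetric.\<close>

definition adjoint_generator ::
  "real \<Rightarrow> real \<Rightarrow> real measure \<Rightarrow> (real \<Rightarrow> real) \<Rightarrow> real \<Rightarrow> real" where
  "adjoint_generator b s2 \<nu> = levy_generator (- b) s2 (distr \<nu> borel uminus)"

definition weak_generator ::
  "real \<Rightarrow> real \<Rightarrow> real measure \<Rightarrow> (real \<Rightarrow> real) \<Rightarrow> (real \<Rightarrow> real) \<Rightarrow> real" where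
  "weak_generator b s2 \<nu> f \<phi> = (LINT x|lborel. f x * adjoint_generator b s2 \<nu> \<phi> x)"

text \<open>Integrability is demanded explicitly, since the Bochner integral of a non-integrable
  function is \<open>0\<close> by convention.\<close>

definition weak_generator_constant ::
  "real \<Rightarrow> real \<Rightarrow> real measure \<Rightarrow> (real \<Rightarrow> real) \<Rightarrow> bool" where
  "weak_generator_constant b s2 \<nu> f \<longleftrightarrow> (\<exists>k. \<forall>\<phi>\<in>test_functions.
     integrable lborel (\<lambda>x. f x * adjoint_generator b s2 \<nu> \<phi> x) \<and>
     weak_generator b s2 \<nu> f \<phi> = k * (LINT x|lborel. \<phi> x))"

definition natural_filtration :: "'a measure \<Rightarrow> (real \<Rightarrow> 'a \<Rightarrow> real) \<Rightarrow> real \<Rightarrow> 'a measure" where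
  "natural_filtration M X t =
     sigma (space M) (\<Union>s\<in>{0..t}. {X s -` B \<inter> space M | B. B \<in> sets borel})"

definition martingale ::
  "'a measure \<Rightarrow> (real \<Rightarrow> 'a measure) \<Rightarrow> (real \<Rightarrow> 'a \<Rightarrow> real) \<Rightarrow> bool" where
  "martingale M F Y \<longleftrightarrow>
     (\<forall>t\<ge>0. integrable M (Y t) \<and> Y t \<in> borel_measurable (F t)) \<and>
     (\<forall>s\<ge>0. \<forall>t\<ge>s. AE \<omega> in M. real_cond_exp M (F s) (Y t) \<omega> = Y s \<omega>)"

end

(* The martingale property at the times t and 2 t, together with p_t > 0, turns into the convolution
   equation P f = f + k almost everywhere, where P u x = E u (x + X_t). Correcting f on a null set, it
   holds everywhere. Since p_t overlaps with each of its translates, P = A avg_h + R with positive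
   convolution operators A, R and avg_h u x = (u x + u (x + h)) / 2. A telescoping binomial sum gives
   |avg_h^j (u (_ + h) - u)| <= 2 sup |u| / sqrt (j + 1), so that differences of P^m u decay like
   m^(-1/2) with respect to the weight (m^2 + |x|)^n, while P^m enlarges polynomial weights only
   polynomially in m. Hence N-th differences of f vanish for N > 4 n, and f is a polynomial; comparing
   coefficients in P f = f + k leaves degree at most two, with E X_t = 0 if the degree is two. *)

theory Submission
  imports Defs
begin

text \<open>In case (b) the Fourier transform of the density has limited smoothness and cannot
  multiply a general tempered distribution, so the convolution equation is treated by weighted
  bounds in space. After m steps the walk has moved by O(m) in the n-th mean and contributes O(m^n)
  to a function of growth n, which is negligible against a weight of at least (m^2)^n; hence m^2 in
  the weight and not m. Since P^l g = g + l k, the function g equals P^l (g - l k) for every l, and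
  l k stays below the weight. Each difference uses m steps and gains m^(-1/2), so at a fixed point 4
  n + 1 differences beat the weight m^(2 n) as m grows. Both (a) and (b) enter through E |X_t|^n.
  The law and the triplet are then linked by E X_t = t (b + integral of y over |y| >= 1), found by
  comparing the characteristic function with the exponent near 0. This turns E X_t = 0 into the
  cancellation that makes the generator constant on quadratics.\<close>

section \<open>Kernels and polynomial growth\<close>

text \<open>The weight (1 + |x|)^n is preferred to 1 + |x|^n because it is submultiplicative under x
  + y, so that moments of a kernel bound the growth of its convolutions without extra
  constants.\<close>

definition pgrowth :: "nat \<Rightarrow> (real \<Rightarrow> real) \<Rightarrow> bool" where
  "pgrowth n u \<longleftrightarrow> u \<in> borel_measurable borel \<and> (\<exists>C. \<forall>x. \<bar>u x\<bar> \<le> C * (1 + \<bar>x\<bar>) ^ n)"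

text \<open>The total mass is left free, so that the two pieces into which a density is split are
  kernels as well.\<close>

definition kernel :: "nat \<Rightarrow> (real \<Rightarrow> real) \<Rightarrow> bool" where
  "kernel n q \<longleftrightarrow> q \<in> borel_measurable borel \<and> (\<forall>y. 0 \<le> q y) \<and>
     integrable lborel (\<lambda>y. q y * (1 + \<bar>y\<bar>) ^ n)"

text \<open>The sign in u (x + y) makes this the expectation after one step of a random walk started
  at x. It commutes with translations, hence with \<open>fwd_diff\<close> and
  \<open>avg\<close>.\<close>

definition conv_op :: "(real \<Rightarrow> real) \<Rightarrow> (real \<Rightarrow> real) \<Rightarrow> real \<Rightarrow> real" where
  "conv_op q u x = (LINT y|lborel. q y * u (x + y))"

definition fwd_diff :: "real \<Rightarrow> (real \<Rightarrow> real) \<Rightarrow> real \<Rightarrow> real" where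
  "fwd_diff h u x = u (x + h) - u x"

definition avg :: "real \<Rightarrow> (real \<Rightarrow> real) \<Rightarrow> real \<Rightarrow> real" where
  "avg h u x = (u x + u (x + h)) / 2"

lemma pgrowth_measurable: "pgrowth n u \<Longrightarrow> u \<in> borel_measurable borel"
  by (simp add: pgrowth_def)

lemma pgrowthE:
  assumes "pgrowth n u"
  obtains C where "C \<ge> 0" "\<And>x. \<bar>u x\<bar> \<le> C * (1 + \<bar>x\<bar>) ^ n"
proof -
  from assms obtain C where C: "\<And>x. \<bar>u x\<bar> \<le> C * (1 + \<bar>x\<bar>) ^ n" by (auto simp: pgrowth_def)
  have "0 \<le> C" using C[of 0] by simp
  with C that show thesis by blast
qed

lemma one_plus_abs_add: "(1 + \<bar>x + y\<bar>) ^ n \<le> (1 + \<bar>x\<bar>) ^ n * (1 + \<bar>y :: real\<bar>) ^ n"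
proof -
  have "1 + \<bar>x + y\<bar> \<le> (1 + \<bar>x\<bar>) * (1 + \<bar>y\<bar>)" by (simp add: algebra_simps) (smt (verit) mult_nonneg_nonneg)
  then have "(1 + \<bar>x + y\<bar>) ^ n \<le> ((1 + \<bar>x\<bar>) * (1 + \<bar>y\<bar>)) ^ n" by (intro power_mono) auto
  then show ?thesis by (simp add: power_mult_distrib)
qed

lemma pgrowth_shift:
  assumes "pgrowth n u" shows "pgrowth n (\<lambda>x. u (x + h))"
proof -
  obtain C where C: "C \<ge> 0" "\<And>x. \<bar>u x\<bar> \<le> C * (1 + \<bar>x\<bar>) ^ n" using pgrowthE[OF assms] by blast
  have [measurable]: "u \<in> borel_measurable borel" using assms by (rule pgrowth_measurable)
  have "\<bar>u (x + h)\<bar> \<le> (C * (1 + \<bar>h\<bar>) ^ n) * (1 + \<bar>x\<bar>) ^ n" for x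
    using C(2)[of "x + h"] mult_left_mono[OF one_plus_abs_add[of x h n] C(1)] by (simp add: mult_ac)
  moreover have "(\<lambda>x. u (x + h)) \<in> borel_measurable borel" by measurable
  ultimately show ?thesis unfolding pgrowth_def by blast
qed

lemma pgrowth_add:
  assumes "pgrowth n u" "pgrowth n v" shows "pgrowth n (\<lambda>x. u x + v x)"
proof -
  obtain C where C: "\<And>x. \<bar>u x\<bar> \<le> C * (1 + \<bar>x\<bar>) ^ n" using pgrowthE[OF assms(1)] by blast
  obtain D where D: "\<And>x. \<bar>v x\<bar> \<le> D * (1 + \<bar>x\<bar>) ^ n" using pgrowthE[OF assms(2)] by blast
  have "\<bar>u x + v x\<bar> \<le> (C + D) * (1 + \<bar>x\<bar>) ^ n" for x
    using C[of x] D[of x] by (simp add: algebra_simps)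
  moreover have "(\<lambda>x. u x + v x) \<in> borel_measurable borel"
    using assms by (auto simp: pgrowth_def)
  ultimately show ?thesis unfolding pgrowth_def by blast
qed

lemma pgrowth_scale:
  assumes "pgrowth n u" shows "pgrowth n (\<lambda>x. c * u x)"
proof -
  obtain C where C: "\<And>x. \<bar>u x\<bar> \<le> C * (1 + \<bar>x\<bar>) ^ n" using pgrowthE[OF assms(1)] by blast
  have "\<bar>c * u x\<bar> \<le> (\<bar>c\<bar> * C) * (1 + \<bar>x\<bar>) ^ n" for x
    using mult_left_mono[OF C[of x], of "\<bar>c\<bar>"] by (simp add: abs_mult mult_ac)
  moreover have "(\<lambda>x. c * u x) \<in> borel_measurable borel"
    using assms by (auto simp: pgrowth_def)
  ultimately show ?thesis unfolding pgrowth_def by blast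
qed

lemma pgrowth_const: "pgrowth n (\<lambda>x. c)"
proof -
  have "\<bar>c\<bar> \<le> \<bar>c\<bar> * (1 + \<bar>x\<bar>) ^ n" for x :: real
    using mult_left_mono[OF one_le_power[of "1 + \<bar>x\<bar>" n], of "\<bar>c\<bar>"] by simp
  then show ?thesis unfolding pgrowth_def by auto
qed

lemma pgrowth_diff_op: "pgrowth n u \<Longrightarrow> pgrowth n (fwd_diff h u)"
  unfolding fwd_diff_def[abs_def]
  using pgrowth_add[OF pgrowth_shift[of n u h] pgrowth_scale[of n u "-1"]] by simp

lemma pgrowth_avg: "pgrowth n u \<Longrightarrow> pgrowth n (avg h u)"
  unfolding avg_def[abs_def]
  using pgrowth_scale[OF pgrowth_add[OF _ pgrowth_shift[of n u h]], where c = "1/2"] by simp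

lemma pgrowth_weight: "L \<ge> 0 \<Longrightarrow> pgrowth n (\<lambda>x. (L + \<bar>x\<bar>) ^ n)"
proof -
  assume L: "L \<ge> 0"
  have "\<bar>(L + \<bar>x\<bar>) ^ n\<bar> \<le> (1 + L) ^ n * (1 + \<bar>x\<bar>) ^ n" for x
  proof -
    have "L + \<bar>x\<bar> \<le> (1 + L) * (1 + \<bar>x\<bar>)" using L by (simp add: algebra_simps)
    then have "(L + \<bar>x\<bar>) ^ n \<le> ((1 + L) * (1 + \<bar>x\<bar>)) ^ n" using L by (intro power_mono) auto
    then show ?thesis using L by (simp add: power_mult_distrib)
  qed
  then show ?thesis unfolding pgrowth_def by auto
qed

lemma conv_op_integrable:
  assumes q: "kernel n q" and u: "pgrowth n u"
  shows "integrable lborel (\<lambda>y. q y * u (x + y))"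
proof -
  obtain C where C: "C \<ge> 0" "\<And>x. \<bar>u x\<bar> \<le> C * (1 + \<bar>x\<bar>) ^ n" using pgrowthE[OF u] by blast
  have [measurable]: "u \<in> borel_measurable borel" "q \<in> borel_measurable borel"
    using u q by (auto simp: pgrowth_def kernel_def)
  have q0: "\<And>y. 0 \<le> q y" using q by (simp add: kernel_def)
  show ?thesis
  proof (rule Bochner_Integration.integrable_bound)
    show "integrable lborel (\<lambda>y. C * (1 + \<bar>x\<bar>) ^ n * (q y * (1 + \<bar>y\<bar>) ^ n))"
      using q by (intro integrable_mult_right) (simp add: kernel_def)
    have "\<bar>q y * u (x + y)\<bar> \<le> C * (1 + \<bar>x\<bar>) ^ n * (q y * (1 + \<bar>y\<bar>) ^ n)" for y
    proof -
      have "\<bar>u (x + y)\<bar> \<le> C * ((1 + \<bar>x\<bar>) ^ n * (1 + \<bar>y\<bar>) ^ n)"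
        using C(2)[of "x + y"] mult_left_mono[OF one_plus_abs_add[of x y n] C(1)] by linarith
      from mult_left_mono[OF this q0[of y]] show ?thesis using q0[of y] by (simp add: abs_mult mult_ac)
    qed
    then show "AE y in lborel. norm (q y * u (x + y)) \<le> norm (C * (1 + \<bar>x\<bar>) ^ n * (q y * (1 + \<bar>y\<bar>) ^ n))"
      by (intro AE_I2) (metis abs_ge_self order_trans real_norm_def)
  qed measurable
qed

lemma conv_op_mono:
  assumes "kernel n q" "pgrowth n u" "pgrowth n v" "\<And>x. u x \<le> v x"
  shows "conv_op q u x \<le> conv_op q v x"
  unfolding conv_op_def using assms
  by (intro integral_mono conv_op_integrable mult_left_mono) (auto simp: kernel_def)

lemma conv_op_add:
  assumes "kernel n q" "pgrowth n u" "pgrowth n v"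
  shows "conv_op q (\<lambda>x. u x + v x) x = conv_op q u x + conv_op q v x"
  unfolding conv_op_def using conv_op_integrable[OF assms(1,2)] conv_op_integrable[OF assms(1,3)]
  by (simp add: distrib_left)

lemma conv_op_scale: "conv_op q (\<lambda>x. c * u x) x = c * conv_op q u x"
proof -
  have "(\<lambda>y. q y * (c * u (x + y))) = (\<lambda>y. c * (q y * u (x + y)))" by (simp add: mult_ac)
  then show ?thesis unfolding conv_op_def by simp
qed

lemma conv_op_const: "conv_op q (\<lambda>x. c) x = c * (LINT y|lborel. q y)"
  unfolding conv_op_def by (simp add: mult.commute)

lemma conv_op_shift: "conv_op q (\<lambda>x. u (x + h)) x = conv_op q u (x + h)"
  unfolding conv_op_def by (simp add: add_ac)

lemma conv_op_abs_le:
  assumes "kernel n q" "pgrowth n u" "pgrowth n v" "\<And>x. \<bar>u x\<bar> \<le> v x"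
  shows "\<bar>conv_op q u x\<bar> \<le> conv_op q v x"
proof -
  have "conv_op q u x \<le> conv_op q v x"
    by (rule conv_op_mono[OF assms(1-3)]) (use assms(4) abs_le_D1 in blast)
  moreover have "conv_op q (\<lambda>x. (-1) * u x) x \<le> conv_op q v x"
    by (rule conv_op_mono[OF assms(1) pgrowth_scale[OF assms(2)] assms(3)]) (use assms(4) abs_le_D2 in auto)
  ultimately show ?thesis unfolding conv_op_scale by linarith
qed

lemma pgrowth_conv_op:
  assumes q: "kernel n q" and u: "pgrowth n u"
  shows "pgrowth n (conv_op q u)"
proof -
  obtain C where C: "C \<ge> 0" "\<And>x. \<bar>u x\<bar> \<le> C * (1 + \<bar>x\<bar>) ^ n" using pgrowthE[OF u] by blast
  have [measurable]: "u \<in> borel_measurable borel" "q \<in> borel_measurable borel"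
    using u q by (auto simp: pgrowth_def kernel_def)
  have q0: "\<And>y. 0 \<le> q y" using q by (simp add: kernel_def)
  have "conv_op q u \<in> borel_measurable borel" unfolding conv_op_def[abs_def] by measurable
  moreover have "\<bar>conv_op q u x\<bar> \<le> (C * (LINT y|lborel. q y * (1 + \<bar>y\<bar>) ^ n)) * (1 + \<bar>x\<bar>) ^ n" for x
  proof -
    have "\<bar>conv_op q u x\<bar> \<le> conv_op q (\<lambda>x. C * (1 + \<bar>x\<bar>) ^ n) x"
      using C by (intro conv_op_abs_le[OF q u] pgrowth_scale pgrowth_weight) auto
    also have "\<dots> \<le> (LINT y|lborel. C * (1 + \<bar>x\<bar>) ^ n * (q y * (1 + \<bar>y\<bar>) ^ n))"
      unfolding conv_op_def
    proof (intro integral_mono)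
      show "integrable lborel (\<lambda>y. q y * (C * (1 + \<bar>x + y\<bar>) ^ n))"
        by (intro conv_op_integrable[OF q] pgrowth_scale pgrowth_weight) auto
      show "integrable lborel (\<lambda>y. C * (1 + \<bar>x\<bar>) ^ n * (q y * (1 + \<bar>y\<bar>) ^ n))"
        using q by (intro integrable_mult_right) (simp add: kernel_def)
      fix y
      show "q y * (C * (1 + \<bar>x + y\<bar>) ^ n) \<le> C * (1 + \<bar>x\<bar>) ^ n * (q y * (1 + \<bar>y\<bar>) ^ n)"
        using mult_left_mono[OF mult_left_mono[OF one_plus_abs_add[of x y n] C(1)] q0[of y]]
        by (simp add: mult_ac)
    qed
    also have "\<dots> = (C * (LINT y|lborel. q y * (1 + \<bar>y\<bar>) ^ n)) * (1 + \<bar>x\<bar>) ^ n" by simp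
    finally show ?thesis .
  qed
  ultimately show ?thesis unfolding pgrowth_def by blast
qed

lemma kernel_integrable:
  assumes "kernel n q" shows "integrable lborel q"
  using conv_op_integrable[OF assms pgrowth_const[where c = 1]] by simp

lemma conv_op_diff:
  assumes "kernel n q" "pgrowth n u"
  shows "conv_op q (fwd_diff h u) x = fwd_diff h (conv_op q u) x"
proof -
  have "conv_op q (fwd_diff h u) x = conv_op q (\<lambda>x. u (x + h) + (-1) * u x) x" by (simp add: fwd_diff_def[abs_def])
  also have "\<dots> = conv_op q u (x + h) + (-1) * conv_op q u x"
    by (subst conv_op_add[OF assms(1) pgrowth_shift[OF assms(2)] pgrowth_scale[OF assms(2)]])
       (simp only: conv_op_shift conv_op_scale)
  finally show ?thesis by (simp add: fwd_diff_def)
qed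

lemma conv_op_avg:
  assumes "kernel n q" "pgrowth n u"
  shows "conv_op q (avg h u) x = avg h (conv_op q u) x"
proof -
  have "conv_op q (avg h u) x = conv_op q (\<lambda>x. (1/2) * (u x + u (x + h))) x" by (simp add: avg_def[abs_def])
  also have "\<dots> = (1/2) * (conv_op q u x + conv_op q u (x + h))"
    unfolding conv_op_scale
    by (subst conv_op_add[OF assms(1) assms(2) pgrowth_shift[OF assms(2)]]) (simp add: conv_op_shift)
  finally show ?thesis by (simp add: avg_def)
qed

lemma pgrowth_conv_pow: "kernel n q \<Longrightarrow> pgrowth n u \<Longrightarrow> pgrowth n ((conv_op q ^^ m) u)"
  by (induction m) (auto intro: pgrowth_conv_op)

lemma conv_pow_add:
  assumes "kernel n q" "pgrowth n u" "pgrowth n v"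
  shows "(conv_op q ^^ m) (\<lambda>x. u x + v x) = (\<lambda>x. (conv_op q ^^ m) u x + (conv_op q ^^ m) v x)"
  by (induction m) (simp_all add: ext[OF conv_op_add[OF assms(1) pgrowth_conv_pow pgrowth_conv_pow]] assms)

lemma conv_pow_scale: "(conv_op q ^^ m) (\<lambda>x. c * u x) = (\<lambda>x. c * (conv_op q ^^ m) u x)"
  by (induction m) (simp_all add: ext[OF conv_op_scale])

lemma conv_pow_shift: "(conv_op q ^^ m) (\<lambda>x. u (x + h)) = (\<lambda>x. (conv_op q ^^ m) u (x + h))"
proof (induction m)
  case (Suc m)
  have "(conv_op q ^^ Suc m) (\<lambda>x. u (x + h)) = conv_op q (\<lambda>x. (conv_op q ^^ m) u (x + h))"
    using Suc by simp
  then show ?case by (simp add: conv_op_shift fun_eq_iff)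
qed simp

lemma conv_pow_mono:
  assumes "kernel n q" "pgrowth n u" "pgrowth n v" "\<And>x. u x \<le> v x"
  shows "(conv_op q ^^ m) u x \<le> (conv_op q ^^ m) v x"
  using assms by (induction m arbitrary: x) (auto intro!: conv_op_mono[of n] pgrowth_conv_pow)

lemma conv_pow_diff:
  assumes "kernel n q" "pgrowth n u"
  shows "(conv_op q ^^ m) (fwd_diff h u) = fwd_diff h ((conv_op q ^^ m) u)"
  by (induction m) (simp_all add: ext[OF conv_op_diff[OF assms(1) pgrowth_conv_pow[OF assms]]])

section \<open>Binomial averages of differences\<close>

definition bin_diff :: "real \<Rightarrow> nat \<Rightarrow> (real \<Rightarrow> real) \<Rightarrow> real \<Rightarrow> real" where
  "bin_diff h j u = (avg h ^^ j) (fwd_diff h u)"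

text \<open>Same construction as \<open>bin_diff\<close> with the sign of the difference removed.
  Its coefficients dominate the absolute values of those of \<open>bin_diff\<close>, so it controls
  the unbounded part of a function, for which no decay is sought.\<close>

definition bin_sum :: "real \<Rightarrow> nat \<Rightarrow> (real \<Rightarrow> real) \<Rightarrow> real \<Rightarrow> real" where
  "bin_sum h j w = (avg h ^^ j) (\<lambda>x. w (x + h) + w x)"

text \<open>Pascal's rule for arbitrary coefficients. The vanishing of \<open>c (Suc N)\<close> lets
  the unshifted sum run one index further, so that both sums have the same range.\<close>

lemma avg_sum:
  assumes "c (Suc N) = 0"
  shows "avg h (\<lambda>x. \<Sum>i\<le>N. c i * u (x + real i * h)) x
     = (\<Sum>i\<le>Suc N. (c i + (if i = 0 then 0 else c (i - 1))) / 2 * u (x + real i * h))"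
proof -
  have "(\<Sum>i\<le>Suc N. (c i + (if i = 0 then 0 else c (i - 1))) / 2 * u (x + real i * h))
     = (\<Sum>i\<le>Suc N. c i / 2 * u (x + real i * h))
       + (\<Sum>i\<le>Suc N. (if i = 0 then 0 else c (i - 1)) / 2 * u (x + real i * h))"
    unfolding sum.distrib[symmetric] by (intro sum.cong refl) (simp only: add_divide_distrib distrib_right)
  also have "(\<Sum>i\<le>Suc N. c i / 2 * u (x + real i * h)) = (\<Sum>i\<le>N. c i / 2 * u (x + real i * h))"
    using assms by simp
  also have "(\<Sum>i\<le>Suc N. (if i = 0 then 0 else c (i - 1)) / 2 * u (x + real i * h))
     = (\<Sum>i\<le>N. c i / 2 * u (x + h + real i * h))"
    by (subst sum.atMost_Suc_shift) (simp add: distrib_right add.assoc)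
  finally show ?thesis
    by (simp add: avg_def add_divide_distrib sum_divide_distrib)
qed

text \<open>With T the translation by h, the operator is ((1 + T) / 2)^j (1 + T). The initial sum
  already supplies one factor, which explains \<open>Suc j\<close> beside 2^j.\<close>

lemma bin_sum_eq:
  "bin_sum h j w x = (\<Sum>i\<le>Suc j. real (Suc j choose i) / 2 ^ j * w (x + real i * h))"
proof (induction j arbitrary: x)
  case 0 show ?case by (simp add: bin_sum_def)
next
  case (Suc j)
  have "bin_sum h (Suc j) w x = avg h (\<lambda>x. \<Sum>i\<le>Suc j. real (Suc j choose i) / 2 ^ j * w (x + real i * h)) x"
    using Suc.IH by (simp add: bin_sum_def avg_def)
  also have "\<dots> = (\<Sum>i\<le>Suc (Suc j). real (Suc (Suc j) choose i) / 2 ^ Suc j * w (x + real i * h))"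
  proof (subst avg_sum)
    show "real (Suc j choose Suc (Suc j)) / 2 ^ j = 0" by (simp add: binomial_eq_0 del: binomial_Suc_Suc)
    have *: "real (Suc j choose i) + (if i = 0 then 0 else real (Suc j choose (i - 1))) = real (Suc (Suc j) choose i)" for i
      by (cases i) auto
    have "(real (Suc j choose i) / 2 ^ j + (if i = 0 then 0 else real (Suc j choose (i - 1)) / 2 ^ j)) / 2
        = real (Suc (Suc j) choose i) / 2 ^ Suc j" for i
      unfolding *[symmetric] by (simp add: add_divide_distrib)
    then show "(\<Sum>i\<le>Suc (Suc j). (real (Suc j choose i) / 2 ^ j + (if i = 0 then 0 else real (Suc j choose (i - 1)) / 2 ^ j)) / 2
          * w (x + real i * h)) = (\<Sum>i\<le>Suc (Suc j). real (Suc (Suc j) choose i) / 2 ^ Suc j * w (x + real i * h))"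
      by (intro sum.cong refl) (simp only:)
  qed
  finally show ?case .
qed

text \<open>Coefficient of z^i in (z - 1) (1 + z)^j. The case i = 0 is separate because
  \<open>i - 1\<close> is truncated there.\<close>

definition dcoef :: "nat \<Rightarrow> nat \<Rightarrow> real" where
  "dcoef j i = ((if i = 0 then 0 else real (j choose (i - 1))) - real (j choose i))"

lemma bin_diff_eq:
  "bin_diff h j u x = (\<Sum>i\<le>Suc j. dcoef j i / 2 ^ j * u (x + real i * h))"
proof (induction j arbitrary: x)
  case 0 show ?case by (simp add: bin_diff_def fwd_diff_def dcoef_def)
next
  case (Suc j)
  have "bin_diff h (Suc j) u x = avg h (\<lambda>x. \<Sum>i\<le>Suc j. dcoef j i / 2 ^ j * u (x + real i * h)) x"
    using Suc.IH by (simp add: bin_diff_def avg_def)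
  also have "\<dots> = (\<Sum>i\<le>Suc (Suc j). dcoef (Suc j) i / 2 ^ Suc j * u (x + real i * h))"
  proof (subst avg_sum)
    show "dcoef j (Suc (Suc j)) / 2 ^ j = 0" by (simp add: dcoef_def binomial_eq_0)
    have *: "dcoef j i + (if i = 0 then 0 else dcoef j (i - 1)) = dcoef (Suc j) i" for i
      by (cases i; cases "i - 1") (auto simp: dcoef_def)
    have "(dcoef j i / 2 ^ j + (if i = 0 then 0 else dcoef j (i - 1) / 2 ^ j)) / 2 = dcoef (Suc j) i / 2 ^ Suc j" for i
      unfolding *[symmetric] by (simp add: add_divide_distrib)
    then show "(\<Sum>i\<le>Suc (Suc j). (dcoef j i / 2 ^ j + (if i = 0 then 0 else dcoef j (i - 1) / 2 ^ j)) / 2 * u (x + real i * h)) =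
      (\<Sum>i\<le>Suc (Suc j). dcoef (Suc j) i / 2 ^ Suc j * u (x + real i * h))"
      by (intro sum.cong refl) (simp only:)
  qed
  finally show ?case .
qed

lemma dcoef_le: "\<bar>dcoef j i\<bar> \<le> real (Suc j choose i)"
  by (cases i) (auto simp: dcoef_def)

text \<open>Absorption identities for binomial coefficients. The factor 2 i - (j + 1) turns the sum
  of the absolute values of \<open>dcoef\<close> into a mean absolute deviation of a binomial
  variable, to which a variance bound applies.\<close>

lemma dcoef_eq: "i \<le> Suc j \<Longrightarrow> real (Suc j) * dcoef j i = real (Suc j choose i) * (2 * real i - real (Suc j))"
proof (cases i)
  case 0 then show ?thesis by (simp add: dcoef_def)
next
  case (Suc k)
  assume i: "i \<le> Suc j"
  have a: "real (Suc j) * real (j choose k) = real (Suc k) * real (Suc j choose Suc k)"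
    using Suc_times_binomial[of k j] by (metis of_nat_mult)
  have b: "real (Suc j) * real (j choose Suc k) = (real (Suc j) - real (Suc k)) * real (Suc j choose Suc k)"
  proof -
    have "real (j choose Suc k) = real (Suc j choose Suc k) - real (j choose k)" by simp
    then show ?thesis using a by (simp add: algebra_simps)
  qed
  show ?thesis unfolding dcoef_def Suc using a b by (simp add: algebra_simps)
qed

text \<open>Variance of a sum of N independent signs, times 2^N. It is read off from the Bernstein
  polynomial identities at 1/2 after writing (2 i - N)^2 through i (i - 1), i and 1.\<close>

lemma sum_choose_square: "(\<Sum>i\<le>N. real (N choose i) * (2 * real i - real N)\<^sup>2) = real N * 2 ^ N"
proof -
  have B: "Bernstein N k (1/2) * 2 ^ N = real (N choose k)" if "k \<le> N" for k
    using that by (simp add: Bernstein_def power_add[symmetric] power_one_over)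
  have "(\<Sum>i\<le>N. real (N choose i) * (2 * real i - real N)\<^sup>2)
     = (\<Sum>i\<le>N. 2 ^ N * (4 * (real i * (real i - 1) * Bernstein N i (1/2)) +
          (4 - 4 * real N) * (real i * Bernstein N i (1/2)) + (real N)\<^sup>2 * Bernstein N i (1/2)))"
    by (intro sum.cong) (auto simp: B[symmetric] power2_eq_square algebra_simps)
  also have "\<dots> = 2 ^ N * (4 * (\<Sum>i\<le>N. real i * (real i - 1) * Bernstein N i (1/2)) +
          (4 - 4 * real N) * (\<Sum>i\<le>N. real i * Bernstein N i (1/2)) + (real N)\<^sup>2 * (\<Sum>i\<le>N. Bernstein N i (1/2)))"
    unfolding sum_distrib_left sum.distrib[symmetric] ..
  also have "\<dots> = real N * 2 ^ N"
    unfolding sum_Bernstein sum_k_Bernstein sum_kk_Bernstein by (simp add: power2_eq_square field_simps)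
  finally show ?thesis .
qed

text \<open>For S binomial with N = j + 1 trials and parameter 1/2, \<open>dcoef_eq\<close> makes
  the sum equal to 2 E |2 S - N| / N, and E |2 S - N| is at most the standard deviation sqrt
  N.\<close>

lemma sum_dcoef: "(\<Sum>i\<le>Suc j. \<bar>dcoef j i\<bar> / 2 ^ j) \<le> 2 / sqrt (real (Suc j))"
proof -
  define N where "N = Suc j"
  have N: "real N > 0" by (simp add: N_def)
  \<comment> \<open>Cauchy-Schwarz in pointwise form. The scale sqrt N balances the two terms
    because the mean of t^2 will be N.\<close>
  have amgm: "\<bar>t\<bar> \<le> (t\<^sup>2 / sqrt N + sqrt N) / 2" for t :: real
  proof -
    have "0 \<le> (\<bar>t\<bar> - sqrt N)\<^sup>2" by simp
    then have "2 * \<bar>t\<bar> * sqrt N \<le> t\<^sup>2 + sqrt N * sqrt N" using N by (simp add: power2_diff)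
    then show ?thesis using N by (simp add: field_simps)
  qed
  have "(\<Sum>i\<le>N. \<bar>dcoef j i\<bar>) = (\<Sum>i\<le>N. real (N choose i) * \<bar>2 * real i - real N\<bar> / real N)"
  proof (intro sum.cong refl)
    fix i assume "i \<in> {..N}"
    then have "real N * dcoef j i = real (N choose i) * (2 * real i - real N)"
      using dcoef_eq[of i j] by (simp add: N_def)
    then have "dcoef j i = real (N choose i) * (2 * real i - real N) / real N"
      using N by (simp add: field_simps)
    then show "\<bar>dcoef j i\<bar> = real (N choose i) * \<bar>2 * real i - real N\<bar> / real N"
      by (simp add: abs_mult)
  qed
  also have "\<dots> \<le> (\<Sum>i\<le>N. real (N choose i) * (((2 * real i - real N)\<^sup>2 / sqrt N + sqrt N) / 2) / real N)"
    by (intro sum_mono divide_right_mono mult_left_mono amgm) auto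
  also have "\<dots> = ((\<Sum>i\<le>N. real (N choose i) * (2 * real i - real N)\<^sup>2) / sqrt N
       + (\<Sum>i\<le>N. real (N choose i)) * sqrt N) / (2 * real N)"
    unfolding sum_distrib_right sum_divide_distrib sum.distrib[symmetric]
    using N by (intro sum.cong refl) (simp add: field_simps)
  also have "(\<Sum>i\<le>N. real (N choose i)) = 2 ^ N"
    using choose_row_sum[of N] by (metis of_nat_numeral of_nat_power of_nat_sum)
  also have "((\<Sum>i\<le>N. real (N choose i) * (2 * real i - real N)\<^sup>2) / sqrt N + 2 ^ N * sqrt N) / (2 * real N)
     = 2 ^ N / sqrt N"
    unfolding sum_choose_square using N by (simp add: field_simps real_sqrt_mult_self)
  finally have "(\<Sum>i\<le>N. \<bar>dcoef j i\<bar>) \<le> 2 ^ N / sqrt N" .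
  then have "(\<Sum>i\<le>N. \<bar>dcoef j i\<bar>) / 2 ^ j \<le> 2 ^ N / sqrt N / 2 ^ j" by (intro divide_right_mono) auto
  then show ?thesis by (simp only: sum_divide_distrib N_def power_Suc) simp
qed

text \<open>The bounded part D benefits from the small sum of the coefficients; the part below w is
  estimated coefficient by coefficient with \<open>dcoef_le\<close>.\<close>

lemma bin_diff_bound:
  assumes "\<And>x. \<bar>u x\<bar> \<le> D + w x" "D \<ge> 0" "\<And>x. 0 \<le> w x"
  shows "\<bar>bin_diff h j u x\<bar> \<le> D * (2 / sqrt (real (Suc j))) + bin_sum h j w x"
proof -
  have "\<bar>bin_diff h j u x\<bar> \<le> (\<Sum>i\<le>Suc j. \<bar>dcoef j i / 2 ^ j * u (x + real i * h)\<bar>)"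
    unfolding bin_diff_eq by (rule sum_abs)
  also have "\<dots> \<le> (\<Sum>i\<le>Suc j. D * (\<bar>dcoef j i\<bar> / 2 ^ j) + real (Suc j choose i) / 2 ^ j * w (x + real i * h))"
  proof (intro sum_mono)
    fix i
    have "\<bar>dcoef j i / 2 ^ j * u (x + real i * h)\<bar> = \<bar>dcoef j i\<bar> / 2 ^ j * \<bar>u (x + real i * h)\<bar>"
      by (simp add: abs_mult)
    also have "\<dots> \<le> \<bar>dcoef j i\<bar> / 2 ^ j * (D + w (x + real i * h))"
      by (intro mult_left_mono assms) auto
    also have "\<dots> = D * (\<bar>dcoef j i\<bar> / 2 ^ j) + \<bar>dcoef j i\<bar> / 2 ^ j * w (x + real i * h)"
      by (simp add: algebra_simps add_divide_distrib)
    also have "\<dots> \<le> D * (\<bar>dcoef j i\<bar> / 2 ^ j) + real (Suc j choose i) / 2 ^ j * w (x + real i * h)"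
      by (intro add_left_mono mult_right_mono divide_right_mono dcoef_le assms) auto
    finally show "\<bar>dcoef j i / 2 ^ j * u (x + real i * h)\<bar>
      \<le> D * (\<bar>dcoef j i\<bar> / 2 ^ j) + real (Suc j choose i) / 2 ^ j * w (x + real i * h)" .
  qed
  also have "\<dots> = D * (\<Sum>i\<le>Suc j. \<bar>dcoef j i\<bar> / 2 ^ j) + bin_sum h j w x"
    unfolding bin_sum_eq by (simp only: sum.distrib sum_distrib_left)
  also have "\<dots> \<le> D * (2 / sqrt (real (Suc j))) + bin_sum h j w x"
    by (intro add_right_mono mult_left_mono sum_dcoef assms)
  finally show ?thesis .
qed

text \<open>One step of a counter that moves from s to s + 1 with probability a. As 1 / sqrt is
  convex, Jensen's inequality goes the wrong way for s + a; giving up half of the mean gain makes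
  the estimate true for s >= 1.\<close>

lemma sqrt_step:
  fixes s a :: real assumes s: "s \<ge> 1" and a: "0 \<le> a" "a \<le> 1"
  shows "a / sqrt (s + 1) + (1 - a) / sqrt s \<le> 1 / sqrt (s + a / 2)"
proof -
  define z where "z = 1 / s"
  have z: "0 < z" "z \<le> 1" using s by (auto simp: z_def)
  have sz: "s + 1 = s * (1 + z)" "s + a / 2 = s * (1 + a * z / 2)" using s by (auto simp: z_def field_simps)
  \<comment> \<open>After the factor 1 / sqrt s is removed, the value 1 - a z / 4 separates the two
    sides: this bound on 0 < z <= 1 puts the left side below it, and the next one puts the right
    side above it.\<close>
  have 1: "1 / sqrt (1 + z) \<le> 1 - z / 4"
  proof -
    have "(1 - z/4)\<^sup>2 * (1 + z) - 1 = z * (8 - 7 * z + z * z) / 16"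
      by (simp add: power2_eq_square field_simps)
    also have "\<dots> \<ge> 0" using z by (intro divide_nonneg_pos mult_nonneg_nonneg) (auto simp: add_nonneg_nonneg)
    finally have "1 \<le> (1 - z/4)\<^sup>2 * (1 + z)" by simp
    then have "sqrt 1 \<le> sqrt ((1 - z/4)\<^sup>2 * (1 + z))" by (rule real_sqrt_le_mono)
    then have "1 \<le> (1 - z/4) * sqrt (1 + z)" using z by (simp add: real_sqrt_mult)
    then show ?thesis using z by (simp add: divide_le_eq)
  qed
  have 2: "1 - a * z / 4 \<le> 1 / sqrt (1 + a * z / 2)"
  proof -
    define x where "x = a * z / 2"
    have x: "0 \<le> x" "x \<le> 1/2" using z a mult_mono[of a 1 z 1] by (auto simp: x_def)
    have "1 - (1 - x/2)\<^sup>2 * (1 + x) = x * x * (3 - x) / 4"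
      by (simp add: power2_eq_square field_simps)
    also have "\<dots> \<ge> 0" using x by (intro divide_nonneg_pos mult_nonneg_nonneg) auto
    finally have "(1 - x/2)\<^sup>2 * (1 + x) \<le> 1" by simp
    then have "sqrt ((1 - x/2)\<^sup>2 * (1 + x)) \<le> sqrt 1" by (rule real_sqrt_le_mono)
    then have "(1 - x/2) * sqrt (1 + x) \<le> 1" using x by (simp add: real_sqrt_mult)
    then show ?thesis using x unfolding x_def by (simp add: le_divide_eq)
  qed
  have "a * (1 / sqrt (1 + z)) + (1 - a) \<le> a * (1 - z/4) + (1 - a)"
    using a 1 by (intro add_right_mono mult_left_mono)
  also have "\<dots> = 1 - a * z / 4" by (simp add: algebra_simps)
  also note 2
  finally have "(a * (1 / sqrt (1 + z)) + (1 - a)) / sqrt s \<le> (1 / sqrt (1 + a * z / 2)) / sqrt s"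
    using s by (intro divide_right_mono) auto
  then show ?thesis unfolding sz real_sqrt_mult by (simp add: add_divide_distrib mult_ac)
qed

lemma pgrowth_bin_diff: "pgrowth n u \<Longrightarrow> pgrowth n (bin_diff h j u)"
  unfolding bin_diff_def by (induction j) (auto intro: pgrowth_avg pgrowth_diff_op)

lemma pgrowth_bin_sum: "pgrowth n u \<Longrightarrow> pgrowth n (bin_sum h j u)"
  unfolding bin_sum_def by (induction j) (auto intro: pgrowth_avg pgrowth_add pgrowth_shift)

lemma conv_op_bin_diff:
  assumes "kernel n q" "pgrowth n u"
  shows "conv_op q (bin_diff h j u) = bin_diff h j (conv_op q u)"
proof (induction j)
  case 0 show ?case by (simp add: bin_diff_def ext[OF conv_op_diff[OF assms]])
next
  case (Suc j)
  have "conv_op q (avg h (bin_diff h j u)) = avg h (conv_op q (bin_diff h j u))"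
    by (rule ext, rule conv_op_avg[OF assms(1) pgrowth_bin_diff[OF assms(2)]])
  then show ?case using Suc by (simp add: bin_diff_def)
qed

lemma conv_op_bin_sum:
  assumes "kernel n q" "pgrowth n u"
  shows "conv_op q (bin_sum h j u) = bin_sum h j (conv_op q u)"
proof (induction j)
  case 0 show ?case
    by (simp add: bin_sum_def fun_eq_iff conv_op_add[OF assms(1) pgrowth_shift[OF assms(2)] assms(2)] conv_op_shift)
next
  case (Suc j)
  have "conv_op q (avg h (bin_sum h j u)) = avg h (conv_op q (bin_sum h j u))"
    by (rule ext, rule conv_op_avg[OF assms(1) pgrowth_bin_sum[OF assms(2)]])
  then show ?case using Suc by (simp add: bin_sum_def)
qed

lemma bin_diff_avg: "bin_diff h j (avg h u) = bin_diff h (Suc j) u"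
proof -
  have "fwd_diff h (avg h u) = avg h (fwd_diff h u)"
    by (intro ext) (simp add: fwd_diff_def avg_def field_simps)
  then show ?thesis unfolding bin_diff_def by (simp add: funpow_swap1)
qed

lemma bin_sum_avg: "bin_sum h j (avg h u) = bin_sum h (Suc j) u"
proof -
  have "(\<lambda>x. avg h u (x + h) + avg h u x) = avg h (\<lambda>x. u (x + h) + u x)"
    by (intro ext) (simp add: avg_def field_simps)
  then show ?thesis unfolding bin_sum_def by (simp add: funpow_swap1)
qed

lemma bin_diff_add: "bin_diff h j (\<lambda>x. u x + v x) x = bin_diff h j u x + bin_diff h j v x"
  unfolding bin_diff_eq by (simp only: sum.distrib[symmetric] distrib_left)

lemma bin_sum_add: "bin_sum h j (\<lambda>x. u x + v x) x = bin_sum h j u x + bin_sum h j v x"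
  unfolding bin_sum_eq by (simp only: sum.distrib[symmetric] distrib_left)

text \<open>Each step of the walk either averages over a step \<open>h\<close>, which improves the difference
  operator by one binomial index, or does not touch it.\<close>
lemma conv_pow_bin_diff_bound:
  assumes p: "kernel n p" and al: "kernel n al" and r: "kernel n r"
    and split: "\<And>u x. pgrowth n u \<Longrightarrow> conv_op p u x = conv_op al (avg h u) x + conv_op r u x"
    and a: "(LINT y|lborel. al y) = a" "(LINT y|lborel. r y) = 1 - a" "0 \<le> a" "a \<le> 1"
    and u: "pgrowth n u" and w: "pgrowth n w" "\<And>x. 0 \<le> w x"
    and D: "D \<ge> 0" "\<And>x. \<bar>u x\<bar> \<le> D + w x"
  shows "\<bar>(conv_op p ^^ m) (bin_diff h j u) x\<bar>
     \<le> D * (2 / sqrt (real (Suc j) + a / 2 * real m)) + (conv_op p ^^ m) (bin_sum h j w) x"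
  using u w D
proof (induction m arbitrary: u w D j)
  case 0
  then show ?case using bin_diff_bound[of u D w h j x] by simp
next
  case (Suc m)
  define s where "s = real (Suc j) + a / 2 * real m"
  have s: "s \<ge> 1" using a unfolding s_def by simp
  note pg = \<open>pgrowth n u\<close> \<open>pgrowth n w\<close>
  have Dw: "pgrowth n (\<lambda>x. D + w x)" by (intro pgrowth_add pgrowth_const Suc.prems)
  have bnd: "\<bar>conv_op q u x\<bar> \<le> D * (LINT y|lborel. q y) + conv_op q w x" if q: "kernel n q" for q x
  proof -
    have "\<bar>conv_op q u x\<bar> \<le> conv_op q (\<lambda>x. D + w x) x"
      by (rule conv_op_abs_le[OF q pg(1) Dw]) (use Suc.prems in auto)
    also have "\<dots> = D * (LINT y|lborel. q y) + conv_op q w x"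
      by (simp add: conv_op_add[OF q pgrowth_const pg(2)] conv_op_const)
    finally show ?thesis .
  qed
  have nonneg: "0 \<le> conv_op q w x" if q: "kernel n q" for q x
    using conv_op_mono[OF q pgrowth_const[of n 0] pg(2), of x] Suc.prems by (simp add: conv_op_const)
  have decomp: "conv_op p v = (\<lambda>x. avg h (conv_op al v) x + conv_op r v x)" if "pgrowth n v" for v
    using split[OF that] conv_op_avg[OF al that] by auto
  have D': "conv_op p (bin_diff h j u) = (\<lambda>x. bin_diff h (Suc j) (conv_op al u) x + bin_diff h j (conv_op r u) x)"
    unfolding conv_op_bin_diff[OF p pg(1)] decomp[OF pg(1)] by (simp add: bin_diff_add bin_diff_avg fun_eq_iff)
  have G': "conv_op p (bin_sum h j w) = (\<lambda>x. bin_sum h (Suc j) (conv_op al w) x + bin_sum h j (conv_op r w) x)"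
    unfolding conv_op_bin_sum[OF p pg(2)] decomp[OF pg(2)] by (simp add: bin_sum_add bin_sum_avg fun_eq_iff)
  have pow_D: "(conv_op p ^^ Suc m) (bin_diff h j u) x
     = (conv_op p ^^ m) (bin_diff h (Suc j) (conv_op al u)) x + (conv_op p ^^ m) (bin_diff h j (conv_op r u)) x"
    unfolding funpow_Suc_right o_def D'
    by (subst conv_pow_add[OF p]) (auto intro!: pgrowth_bin_diff pgrowth_conv_op[OF al] pgrowth_conv_op[OF r] pg)
  have pow_G: "(conv_op p ^^ Suc m) (bin_sum h j w) x
     = (conv_op p ^^ m) (bin_sum h (Suc j) (conv_op al w)) x + (conv_op p ^^ m) (bin_sum h j (conv_op r w)) x"
    unfolding funpow_Suc_right o_def G'
    by (subst conv_pow_add[OF p]) (auto intro!: pgrowth_bin_sum pgrowth_conv_op[OF al] pgrowth_conv_op[OF r] pg)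
  \<comment> \<open>Induction hypothesis for the part that used an averaging step: the index rises
    to \<open>Suc j\<close> and the bound D is scaled by the mass a. The next fact treats the rest
    with mass 1 - a and unchanged index; \<open>sqrt_step\<close> merges the two.\<close>
  have 1: "\<bar>(conv_op p ^^ m) (bin_diff h (Suc j) (conv_op al u)) x\<bar>
     \<le> D * a * (2 / sqrt (real (Suc (Suc j)) + a / 2 * real m)) + (conv_op p ^^ m) (bin_sum h (Suc j) (conv_op al w)) x"
    by (rule Suc.IH) (use bnd[OF al] nonneg[OF al] Suc.prems a in \<open>auto intro!: pgrowth_conv_op[OF al]\<close>)
  have 2: "\<bar>(conv_op p ^^ m) (bin_diff h j (conv_op r u)) x\<bar>
     \<le> D * (1 - a) * (2 / sqrt (real (Suc j) + a / 2 * real m)) + (conv_op p ^^ m) (bin_sum h j (conv_op r w)) x"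
    by (rule Suc.IH) (use bnd[OF r] nonneg[OF r] Suc.prems a in \<open>auto intro!: pgrowth_conv_op[OF r]\<close>)
  have "D * a * (2 / sqrt (s + 1)) + D * (1 - a) * (2 / sqrt s) = 2 * D * (a / sqrt (s + 1) + (1 - a) / sqrt s)"
    by (simp add: algebra_simps)
  also have "\<dots> \<le> 2 * D * (1 / sqrt (s + a / 2))"
    by (intro mult_left_mono sqrt_step s a) (use Suc.prems in auto)
  finally have 3: "D * a * (2 / sqrt (s + 1)) + D * (1 - a) * (2 / sqrt s) \<le> D * (2 / sqrt (s + a / 2))"
    by (simp add: mult_ac)
  have e: "real (Suc (Suc j)) + a / 2 * real m = s + 1" "real (Suc j) + a / 2 * real m = s"
    "real (Suc j) + a / 2 * real (Suc m) = s + a / 2" by (simp_all add: s_def algebra_simps)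
  show ?case unfolding pow_D pow_G e(3) using 1 2 3 unfolding e(1,2) by linarith
qed

section \<open>Growth of polynomial weights along the walk\<close>

lemma conv_op_weight_growth:
  assumes p: "kernel n p" and 1: "(LINT y|lborel. p y) = 1" and L: "L \<ge> 1"
    and K: "K = (LINT y|lborel. p y * (1 + \<bar>y\<bar>) ^ n)"
  shows "conv_op p (\<lambda>x. (L + \<bar>x\<bar>) ^ n) x \<le> (1 + real n * K / L) * (L + \<bar>x\<bar>) ^ n"
proof -
  have p0: "\<And>y. 0 \<le> p y" and pn: "integrable lborel (\<lambda>y. p y * (1 + \<bar>y\<bar>) ^ n)" using p by (auto simp: kernel_def)
  note pi = kernel_integrable[OF p]
  define W where "W = (L + \<bar>x\<bar>) ^ n"
  have W: "W \<ge> 0" using L by (simp add: W_def)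
  have key: "(L + \<bar>x + y\<bar>) ^ n \<le> W + real n / L * W * (1 + \<bar>y\<bar>) ^ n" for y
  proof -
    \<comment> \<open>Displacement relative to L. Since (1 + z)^n - 1 carries a factor z = |y| / L,
      the relative growth of the weight in one step is of order 1 / L.\<close>
    define z where "z = \<bar>y\<bar> / L"
    have z: "0 \<le> z" "z \<le> \<bar>y\<bar>" using L by (auto simp: z_def divide_le_eq mult_le_cancel_left1)
    have "L + \<bar>x + y\<bar> \<le> (L + \<bar>x\<bar>) * (1 + z)"
    proof -
      have "\<bar>y\<bar> \<le> (L + \<bar>x\<bar>) * z" using L unfolding z_def by (simp add: field_simps)
      then show ?thesis by (simp add: distrib_left)
    qed
    then have "(L + \<bar>x + y\<bar>) ^ n \<le> ((L + \<bar>x\<bar>) * (1 + z)) ^ n" using L by (intro power_mono) auto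
    also have "\<dots> = W * (1 + z) ^ n" by (simp add: power_mult_distrib W_def)
    also have "(1 + z) ^ n \<le> 1 + real n / L * (1 + \<bar>y\<bar>) ^ n"
    proof (cases n)
      case (Suc k)
      have "(1 + z) ^ n - 1 = z * (\<Sum>i<n. (1 + z) ^ i)"
        using power_diff_1_eq[of "1 + z" n] Suc by simp
      also have "\<dots> \<le> z * (\<Sum>i<n. (1 + z) ^ k)"
        using z Suc by (intro mult_left_mono sum_mono power_increasing) auto
      also have "\<dots> = real n * z * (1 + z) ^ k" by simp
      also have "\<dots> \<le> real n * z * (1 + \<bar>y\<bar>) ^ k"
        using z by (intro mult_left_mono power_mono) auto
      also have "\<dots> = real n / L * (\<bar>y\<bar> * (1 + \<bar>y\<bar>) ^ k)" by (simp add: z_def)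
      also have "\<dots> \<le> real n / L * (1 + \<bar>y\<bar>) ^ n"
        using L Suc by (intro mult_left_mono) (auto simp: mult_right_mono)
      finally show ?thesis by simp
    qed simp
    finally have "(L + \<bar>x + y\<bar>) ^ n \<le> W * (1 + real n / L * (1 + \<bar>y\<bar>) ^ n)"
      using W by (simp add: mult_left_mono)
    then show ?thesis by (simp add: distrib_left mult_ac)
  qed
  have "conv_op p (\<lambda>x. (L + \<bar>x\<bar>) ^ n) x \<le> (LINT y|lborel. W * p y + real n / L * W * (p y * (1 + \<bar>y\<bar>) ^ n))"
    unfolding conv_op_def
  proof (intro integral_mono)
    show "integrable lborel (\<lambda>y. p y * (L + \<bar>x + y\<bar>) ^ n)"
      using L by (intro conv_op_integrable[OF p] pgrowth_weight) auto
    show "integrable lborel (\<lambda>y. W * p y + real n / L * W * (p y * (1 + \<bar>y\<bar>) ^ n))"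
      using pi pn by (intro Bochner_Integration.integrable_add integrable_mult_right) auto
    show "p y * (L + \<bar>x + y\<bar>) ^ n \<le> W * p y + real n / L * W * (p y * (1 + \<bar>y\<bar>) ^ n)" for y
      using mult_left_mono[OF key p0, of y y] by (simp add: algebra_simps)
  qed
  also have "\<dots> = W * 1 + real n / L * W * K"
    by (subst Bochner_Integration.integral_add) (use pi pn 1 K in auto)
  finally show ?thesis by (simp add: W_def algebra_simps)
qed

text \<open>A step costs a factor 1 + n K / L. Taking L equal to the number m of steps keeps the
  product below exp (n K), uniformly in m.\<close>

lemma conv_pow_weight_growth:
  assumes p: "kernel n p" and 1: "(LINT y|lborel. p y) = 1"
    and K: "K = (LINT y|lborel. p y * (1 + \<bar>y\<bar>) ^ n)" and m: "m \<ge> 1"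
  shows "(conv_op p ^^ m) (\<lambda>x. (real m + \<bar>x\<bar>) ^ n) x \<le> exp (real n * K) * (real m + \<bar>x\<bar>) ^ n"
proof -
  define w where "w = (\<lambda>x. (real m + \<bar>x\<bar>) ^ n)"
  have w: "pgrowth n w" unfolding w_def by (rule pgrowth_weight) simp
  have K0: "K \<ge> 0" unfolding K using p by (intro integral_nonneg_AE) (auto simp: kernel_def)
  define c where "c = 1 + real n * K / real m"
  have c: "c \<ge> 0" using K0 by (simp add: c_def)
  have "(conv_op p ^^ k) w x \<le> c ^ k * w x" for k x
  proof (induction k arbitrary: x)
    case (Suc k)
    have "(conv_op p ^^ Suc k) w x \<le> conv_op p (\<lambda>x. c ^ k * w x) x"
      by (simp, rule conv_op_mono[OF p]) (auto intro: Suc pgrowth_conv_pow[OF p] pgrowth_scale w)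
    also have "\<dots> \<le> c ^ k * (c * w x)"
      unfolding conv_op_scale using conv_op_weight_growth[OF p 1 _ K, of "real m" x] m c
      by (intro mult_left_mono) (auto simp: w_def c_def)
    finally show ?case by (simp add: mult_ac)
  qed simp
  then have "(conv_op p ^^ m) w x \<le> c ^ m * w x" .
  also have "c ^ m \<le> exp (real n * K / real m) ^ m"
    using c unfolding c_def by (intro power_mono exp_ge_add_one_self) auto
  also have "\<dots> = exp (real n * K)" using m by (simp add: exp_of_nat_mult[symmetric])
  finally show ?thesis by (simp add: w_def mult_right_mono)
qed

lemma power_add_le: "0 \<le> a \<Longrightarrow> 0 \<le> b \<Longrightarrow> (a + b :: real) ^ n \<le> 2 ^ n * (a ^ n + b ^ n)"
proof -
  assume a: "0 \<le> a" and b: "0 \<le> b"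
  have "(a + b) ^ n \<le> (2 * max a b) ^ n" using a b by (intro power_mono) auto
  also have "\<dots> = 2 ^ n * max a b ^ n" by (simp add: power_mult_distrib)
  also have "max a b ^ n \<le> a ^ n + b ^ n" using a b by (auto simp: max_def)
  finally show ?thesis by simp
qed

section \<open>Overlap of a positive density with its translates\<close>

lemma lborel_AE_imp_ex:
  assumes "AE y in lborel. P (y :: real)" shows "\<exists>y. P y"
proof (rule ccontr)
  assume nP: "\<nexists>y. P y"
  from AE_E[OF assms] obtain N where N: "{y \<in> space lborel. \<not> P y} \<subseteq> N" "emeasure lborel N = 0" by blast
  then have "N = UNIV" using nP by auto
  with N(2) show False by simp
qed

lemma kernel_bounded_by:
  assumes "kernel n p" "q \<in> borel_measurable borel" "\<And>y. 0 \<le> q y" "\<And>y. q y \<le> p y"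
  shows "kernel n q"
  unfolding kernel_def
proof (intro conjI allI assms)
  have [measurable]: "q \<in> borel_measurable borel" by fact
  show "integrable lborel (\<lambda>y. q y * (1 + \<bar>y\<bar>) ^ n)"
  proof (rule Bochner_Integration.integrable_bound)
    show "integrable lborel (\<lambda>y. p y * (1 + \<bar>y\<bar>) ^ n)" using assms(1) by (simp add: kernel_def)
    show "AE x in lborel. norm (q x * (1 + \<bar>x\<bar>) ^ n) \<le> norm (p x * (1 + \<bar>x\<bar>) ^ n)"
      using assms(3,4) order_trans[OF assms(3,4)] by (auto intro!: AE_I2 mult_right_mono simp: abs_mult)
  qed simp
qed

text \<open>\<open>al\<close> is the common part of p and a translate of p by h, and its shift
  \<open>be\<close> lies below p too. Removing half of each leaves r >= 0, while the two halves
  together act as \<open>al\<close> after averaging over the step h. Positivity of p makes the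
  common mass a positive for every h.\<close>

lemma kernel_overlap_split:
  assumes p: "kernel n p" and 1: "(LINT y|lborel. p y) = 1" and pos: "\<And>y. p y > 0"
  obtains al r a where "kernel n al" "kernel n r"
    "\<And>u x. pgrowth n u \<Longrightarrow> conv_op p u x = conv_op al (avg h u) x + conv_op r u x"
    "(LINT y|lborel. al y) = a" "(LINT y|lborel. r y) = 1 - a" "0 < a" "a \<le> 1"
proof -
  have [measurable]: "p \<in> borel_measurable borel" using p by (simp add: kernel_def)
  define al where "al y = min (p y) (p (y + h))" for y
  define be where "be y = al (y - h)" for y
  define r where "r y = p y - al y / 2 - be y / 2" for y
  have [measurable]: "al \<in> borel_measurable borel" "be \<in> borel_measurable borel" "r \<in> borel_measurable borel"
    unfolding al_def[abs_def] be_def[abs_def] r_def[abs_def] by measurable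
  have al0: "al y > 0" for y using pos by (simp add: al_def)
  have alp: "al y \<le> p y" for y by (simp add: al_def)
  have be0: "be y > 0" for y using al0 by (simp add: be_def)
  have bep: "be y \<le> p y" for y by (simp add: al_def be_def)
  have r0: "r y \<ge> 0" for y using alp[of y] bep[of y] by (simp add: r_def)
  have rp: "r y \<le> p y" for y using al0[of y] be0[of y] by (simp add: r_def)
  have kal: "kernel n al" by (rule kernel_bounded_by[OF p]) (auto simp: alp al0 less_imp_le)
  have kbe: "kernel n be" by (rule kernel_bounded_by[OF p]) (auto simp: bep be0 less_imp_le)
  have kr: "kernel n r" by (rule kernel_bounded_by[OF p]) (auto simp: rp r0)
  have be_al: "conv_op be u x = conv_op al u (x + h)" for u x
    unfolding conv_op_def
    by (subst lborel_integral_real_affine[where c = 1 and t = h]) (simp_all add: be_def add_ac)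
  have split: "conv_op p u x = conv_op al (avg h u) x + conv_op r u x" if u: "pgrowth n u" for u x
  proof -
    have "conv_op r u x = (LINT y|lborel. p y * u (x + y) - (1/2) * (al y * u (x + y)) - (1/2) * (be y * u (x + y)))"
      unfolding conv_op_def r_def by (intro Bochner_Integration.integral_cong) (auto simp: algebra_simps)
    also have "\<dots> = conv_op p u x - (1/2) * conv_op al u x - (1/2) * conv_op be u x"
      unfolding conv_op_def
      using conv_op_integrable[OF p u] conv_op_integrable[OF kal u] conv_op_integrable[OF kbe u] by simp
    finally show ?thesis by (simp add: conv_op_avg[OF kal u] avg_def be_al add_divide_distrib)
  qed
  define a where "a = (LINT y|lborel. al y)"
  have int: "integrable lborel al" "integrable lborel p" using kernel_integrable kal p by auto
  have "a \<le> 1" unfolding a_def 1[symmetric] by (rule integral_mono) (use int alp in auto)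
  moreover have "a > 0"
  proof (rule ccontr)
    assume "\<not> a > 0"
    moreover have "a \<ge> 0" unfolding a_def using al0 by (intro integral_nonneg_AE) (auto simp: less_imp_le)
    ultimately have "(LINT y|lborel. al y) = 0" by (simp add: a_def)
    then have "AE y in lborel. al y = 0"
      using integral_nonneg_eq_0_iff_AE[OF int(1)] al0 by (simp add: less_imp_le)
    then obtain y where "al y = 0" using lborel_AE_imp_ex by blast
    then show False using al0[of y] by simp
  qed
  moreover have "(LINT y|lborel. r y) = 1 - a"
    using split[OF pgrowth_const[where c = 1], of 0] by (simp add: conv_op_const avg_def[abs_def] 1 a_def)
  ultimately show thesis using that kal kr split a_def by blast
qed

text \<open>With m = J^2 steps and weight parameter m^2 = J^4, one difference gains 1 / J. Seen from
  x, the function is bounded by a constant of size W, on which the binomial decay 1 / sqrt m acts,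
  plus a multiple of |y|^n, whose mean after m steps is of order m^n and thus at most of order W /
  J.\<close>

lemma diff_conv_pow_bound:
  assumes p: "kernel n p" and 1: "(LINT y|lborel. p y) = 1" and pos: "\<And>y. p y > 0" and n: "n \<ge> 1"
  shows "\<exists>C\<ge>0. \<forall>J\<ge>1. \<forall>v K. pgrowth n v \<longrightarrow> K \<ge> 0 \<longrightarrow> (\<forall>x. \<bar>v x\<bar> \<le> K * (real J ^ 4 + \<bar>x\<bar>) ^ n) \<longrightarrow>
      (\<forall>x. \<bar>fwd_diff h ((conv_op p ^^ (J\<^sup>2)) v) x\<bar> \<le> C / real J * K * (real J ^ 4 + \<bar>x\<bar>) ^ n)"
proof -
  obtain al r a where k: "kernel n al" "kernel n r"
    "\<And>u x. pgrowth n u \<Longrightarrow> conv_op p u x = conv_op al (avg h u) x + conv_op r u x"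
    "(LINT y|lborel. al y) = a" "(LINT y|lborel. r y) = 1 - a" and a: "0 < a" "a \<le> 1"
    using kernel_overlap_split[OF p 1 pos, where h = h] by metis
  define E where "E = exp (real n * (LINT y|lborel. p y * (1 + \<bar>y\<bar>) ^ n))"
  \<comment> \<open>The first term is the binomial decay of the constant part, the second the
    remainder, counted at the two points 0 and h of \<open>bin_sum h 0\<close>. The factor 2^n comes
    from \<open>power_add_le\<close>.\<close>
  define C where "C = 2 ^ n * (2 / sqrt (a / 2) + 2 * E * (1 + \<bar>h\<bar>) ^ n)"
  have E: "E \<ge> 0" by (simp add: E_def)
  have C: "C \<ge> 0" using a E unfolding C_def by simp
  show ?thesis
  proof (intro exI[of _ C] conjI C allI impI)
    fix J :: nat and v K x
    assume J: "1 \<le> J" and v: "pgrowth n v" and K: "(0::real) \<le> K"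
      and vb: "\<forall>x. \<bar>v x\<bar> \<le> K * (real J ^ 4 + \<bar>x\<bar>) ^ n"
    define L where "L = real J ^ 4"
    define W where "W = (L + \<bar>x\<bar>) ^ n"
    define m where "m = J\<^sup>2"
    have m: "m \<ge> 1" "real m = real J ^ 2" using J by (auto simp: m_def)
    have L: "L \<ge> 0" by (simp add: L_def)
    have W: "W \<ge> 0" using L by (simp add: W_def)
    \<comment> \<open>Recentring at x reduces the claim to the value at 0, where growth beyond a
      constant is measured by |y|^n.\<close>
    define V where "V y = v (y + x)" for y
    define w where "w y = K * 2 ^ n * \<bar>y\<bar> ^ n" for y :: real
    have pV: "pgrowth n V" unfolding V_def[abs_def] by (rule pgrowth_shift[OF v])
    have pa: "pgrowth n (\<lambda>y. \<bar>y\<bar> ^ n)" using pgrowth_weight[of 0 n] by simp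
    have pw: "pgrowth n w" unfolding w_def[abs_def] by (intro pgrowth_scale pa)
    have Vb: "\<bar>V y\<bar> \<le> K * 2 ^ n * W + w y" for y
    proof -
      have "\<bar>V y\<bar> \<le> K * (L + \<bar>y + x\<bar>) ^ n" using vb unfolding V_def L_def by blast
      also have "\<dots> \<le> K * ((L + \<bar>x\<bar>) + \<bar>y\<bar>) ^ n" using K L by (intro mult_left_mono power_mono) auto
      also have "\<dots> \<le> K * (2 ^ n * (W + \<bar>y\<bar> ^ n))"
        unfolding W_def using K L by (intro mult_left_mono power_add_le) auto
      finally show ?thesis by (simp add: w_def algebra_simps)
    qed
    have "\<bar>(conv_op p ^^ m) (bin_diff h 0 V) 0\<bar>
      \<le> K * 2 ^ n * W * (2 / sqrt (real (Suc 0) + a / 2 * real m)) + (conv_op p ^^ m) (bin_sum h 0 w) 0"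
      by (rule conv_pow_bin_diff_bound[OF p k _ _ pV pw]) (use a Vb W K in \<open>auto simp: w_def\<close>)
    also have "(conv_op p ^^ m) (bin_diff h 0 V) 0 = fwd_diff h ((conv_op p ^^ m) v) x"
      unfolding bin_diff_def V_def[abs_def]
      by (simp add: conv_pow_diff[OF p pgrowth_shift[OF v]] conv_pow_shift) (simp add: fwd_diff_def add_ac)
    finally have 1: "\<bar>fwd_diff h ((conv_op p ^^ m) v) x\<bar>
      \<le> K * 2 ^ n * W * (2 / sqrt (real (Suc 0) + a / 2 * real m)) + (conv_op p ^^ m) (bin_sum h 0 w) 0" .
    have "2 / sqrt (real (Suc 0) + a / 2 * real m) \<le> 2 / sqrt (a / 2 * real m)"
      using a J by (intro divide_left_mono real_sqrt_le_mono mult_pos_pos) (auto simp: m add_pos_nonneg)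
    also have "\<dots> = 2 / sqrt (a / 2) / real J" unfolding m real_sqrt_mult by simp
    finally have 2: "2 / sqrt (real (Suc 0) + a / 2 * real m) \<le> 2 / sqrt (a / 2) / real J" .
    have Pw: "(conv_op p ^^ m) w y \<le> K * 2 ^ n * (E * (1 + \<bar>h\<bar>) ^ n * W / real J)" if y: "\<bar>y\<bar> \<le> \<bar>h\<bar>" for y
    proof -
      have "(conv_op p ^^ m) (\<lambda>y. \<bar>y\<bar> ^ n) y \<le> (conv_op p ^^ m) (\<lambda>x. (real m + \<bar>x\<bar>) ^ n) y"
        by (rule conv_pow_mono[OF p pa pgrowth_weight]) (auto intro: power_mono)
      also have "\<dots> \<le> E * (real m + \<bar>y\<bar>) ^ n"
        unfolding E_def by (rule conv_pow_weight_growth[OF p assms(2) refl m(1)])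
      also have "\<dots> \<le> E * ((1 + \<bar>h\<bar>) * real m) ^ n"
      proof (intro mult_left_mono power_mono E)
        have "\<bar>h\<bar> * 1 \<le> \<bar>h\<bar> * real m" using m(1) by (intro mult_left_mono) auto
        then show "real m + \<bar>y\<bar> \<le> (1 + \<bar>h\<bar>) * real m" using y by (simp add: algebra_simps)
      qed simp
      also have "\<dots> = E * (1 + \<bar>h\<bar>) ^ n * real m ^ n" by (simp add: power_mult_distrib)
      \<comment> \<open>W is at least L^n = m^n m^n, and one factor m^n already exceeds J because n
        >= 1.\<close>
      also have "real m ^ n \<le> W / real J"
      proof -
        have "real m ^ n * real J \<le> real m ^ n * real m ^ n"
        proof (intro mult_left_mono)
          have "real J \<le> real m" using J by (simp add: m power2_eq_square)
          also have "\<dots> \<le> real m ^ n" using m(1) n by (intro self_le_power) auto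
          finally show "real J \<le> real m ^ n" .
        qed simp
        also have "\<dots> = L ^ n" unfolding L_def m by (simp add: power_mult[symmetric] power_add[symmetric] mult.commute)
        also have "\<dots> \<le> W" unfolding W_def using L by (intro power_mono) auto
        finally show ?thesis using J by (simp add: le_divide_eq)
      qed
      finally have "(conv_op p ^^ m) (\<lambda>y. \<bar>y\<bar> ^ n) y \<le> E * (1 + \<bar>h\<bar>) ^ n * W / real J"
        using E by (simp add: mult_left_mono)
      then show ?thesis unfolding w_def[abs_def] conv_pow_scale using K by (intro mult_left_mono) auto
    qed
    have "(conv_op p ^^ m) (bin_sum h 0 w) 0 = (conv_op p ^^ m) w h + (conv_op p ^^ m) w 0"
      unfolding bin_sum_def by (simp add: conv_pow_add[OF p pgrowth_shift[OF pw] pw] conv_pow_shift)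
    also have "\<dots> \<le> 2 * (K * 2 ^ n * (E * (1 + \<bar>h\<bar>) ^ n * W / real J))"
      unfolding mult_2 by (rule add_mono[OF Pw[of h, OF order_refl] Pw[of 0, unfolded abs_zero, OF abs_ge_zero]])
    also have "\<dots> = K * 2 ^ n * (2 * E * (1 + \<bar>h\<bar>) ^ n * W / real J)" by simp
    finally have 3: "(conv_op p ^^ m) (bin_sum h 0 w) 0 \<le> K * 2 ^ n * (2 * E * (1 + \<bar>h\<bar>) ^ n * W / real J)" .
    have "K * 2 ^ n * W * (2 / sqrt (real (Suc 0) + a / 2 * real m)) \<le> K * 2 ^ n * W * (2 / sqrt (a / 2) / real J)"
      using K W by (intro mult_left_mono 2) auto
    with 1 3 have "\<bar>fwd_diff h ((conv_op p ^^ m) v) x\<bar> \<le> K * 2 ^ n * W * (2 / sqrt (a / 2) / real J)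
        + K * 2 ^ n * (2 * E * (1 + \<bar>h\<bar>) ^ n * W / real J)" by linarith
    also have "\<dots> = C / real J * K * W" unfolding C_def using J by (simp add: field_simps)
    finally show "\<bar>fwd_diff h ((conv_op p ^^ (J\<^sup>2)) v) x\<bar> \<le> C / real J * K * (real J ^ 4 + \<bar>x\<bar>) ^ n"
      by (simp add: m_def W_def L_def)
  qed
qed

section \<open>Vanishing differences and polynomials\<close>

text \<open>Frechet's condition: all N-fold differences vanish, with N independently chosen steps.
  It passes to limits, and averaging a first difference over its step lowers the order by
  one.\<close>

primrec diffs_vanish :: "nat \<Rightarrow> (real \<Rightarrow> real) \<Rightarrow> bool" where
  "diffs_vanish 0 u \<longleftrightarrow> (\<forall>x. u x = 0)"
| "diffs_vanish (Suc N) u \<longleftrightarrow> (\<forall>h. diffs_vanish N (fwd_diff h u))"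

text \<open>With \<open>J\<^sup>2\<close> steps and weight parameter \<open>J ^ 4\<close>, all rates become integral powers of \<open>J\<close>.\<close>
lemma diffs_vanish_iterate:
  assumes p: "kernel n p" and 1: "(LINT y|lborel. p y) = 1" and pos: "\<And>y. p y > 0" and n: "n \<ge> 1"
    and "C \<ge> 0" and "\<And>J. J \<ge> 1 \<Longrightarrow> \<exists>v. pgrowth n v \<and> (\<forall>x. \<bar>v x\<bar> \<le> C / real J ^ s * (real J ^ 4 + \<bar>x\<bar>) ^ n)
           \<and> u = (conv_op p ^^ (J\<^sup>2 * N)) v"
    and "s + N > 4 * n"
  shows "diffs_vanish N u"
  using assms(5-)
\<comment> \<open>s counts the factors 1 / J already gained and N the differences still to come, so
  s + N is preserved. Each difference consumes J^2 of the remaining J^2 N steps.\<close>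
proof (induction N arbitrary: u s C)
  case 0
  \<comment> \<open>At fixed x the weight is of order J^(4 n), and s >= 4 n + 1 factors 1 / J bring
    the bound to order 1 / J for every J.\<close>
  have "u x = 0" for x
  proof -
    define B where "B = C * (1 + \<bar>x\<bar>) ^ n"
    have B0: "B \<ge> 0" using 0 by (simp add: B_def)
    have B: "\<bar>u x\<bar> \<le> B / real J" if J: "J \<ge> 1" for J
    proof -
      from "0.prems"(2)[OF J] obtain v
        where v: "\<forall>x. \<bar>v x\<bar> \<le> C / real J ^ s * (real J ^ 4 + \<bar>x\<bar>) ^ n" "u = v" by auto
      have "\<bar>u x\<bar> \<le> C / real J ^ s * (real J ^ 4 + \<bar>x\<bar>) ^ n" using v by blast
      also have "\<dots> \<le> C / real J ^ s * (real J ^ 4 * (1 + \<bar>x\<bar>)) ^ n"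
      proof (intro mult_left_mono power_mono)
        have "\<bar>x\<bar> * 1 \<le> \<bar>x\<bar> * real J ^ 4" using J by (intro mult_left_mono) auto
        then show "real J ^ 4 + \<bar>x\<bar> \<le> real J ^ 4 * (1 + \<bar>x\<bar>)" by (simp add: algebra_simps)
      qed (use 0 in auto)
      also have "\<dots> = B * (real J ^ (4 * n) / real J ^ s)"
        by (simp add: power_mult_distrib power_mult B_def)
      also have "\<dots> \<le> B * (1 / real J)"
      proof (intro mult_left_mono B0)
        have "real J ^ (4 * n) * real J = real J ^ Suc (4 * n)" by simp
        also have "\<dots> \<le> real J ^ s" using "0.prems"(3) J by (intro power_increasing) auto
        finally show "real J ^ (4 * n) / real J ^ s \<le> 1 / real J" using J by (simp add: field_simps)
      qed
      finally show ?thesis by simp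
    qed
    have "\<bar>u x\<bar> \<le> 0"
    proof (rule tendsto_lowerbound)
      show "(\<lambda>J. B / real J) \<longlonglongrightarrow> 0" by (rule lim_const_over_n)
      show "\<forall>\<^sub>F J in sequentially. \<bar>u x\<bar> \<le> B / real J"
        using B by (auto simp: eventually_at_top_linorder)
    qed simp
    then show ?thesis by simp
  qed
  then show ?case by simp
next
  case (Suc N)
  have "diffs_vanish N (fwd_diff h u)" for h
  proof -
    obtain D where D: "D \<ge> 0" "\<And>J v K x. J \<ge> 1 \<Longrightarrow> pgrowth n v \<Longrightarrow> K \<ge> 0 \<Longrightarrow>
      (\<forall>x. \<bar>v x\<bar> \<le> K * (real J ^ 4 + \<bar>x\<bar>) ^ n) \<Longrightarrow>
      \<bar>fwd_diff h ((conv_op p ^^ (J\<^sup>2)) v) x\<bar> \<le> D / real J * K * (real J ^ 4 + \<bar>x\<bar>) ^ n"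
      using diff_conv_pow_bound[OF p 1 pos n, of h] by blast
    show ?thesis
    proof (rule Suc.IH[of "D * C" "Suc s"])
      show "D * C \<ge> 0" using D Suc.prems by simp
      show "Suc s + N > 4 * n" using Suc.prems by simp
      fix J :: nat assume J: "J \<ge> 1"
      from Suc.prems(2)[OF J] obtain v where v: "pgrowth n v"
        "\<forall>x. \<bar>v x\<bar> \<le> C / real J ^ s * (real J ^ 4 + \<bar>x\<bar>) ^ n" "u = (conv_op p ^^ (J\<^sup>2 * Suc N)) v" by auto
      define v' where "v' = fwd_diff h ((conv_op p ^^ (J\<^sup>2)) v)"
      have "\<bar>v' x\<bar> \<le> D / real J * (C / real J ^ s) * (real J ^ 4 + \<bar>x\<bar>) ^ n" for x
        unfolding v'_def by (rule D(2)) (use J v Suc.prems in auto)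
      moreover have "D / real J * (C / real J ^ s) = D * C / real J ^ Suc s" by simp
      moreover have "pgrowth n v'" unfolding v'_def by (intro pgrowth_diff_op pgrowth_conv_pow p v)
      moreover have "fwd_diff h u = (conv_op p ^^ (J\<^sup>2 * N)) v'"
      proof -
        have "u = (conv_op p ^^ (J\<^sup>2 * N)) ((conv_op p ^^ (J\<^sup>2)) v)"
          unfolding v(3) mult_Suc_right add.commute[of "J\<^sup>2"] by (simp add: funpow_add)
        then show ?thesis unfolding v'_def by (simp only: conv_pow_diff[OF p pgrowth_conv_pow[OF p v(1)]])
      qed
      ultimately show "\<exists>v. pgrowth n v \<and> (\<forall>x. \<bar>v x\<bar> \<le> D * C / real J ^ Suc s * (real J ^ 4 + \<bar>x\<bar>) ^ n)
           \<and> fwd_diff h u = (conv_op p ^^ (J\<^sup>2 * N)) v" by auto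
    qed
  qed
  then show ?case by simp
qed

text \<open>Iterating the equation gives g = P^m (g - m k) for every m, which is the form that
  \<open>diffs_vanish_iterate\<close> asks for. With m = J^2 N the constant m k is of order J^2 and
  is absorbed by the weight with parameter J^4.\<close>

lemma harmonic_diffs_vanish:
  assumes p: "kernel n p" and 1: "(LINT y|lborel. p y) = 1" and pos: "\<And>y. p y > 0" and n: "n \<ge> 1"
    and g: "pgrowth n g" and harm: "\<And>x. conv_op p g x = g x + k"
  shows "diffs_vanish (Suc (4 * n)) g"
proof -
  obtain B where B: "B \<ge> 0" "\<And>x. \<bar>g x\<bar> \<le> B * (1 + \<bar>x\<bar>) ^ n" using pgrowthE[OF g] by blast
  define N where "N = Suc (4 * n)"
  have pow: "(conv_op p ^^ m) (\<lambda>x. g x + c) = (\<lambda>x. g x + (real m * k + c))" for m c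
  proof (induction m)
    case (Suc m)
    have "conv_op p (\<lambda>x. g x + (real m * k + c)) x = g x + (real (Suc m) * k + c)" for x
      by (subst conv_op_add[OF p g pgrowth_const]) (simp add: conv_op_const 1 harm algebra_simps)
    then show ?case unfolding funpow.simps o_def Suc by (rule ext)
  qed simp
  show ?thesis unfolding N_def[symmetric]
  proof (rule diffs_vanish_iterate[OF p 1 pos n, where s = 0 and C = "B + real N * \<bar>k\<bar>"])
    show "0 \<le> B + real N * \<bar>k\<bar>" using B by simp
    show "0 + N > 4 * n" by (simp add: N_def)
    fix J :: nat assume J: "J \<ge> 1"
    define c where "c = - (real (J\<^sup>2 * N) * k)"
    have "\<bar>g x + c\<bar> \<le> (B + real N * \<bar>k\<bar>) / real J ^ 0 * (real J ^ 4 + \<bar>x\<bar>) ^ n" for x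
    proof -
      have J4: "1 \<le> real J ^ 4" using J by simp
      have "B * (1 + \<bar>x\<bar>) ^ n \<le> B * (real J ^ 4 + \<bar>x\<bar>) ^ n"
        using J4 B by (intro mult_left_mono power_mono) auto
      moreover have "\<bar>c\<bar> \<le> real N * \<bar>k\<bar> * (real J ^ 4 + \<bar>x\<bar>) ^ n"
      proof -
        have "\<bar>c\<bar> = real N * \<bar>k\<bar> * (real J)\<^sup>2" by (simp add: c_def abs_mult mult_ac)
        also have "(real J)\<^sup>2 \<le> real J ^ 4" using J by (intro power_increasing) auto
        also have "real J ^ 4 \<le> real J ^ 4 + \<bar>x\<bar>" by simp
        also have "\<dots> \<le> (real J ^ 4 + \<bar>x\<bar>) ^ n" using J4 n by (intro self_le_power) auto
        finally show ?thesis by (simp add: mult_left_mono)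
      qed
      moreover have "\<bar>g x + c\<bar> \<le> \<bar>g x\<bar> + \<bar>c\<bar>" by (rule abs_triangle_ineq)
      moreover have "(B + real N * \<bar>k\<bar>) / real J ^ 0 * (real J ^ 4 + \<bar>x\<bar>) ^ n
        = B * (real J ^ 4 + \<bar>x\<bar>) ^ n + real N * \<bar>k\<bar> * (real J ^ 4 + \<bar>x\<bar>) ^ n" by (simp add: algebra_simps)
      ultimately show ?thesis using B(2)[of x] by linarith
    qed
    moreover have "g = (conv_op p ^^ (J\<^sup>2 * N)) (\<lambda>x. g x + c)" unfolding pow c_def by simp
    moreover have "pgrowth n (\<lambda>x. g x + c)" by (intro pgrowth_add g pgrowth_const)
    ultimately show "\<exists>v. pgrowth n v \<and> (\<forall>x. \<bar>v x\<bar> \<le> (B + real N * \<bar>k\<bar>) / real J ^ 0 * (real J ^ 4 + \<bar>x\<bar>) ^ n)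
        \<and> g = (conv_op p ^^ (J\<^sup>2 * N)) v"
      by blast
  qed
qed

section \<open>Frechet's theorem: vanishing differences force a polynomial\<close>

lemma diffs_vanish_limit:
  assumes "\<And>k::nat. diffs_vanish N (F k)" "\<And>x. (\<lambda>k. F k x) \<longlonglongrightarrow> G x"
  shows "diffs_vanish N G"
  using assms
proof (induction N arbitrary: F G)
  case 0
  then have "(\<lambda>k::nat. 0::real) \<longlonglongrightarrow> G x" for x using LIMSEQ_unique by simp
  then have "G x = 0" for x by (simp add: LIMSEQ_const_iff)
  then show ?case by simp
next
  case (Suc N)
  have "diffs_vanish N (fwd_diff h G)" for h
  proof (rule Suc.IH)
    show "diffs_vanish N (fwd_diff h (F k))" for k using Suc.prems(1) by simp
    show "(\<lambda>k. fwd_diff h (F k) x) \<longlonglongrightarrow> fwd_diff h G x" for x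
      unfolding fwd_diff_def by (intro tendsto_diff Suc.prems)
  qed
  then show ?case by simp
qed

lemma diffs_vanish_scale: "diffs_vanish N u \<Longrightarrow> diffs_vanish N (\<lambda>x. c * u x)"
proof (induction N arbitrary: u)
  case (Suc N)
  have "diffs_vanish N (\<lambda>x. c * fwd_diff h u x)" for h using Suc by simp
  moreover have "fwd_diff h (\<lambda>x. c * u x) = (\<lambda>x. c * fwd_diff h u x)" for h by (simp add: fwd_diff_def fun_eq_iff algebra_simps)
  ultimately show ?case by simp
qed simp

text \<open>Differences in x pass under the integral over h. This serves to average
  \<open>fwd_diff h g\<close> over the step h.\<close>

lemma diffs_vanish_integral:
  assumes "\<And>h. diffs_vanish N (F h)" "\<And>x. (\<lambda>h. F h x) integrable_on {0..1::real}"
  shows "diffs_vanish N (\<lambda>x. integral {0..1} (\<lambda>h. F h x))"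
  using assms
proof (induction N arbitrary: F)
  case (Suc N)
  have "diffs_vanish N (fwd_diff k (\<lambda>x. integral {0..1} (\<lambda>h. F h x)))" for k
  proof -
    have "diffs_vanish N (\<lambda>x. integral {0..1} (\<lambda>h. fwd_diff k (F h) x))"
    proof (rule Suc.IH)
      show "diffs_vanish N (fwd_diff k (F h))" for h using Suc.prems(1) by simp
      show "(\<lambda>h. fwd_diff k (F h) x) integrable_on {0..1}" for x
        unfolding fwd_diff_def by (intro integrable_diff Suc.prems)
    qed
    moreover have "(\<lambda>x. integral {0..1} (\<lambda>h. fwd_diff k (F h) x)) = fwd_diff k (\<lambda>x. integral {0..1} (\<lambda>h. F h x))"
      using Suc.prems by (auto simp: fwd_diff_def fun_eq_iff intro!: Henstock_Kurzweil_Integration.integral_diff)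
    ultimately show ?thesis by simp
  qed
  then show ?case by simp
qed simp

definition locally_bounded :: "(real \<Rightarrow> real) \<Rightarrow> bool" where
  "locally_bounded g \<longleftrightarrow> (\<forall>R. \<exists>B. \<forall>x. \<bar>x\<bar> \<le> R \<longrightarrow> \<bar>g x\<bar> \<le> B)"

lemma locally_bounded_integrable_on:
  assumes [measurable]: "g \<in> borel_measurable borel" and "locally_bounded g"
  shows "g integrable_on {a..b}"
proof -
  obtain B where B: "\<And>x. \<bar>x\<bar> \<le> max \<bar>a\<bar> \<bar>b\<bar> \<Longrightarrow> \<bar>g x\<bar> \<le> B"
    using assms(2) unfolding locally_bounded_def by blast
  have "set_integrable lborel {a..b} g"
    unfolding set_integrable_def
  proof (rule integrableI_bounded_set_indicator[where B = B])
    show "emeasure lborel {a..b} < \<infinity>" by (simp add: emeasure_lborel_Icc_eq)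
    show "AE x in lborel. x \<in> {a..b} \<longrightarrow> norm (g x) \<le> B" using B by (intro AE_I2) auto
  qed simp_all
  then show ?thesis by (rule set_borel_integral_eq_integral(1))
qed

lemma continuous_locally_bounded:
  assumes "continuous_on UNIV g" shows "locally_bounded g"
  unfolding locally_bounded_def
proof
  fix R :: real
  have "compact (g ` {-R..R})" by (intro compact_continuous_image continuous_on_subset[OF assms]) auto
  then obtain B where "\<And>y. y \<in> g ` {-R..R} \<Longrightarrow> norm y \<le> B" using compact_imp_bounded bounded_iff by metis
  then show "\<exists>B. \<forall>x. \<bar>x\<bar> \<le> R \<longrightarrow> \<bar>g x\<bar> \<le> B" by (intro exI[of _ B]) (auto simp: abs_le_iff)
qed

lemma integral_shift_unit:
  fixes g :: "real \<Rightarrow> real" assumes "\<And>a b. g integrable_on {a..b}"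
  shows "integral {0..1} (\<lambda>h. g (x + h)) = integral {x..x + 1} g"
    "(\<lambda>h. g (x + h)) integrable_on {0..1}"
proof -
  have "(g has_integral integral {x..x+1} g) (cbox x (x + 1))"
    using assms[of x "x+1"] by (simp add: integrable_integral)
  from has_integral_affinity'[OF this, of 1 x]
  have "((\<lambda>h. g (x + h)) has_integral integral {x..x + 1} g) {0..1}" by (simp add: add.commute)
  then show "integral {0..1} (\<lambda>h. g (x + h)) = integral {x..x + 1} g"
    "(\<lambda>h. g (x + h)) integrable_on {0..1}" by (auto simp: integral_unique has_integral_integrable)
qed

text \<open>Averaging \<open>g (x + h) - g x\<close> over \<open>0 \<le> h \<le> 1\<close> writes \<open>g\<close> as an indefinite integral plus a polynomial,
  so that \<open>g\<close> is continuously differentiable and the induction hypothesis applies to its derivative.\<close>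
lemma diffs_vanish_polynomial:
  assumes "g \<in> borel_measurable borel" "locally_bounded g" "diffs_vanish (Suc N) g"
  shows "\<exists>c. \<forall>x. g x = (\<Sum>i\<le>N. c i * x ^ i)"
  using assms
proof (induction N arbitrary: g)
  case 0
  then have "g (x + h) = g x" for x h by (simp add: fwd_diff_def)
  from this[of 0] show ?case by (intro exI[of _ "\<lambda>_. g 0"]) auto
next
  case (Suc N)
  note int = locally_bounded_integrable_on[OF Suc.prems(1,2)]
  note [measurable] = Suc.prems(1)
  define J where "J x = integral {x..x+1} g" for x
  \<comment> \<open>Signed primitive of g: the integral over \<open>{0..x}\<close> is 0 for x < 0,
    so negative x needs its own formula.\<close>
  define G where "G x = (if 0 \<le> x then integral {0..x} g else - integral {x..0} g)" for x
  have G_diff: "integral {x..y} g = G y - G x" if "x \<le> y" for x y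
  proof -
    consider "0 \<le> x" | "y < 0" | "x < 0" "0 \<le> y" using that by linarith
    then show ?thesis
    proof cases
      case 1 then show ?thesis using that Henstock_Kurzweil_Integration.integral_combine[of 0 x y g] int by (simp add: G_def)
    next
      case 2 then show ?thesis using that Henstock_Kurzweil_Integration.integral_combine[of x y 0 g] int by (simp add: G_def)
    next
      case 3 then show ?thesis using that Henstock_Kurzweil_Integration.integral_combine[of x 0 y g] int by (simp add: G_def)
    qed
  qed
  have J_G: "J x = G (x + 1) - G x" for x unfolding J_def by (simp add: G_diff)
  have contG: "continuous_on UNIV G"
    unfolding continuous_on_eq_continuous_at[OF open_UNIV]
  proof
    fix x :: real
    have "continuous_on {x-1..x+1} (\<lambda>y. integral {x-1..y} g)" by (rule indefinite_integral_continuous_1[OF int])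
    then have "continuous_on {x-1..x+1} (\<lambda>y. G y - G (x-1))" by (rule continuous_on_eq) (auto simp: G_diff)
    then have "continuous_on {x-1..x+1} (\<lambda>y. (G y - G (x-1)) + G (x-1))" by (intro continuous_on_add) auto
    then have "continuous_on {x-1..x+1} G" by simp
    then have "continuous_on {x-1<..<x+1} G" by (rule continuous_on_subset) auto
    then show "isCont G x" by (subst (asm) continuous_on_eq_continuous_at) auto
  qed
  have contG1: "continuous_on UNIV (\<lambda>x. G (x + 1))"
    by (rule continuous_on_compose2[OF contG]) (auto intro!: continuous_intros)
  have contJ: "continuous_on UNIV J"
    unfolding J_G[abs_def] by (intro continuous_on_diff contG contG1)
  \<comment> \<open>The mean of g over [x, x + 1] minus g x is an average of first differences. This
    lowers the order by one and opens the way to the induction hypothesis.\<close>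
  have J0: "J x - g x = integral {0..1} (\<lambda>h. fwd_diff h g x)" for x
    unfolding fwd_diff_def J_def
    by (subst Henstock_Kurzweil_Integration.integral_diff) (use integral_shift_unit[of g x] int in auto)
  have "diffs_vanish (Suc N) (\<lambda>x. J x - g x)"
    unfolding J0
  proof (rule diffs_vanish_integral)
    show "diffs_vanish (Suc N) (fwd_diff h g)" for h using Suc.prems(3) by simp
    show "(\<lambda>h. fwd_diff h g x) integrable_on {0..1}" for x
      unfolding fwd_diff_def using integral_shift_unit(2)[of g] int by (intro integrable_diff) auto
  qed
  moreover have [measurable]: "J \<in> borel_measurable borel" using contJ by (rule borel_measurable_continuous_onI)
  moreover have "locally_bounded (\<lambda>x. J x - g x)"
    unfolding locally_bounded_def
  proof
    fix R
    obtain B where "\<And>x. \<bar>x\<bar> \<le> R \<Longrightarrow> \<bar>g x\<bar> \<le> B" using Suc.prems(2) unfolding locally_bounded_def by blast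
    moreover obtain C where "\<And>x. \<bar>x\<bar> \<le> R \<Longrightarrow> \<bar>J x\<bar> \<le> C"
      using continuous_locally_bounded[OF contJ] unfolding locally_bounded_def by blast
    ultimately show "\<exists>B. \<forall>x. \<bar>x\<bar> \<le> R \<longrightarrow> \<bar>J x - g x\<bar> \<le> B"
      by (intro exI[of _ "C + B"]) (smt (verit))
  qed
  ultimately obtain c where c: "\<And>x. J x - g x = (\<Sum>i\<le>N. c i * x ^ i)"
    using Suc.IH[of "\<lambda>x. J x - g x"] by auto
  \<comment> \<open>Bootstrap: continuity of G makes g continuous, which makes G differentiable, and
    then this same formula makes g continuously differentiable.\<close>
  have "g x = G (x + 1) - G x - (\<Sum>i\<le>N. c i * x ^ i)" for x using c[of x] J_G[of x] by linarith
  then have g_eq: "g = (\<lambda>x. G (x + 1) - G x - (\<Sum>i\<le>N. c i * x ^ i))" by (rule ext)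
  have contg: "continuous_on UNIV g"
    unfolding g_eq by (intro continuous_on_diff continuous_on_sum continuous_on_mult continuous_on_power
      continuous_on_const continuous_on_id contG contG1)
  have G': "(G has_real_derivative g x) (at x)" for x
  proof -
    have "((\<lambda>u. integral {x-1..u} g) has_real_derivative g x) (at x within {x-1..x+1})"
      by (rule integral_has_real_derivative) (auto intro: continuous_on_subset[OF contg])
    then have "((\<lambda>u. integral {x-1..u} g) has_real_derivative g x) (at x)" by (simp add: at_within_Icc_at)
    then have "((\<lambda>u. integral {x-1..u} g + G (x-1)) has_real_derivative g x + 0) (at x)"
      by (intro DERIV_add) auto
    moreover have "\<forall>\<^sub>F u in nhds x. integral {x-1..u} g + G (x-1) = G u"
      using eventually_nhds_in_open[of "{x-1<..}" x] by (auto elim!: eventually_mono simp: G_diff)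
    ultimately show ?thesis by (simp add: DERIV_cong_ev[OF refl _ refl])
  qed
  define g' where "g' x = g (x + 1) - g x - (\<Sum>i\<le>N. c i * (real i * x ^ (i - 1)))" for x
  have g': "(g has_real_derivative g' x) (at x)" for x
  proof -
    have "((\<lambda>x. G (x + 1)) has_real_derivative g (x + 1)) (at x)" using G'[of "x + 1"] by (simp add: DERIV_shift)
    moreover have "((\<lambda>x. \<Sum>i\<le>N. c i * x ^ i) has_real_derivative (\<Sum>i\<le>N. c i * (real i * x ^ (i - 1)))) (at x)"
      by (rule derivative_eq_intros refl)+ (simp add: mult_ac)
    ultimately have "((\<lambda>x. G (x + 1) - G x - (\<Sum>i\<le>N. c i * x ^ i)) has_real_derivative g' x) (at x)"
      unfolding g'_def by (intro DERIV_diff G')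
    then show ?thesis by (simp only: g_eq[symmetric])
  qed
  have contg': "continuous_on UNIV g'"
    unfolding g'_def[abs_def] by (intro continuous_on_diff continuous_on_sum continuous_on_mult continuous_on_power
      continuous_on_const continuous_on_id contg continuous_on_compose2[OF contg _ subset_UNIV] continuous_on_add)
  \<comment> \<open>Each difference quotient satisfies the condition of order N + 1, since g does so
    for order N + 2, and the condition passes to the limit.\<close>
  have "diffs_vanish (Suc N) g'"
  proof (rule diffs_vanish_limit)
    show "diffs_vanish (Suc N) (\<lambda>x. real (Suc k) * fwd_diff (1 / real (Suc k)) g x)" for k
      using Suc.prems(3) by (intro diffs_vanish_scale) (simp only: diffs_vanish.simps(2)[of "Suc N"])
    show "(\<lambda>k. real (Suc k) * fwd_diff (1 / real (Suc k)) g x) \<longlonglongrightarrow> g' x" for x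
    proof -
      have lim: "filterlim (\<lambda>k. 1 / real (Suc k)) (at 0) sequentially"
        using LIMSEQ_inverse_real_of_nat by (intro filterlim_atI) (simp_all add: inverse_eq_divide)
      have "((\<lambda>h. (g (x + h) - g x) / h) \<longlongrightarrow> g' x) (at 0)" using g'[of x] by (simp add: DERIV_def)
      from filterlim_compose[OF this lim] show ?thesis by (simp add: fwd_diff_def mult.commute)
    qed
  qed
  then obtain d where d: "\<And>x. g' x = (\<Sum>i\<le>N. d i * x ^ i)"
    using Suc.IH[of g'] continuous_locally_bounded[OF contg'] borel_measurable_continuous_onI[OF contg'] by blast
  define H where "H x = (\<Sum>i\<le>N. d i / real (Suc i) * x ^ Suc i)" for x
  have H: "(H has_real_derivative g' x) (at x)" for x
    unfolding H_def d by (rule derivative_eq_intros refl)+ (simp del: of_nat_Suc add: mult.commute)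
  have "((\<lambda>x. g x - H x) has_real_derivative 0) (at x)" for x using DERIV_diff[OF g'[of x] H[of x]] unfolding diff_self .
  then have gH: "g x - H x = g 0 - H 0" for x using DERIV_isconst_all[of "\<lambda>x. g x - H x" x 0] by blast
  have "H 0 = 0" by (simp add: H_def)
  then have gH': "g x = g 0 + H x" for x using gH[of x] by linarith
  have "g x = (\<Sum>i\<le>Suc N. (if i = 0 then g 0 else d (i - 1) / real i) * x ^ i)" for x
    unfolding gH'[of x] by (subst sum.atMost_Suc_shift) (simp add: H_def)
  then show ?case by (intro exI[of _ "\<lambda>i. if i = 0 then g 0 else d (i - 1) / real i"] allI)
qed

lemma pgrowth_locally_bounded: "pgrowth n g \<Longrightarrow> locally_bounded g"
  unfolding locally_bounded_def
proof
  fix R assume "pgrowth n g"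
  then obtain C where C: "C \<ge> 0" "\<And>x. \<bar>g x\<bar> \<le> C * (1 + \<bar>x\<bar>) ^ n" using pgrowthE by blast
  have "\<bar>g x\<bar> \<le> C * (1 + R) ^ n" if "\<bar>x\<bar> \<le> R" for x
    using C(2)[of x] mult_left_mono[OF power_mono[of "1 + \<bar>x\<bar>" "1 + R" n] C(1)] that by linarith
  then show "\<exists>B. \<forall>x. \<bar>x\<bar> \<le> R \<longrightarrow> \<bar>g x\<bar> \<le> B" by blast
qed

section \<open>Polynomial solutions of the convolution equation\<close>

lemma quadratic_harmonic:
  assumes p: "kernel n p" and 1: "(LINT y|lborel. p y) = 1" and n: "n \<ge> 2"
    and harm: "\<And>x. conv_op p (\<lambda>x. a * x\<^sup>2 + b * x + c) x = a * x\<^sup>2 + b * x + c + k"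
  shows "a * (LINT y|lborel. p y * y) = 0"
    and "k = a * (LINT y|lborel. p y * y\<^sup>2) + b * (LINT y|lborel. p y * y)"
proof -
  have pg: "pgrowth n (\<lambda>x. x)" "pgrowth n (\<lambda>x. x\<^sup>2)"
  proof -
    have "\<bar>x\<bar> ^ i \<le> 1 * (1 + \<bar>x\<bar>) ^ n" if "i \<le> 2" for x :: real and i
    proof -
      have "\<bar>x\<bar> ^ i \<le> (1 + \<bar>x\<bar>) ^ i" by (intro power_mono) auto
      also have "\<dots> \<le> (1 + \<bar>x\<bar>) ^ n" using that n by (intro power_increasing) auto
      finally show ?thesis by simp
    qed
    from this[of 1] this[of 2] show "pgrowth n (\<lambda>x. x)" "pgrowth n (\<lambda>x. x\<^sup>2)"
      unfolding pgrowth_def by (auto simp: power_abs intro!: exI[of _ 1])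
  qed
  define m1 where "m1 = (LINT y|lborel. p y * y)"
  define m2 where "m2 = (LINT y|lborel. p y * y\<^sup>2)"
  have i: "integrable lborel p" "integrable lborel (\<lambda>y. p y * y)" "integrable lborel (\<lambda>y. p y * y\<^sup>2)"
    using kernel_integrable[OF p] conv_op_integrable[OF p pg(1), of 0] conv_op_integrable[OF p pg(2), of 0] by auto
  \<comment> \<open>The quadratic at x + y is expanded and integrated in y; what already forms the
    right-hand side cancels. The remaining relation is affine in x, so x = 0 and x = 1 give both
    claims.\<close>
  have eq: "2 * a * m1 * x + a * m2 + b * m1 = k" for x
  proof -
    have "conv_op p (\<lambda>x. a * x\<^sup>2 + b * x + c) x = (LINT y|lborel. (a * x\<^sup>2 + b * x + c) * p y
        + (2 * a * x + b) * (p y * y) + a * (p y * y\<^sup>2))"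
      unfolding conv_op_def by (intro Bochner_Integration.integral_cong) (auto simp: algebra_simps power2_eq_square)
    also have "\<dots> = (a * x\<^sup>2 + b * x + c) + (2 * a * x + b) * m1 + a * m2"
      using i 1 by (simp add: m1_def m2_def)
    finally show ?thesis using harm[of x] by (simp add: algebra_simps)
  qed
  from eq[of 0] eq[of 1] show "a * (LINT y|lborel. p y * y) = 0"
    and "k = a * (LINT y|lborel. p y * y\<^sup>2) + b * (LINT y|lborel. p y * y)"
    by (auto simp: m1_def m2_def)
qed

text \<open>Induction on the order of the vanishing differences. A difference of g solves the
  equation with constant 0, so it is quadratic by induction; constant 0 and a positive second moment
  kill its leading coefficient. All differences of g are then affine, hence g has degree at most
  two.\<close>

lemma harmonic_quadratic:
  assumes p: "kernel n p" and 1: "(LINT y|lborel. p y) = 1" and pos: "\<And>y. p y > 0" and n: "n \<ge> 2"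
    and g: "pgrowth n g" and harm: "\<And>x. conv_op p g x = g x + k"
  shows "\<exists>a b c. \<forall>x. g x = a * x\<^sup>2 + b * x + c"
proof -
  have pp: "p \<in> borel_measurable borel" using p by (simp add: kernel_def)
  have main: "\<exists>a b c. \<forall>x. g x = a * x\<^sup>2 + b * x + c"
    if "pgrowth n g" "\<And>x. conv_op p g x = g x + k" "diffs_vanish N g" for N g k
    using that
  proof (induction N arbitrary: g k)
    case 0
    then have "\<forall>x. g x = 0 * x\<^sup>2 + 0 * x + 0" by simp
    then show ?case by blast
  next
    case (Suc N)
    have "diffs_vanish 2 (fwd_diff h g)" for h
    proof -
      have harm: "conv_op p (fwd_diff h g) x = fwd_diff h g x + 0" for x
        using Suc.prems(2) by (simp add: conv_op_diff[OF p Suc.prems(1)] fwd_diff_def)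
      obtain a b c where abc: "\<And>x. fwd_diff h g x = a * x\<^sup>2 + b * x + c"
        using Suc.IH[OF pgrowth_diff_op[OF Suc.prems(1)] harm] Suc.prems(3) by auto
      note q = quadratic_harmonic[OF p 1 n, of a b c 0]
      have h': "conv_op p (\<lambda>x. a * x\<^sup>2 + b * x + c) x = a * x\<^sup>2 + b * x + c + 0" for x
        using harm[of x] unfolding abc ext[OF abc, of "\<lambda>x. x"] by simp
      have m2: "(LINT y|lborel. p y * y\<^sup>2) \<noteq> 0"
      proof
        assume z: "(LINT y|lborel. p y * y\<^sup>2) = 0"
        have "pgrowth n (\<lambda>x. x\<^sup>2)"
        proof -
          have "\<bar>x\<^sup>2\<bar> \<le> 1 * (1 + \<bar>x\<bar>) ^ n" for x :: real
          proof -
            have "\<bar>x\<^sup>2\<bar> = \<bar>x\<bar> ^ 2" by simp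
            also have "\<dots> \<le> (1 + \<bar>x\<bar>) ^ 2" by (intro power_mono) auto
            also have "\<dots> \<le> (1 + \<bar>x\<bar>) ^ n" using n by (intro power_increasing) auto
            finally show ?thesis by simp
          qed
          then show ?thesis unfolding pgrowth_def by (intro conjI exI[of _ 1]) auto
        qed
        from conv_op_integrable[OF p this, of 0] have "integrable lborel (\<lambda>y. p y * y\<^sup>2)" by simp
        then have "AE y in lborel. p y * y\<^sup>2 = 0"
          using integral_nonneg_eq_0_iff_AE[of lborel "\<lambda>y. p y * y\<^sup>2"] pos z by (auto simp: less_imp_le)
        moreover have "AE y in lborel. y \<noteq> (0::real)" by (rule AE_lborel_singleton)
        ultimately have "AE y in lborel. p y * y\<^sup>2 = 0 \<and> y \<noteq> 0" by eventually_elim simp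
        then obtain y where "p y * y\<^sup>2 = 0" "y \<noteq> 0" using lborel_AE_imp_ex by blast
        then show False using pos[of y] by simp
      qed
      \<comment> \<open>If the first moment is 0, the second identity reads 0 = a times the second
        moment; otherwise the first identity suffices.\<close>
      have "a = 0"
      proof (cases "(LINT y|lborel. p y * y) = 0")
        case True
        then show ?thesis using q(2)[OF h'] m2 by simp
      next
        case False
        then show ?thesis using q(1)[OF h'] by simp
      qed
      then have "fwd_diff h g = (\<lambda>x. b * x + c)" using abc by (simp add: fun_eq_iff)
      then show ?thesis by (simp add: numeral_2_eq_2 fwd_diff_def[abs_def] algebra_simps)
    qed
    then have "diffs_vanish (Suc 2) g" by (simp only: diffs_vanish.simps) blast
    then obtain c where "\<And>x. g x = (\<Sum>i\<le>2. c i * x ^ i)"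
      using diffs_vanish_polynomial[of g 2] pgrowth_locally_bounded[OF Suc.prems(1)] pgrowth_measurable[OF Suc.prems(1)] by auto
    then have "\<forall>x. g x = c 2 * x\<^sup>2 + c 1 * x + c 0" by (simp add: numeral_2_eq_2)
    then show ?case by blast
  qed
  show ?thesis
    by (rule main[OF g harm harmonic_diffs_vanish[OF p 1 pos _ g harm]]) (use n in auto)
qed

section \<open>Moments from the characteristic function\<close>

lemma second_difference_cos_limit:
  "(\<lambda>k. (real k)\<^sup>2 * (2 - 2 * cos (x / real k))) \<longlonglongrightarrow> x\<^sup>2"
proof (cases "x = 0")
  case False
  have lim: "filterlim (\<lambda>k. x / 2 / real k) (at 0) sequentially"
    unfolding filterlim_at using lim_const_over_n[of "x / 2"] False
    by (auto intro!: eventually_mono[OF eventually_gt_at_top[of 0]])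
  have "(\<lambda>k. sin (x / 2 / real k) / (x / 2 / real k)) \<longlonglongrightarrow> 1"
    by (rule filterlim_compose[OF sinc_at_0 lim])
  then have "(\<lambda>k. x\<^sup>2 * (sin (x / 2 / real k) / (x / 2 / real k))\<^sup>2) \<longlonglongrightarrow> x\<^sup>2 * 1\<^sup>2"
    by (intro tendsto_intros)
  moreover have "\<forall>\<^sub>F k in sequentially. x\<^sup>2 * (sin (x / 2 / real k) / (x / 2 / real k))\<^sup>2
      = (real k)\<^sup>2 * (2 - 2 * cos (x / real k))"
    using eventually_gt_at_top[of 0]
  proof eventually_elim
    case (elim k)
    have "cos (x / real k) = 1 - 2 * (sin (x / 2 / real k))\<^sup>2"
      using cos_double_sin[of "x / 2 / real k"] by simp
    then have "2 - 2 * cos (x / real k) = 4 * (sin (x / 2 / real k))\<^sup>2" by simp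
    then show ?case using elim False by (simp only:) (simp add: power_divide power_mult_distrib field_simps)
  qed
  ultimately show ?thesis by (simp add: filterlim_cong[OF refl refl])
qed simp

text \<open>Fatou's lemma recovers even moments from second differences of the cosine transform.\<close>
lemma even_moment_from_cos:
  fixes N :: "real measure"
  assumes [measurable_cong]: "sets N = sets borel"
    and C: "\<forall>\<^sub>F k in sequentially.
      (\<integral>\<^sup>+x. ennreal (((real k)\<^sup>2 * (2 - 2 * cos (x / real k))) ^ j) \<partial>N) \<le> ennreal C"
  shows "integrable N (\<lambda>x. x ^ (2 * j))"
proof -
  define u where "u k x = ennreal (((real k)\<^sup>2 * (2 - 2 * cos (x / real k))) ^ j)" for k :: nat and x :: real
  have [measurable]: "u k \<in> borel_measurable N" for k unfolding u_def[abs_def] by measurable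
  have lim: "liminf (\<lambda>k. u k x) = ennreal (x ^ (2 * j))" for x
  proof (rule lim_imp_Liminf)
    have "(\<lambda>k. ((real k)\<^sup>2 * (2 - 2 * cos (x / real k))) ^ j) \<longlonglongrightarrow> (x\<^sup>2) ^ j"
      by (intro tendsto_power second_difference_cos_limit)
    then show "(\<lambda>k. u k x) \<longlonglongrightarrow> ennreal (x ^ (2 * j))"
      unfolding u_def by (intro tendsto_ennrealI) (simp add: power_mult)
  qed simp
  have "(\<integral>\<^sup>+x. ennreal (x ^ (2 * j)) \<partial>N) \<le> liminf (\<lambda>k. \<integral>\<^sup>+x. u k x \<partial>N)"
    unfolding lim[symmetric] by (rule nn_integral_liminf) measurable
  also have "\<dots> \<le> liminf (\<lambda>k::nat. ennreal C)"
    by (rule Liminf_mono) (use C in \<open>simp add: u_def\<close>)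
  also have "\<dots> = ennreal C" by (simp add: Liminf_const)
  finally have "(\<integral>\<^sup>+x. ennreal (x ^ (2 * j)) \<partial>N) < \<infinity>" by (rule order.strict_trans1) simp
  then show ?thesis by (intro integrableI_nonneg) (auto simp: zero_le_even_power)
qed

text \<open>Negative of the usual second difference. On cos (a x), as a function of a, it acts as
  multiplication by 2 - 2 cos (h x), which is nonnegative as Fatou's lemma requires.\<close>

definition sdiff :: "real \<Rightarrow> (real \<Rightarrow> real) \<Rightarrow> real \<Rightarrow> real" where
  "sdiff h u x = 2 * u x - u (x + h) - u (x - h)"

text \<open>Mean value inequality twice: for u' between x - s and x + s, and then for u (x + s) + u
  (x - s) as a function of s. The factor 2 is the price for bounding the derivative of the latter
  uniformly in s.\<close>

lemma sdiff_bound: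
  assumes d: "\<And>x. (u has_real_derivative u' x) (at x)" "\<And>x. (u' has_real_derivative u'' x) (at x)"
    and B: "\<And>y. \<bar>y - x\<bar> \<le> \<bar>h\<bar> \<Longrightarrow> \<bar>u'' y\<bar> \<le> B"
  shows "\<bar>sdiff h u x\<bar> \<le> 2 * B * h\<^sup>2"
proof -
  have B0: "B \<ge> 0" using B[of x] by simp
  have 1: "\<bar>u' (x + s) - u' (x - s)\<bar> \<le> B * (2 * \<bar>h\<bar>)" if s: "\<bar>s\<bar> \<le> \<bar>h\<bar>" for s
  proof -
    have "norm (u' (x + s) - u' (x - s)) \<le> B * norm ((x + s) - (x - s))"
      by (rule field_differentiable_bound[of "{x - \<bar>h\<bar>..x + \<bar>h\<bar>}" u' u''])
        (use s B in \<open>auto intro!: has_field_derivative_at_within d simp: abs_le_iff\<close>)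
    also have "\<dots> \<le> B * (2 * \<bar>h\<bar>)" using s B0 by (intro mult_left_mono) auto
    finally show ?thesis by simp
  qed
  have "norm ((u (x + h) + u (x - h)) - (u (x + 0) + u (x - 0))) \<le> B * (2 * \<bar>h\<bar>) * norm (h - 0)"
  proof (rule field_differentiable_bound[of "{-\<bar>h\<bar>..\<bar>h\<bar>}" "\<lambda>s. u (x + s) + u (x - s)" "\<lambda>s. u' (x + s) - u' (x - s)"])
    fix s assume s: "s \<in> {-\<bar>h\<bar>..\<bar>h\<bar>}"
    have "((\<lambda>s. u (x + s)) has_real_derivative u' (x + s) * 1) (at s within {-\<bar>h\<bar>..\<bar>h\<bar>})"
      by (rule DERIV_chain2[OF d(1)]) (auto intro!: derivative_eq_intros)
    moreover have "((\<lambda>s. u (x - s)) has_real_derivative u' (x - s) * (-1)) (at s within {-\<bar>h\<bar>..\<bar>h\<bar>})"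
      by (rule DERIV_chain2[OF d(1)]) (auto intro!: derivative_eq_intros)
    ultimately show "((\<lambda>s. u (x + s) + u (x - s)) has_field_derivative u' (x + s) - u' (x - s)) (at s within {-\<bar>h\<bar>..\<bar>h\<bar>})"
      using DERIV_add by force
    show "norm (u' (x + s) - u' (x - s)) \<le> B * (2 * \<bar>h\<bar>)" using 1[of s] s by auto
  qed auto
  then show ?thesis by (simp add: sdiff_def power2_eq_square mult_ac abs_minus_commute)
qed

text \<open>The induction applies \<open>sdiff h\<close> to the whole family of derivatives at once,
  since it commutes with differentiation. Every application reaches at most |h| <= 1 further, hence
  the radius R + k.\<close>

lemma sdiff_pow_bound:
  assumes D: "\<And>m x. (D m has_real_derivative D (Suc m) x) (at x)"
    and h: "\<bar>h\<bar> \<le> 1" and B: "\<And>y. \<bar>y\<bar> \<le> R + real k \<Longrightarrow> \<bar>D (2 * k) y\<bar> \<le> B" and x: "\<bar>x\<bar> \<le> R"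
  shows "\<bar>(sdiff h ^^ k) (D 0) x\<bar> \<le> 2 ^ k * B * h ^ (2 * k)"
  using D B
proof (induction k arbitrary: D B)
  case 0
  then show ?case using x by simp
next
  case (Suc k)
  have "\<bar>(sdiff h ^^ k) (sdiff h (D 0)) x\<bar> \<le> 2 ^ k * (2 * B * h\<^sup>2) * h ^ (2 * k)"
  proof (rule Suc.IH[of "\<lambda>m. sdiff h (D m)"])
    fix m x
    have "((\<lambda>x. D m (x + h)) has_real_derivative D (Suc m) (x + h) * 1) (at x)"
      by (rule DERIV_chain2[OF Suc.prems(1)]) (auto intro!: derivative_eq_intros)
    moreover have "((\<lambda>x. D m (x - h)) has_real_derivative D (Suc m) (x - h) * 1) (at x)"
      by (rule DERIV_chain2[OF Suc.prems(1)]) (auto intro!: derivative_eq_intros)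
    ultimately show "(sdiff h (D m) has_real_derivative sdiff h (D (Suc m)) x) (at x)"
      unfolding sdiff_def[abs_def] using Suc.prems(1)[of m x]
      by (auto intro!: DERIV_diff DERIV_cmult)
  next
    fix y assume y: "\<bar>y\<bar> \<le> R + real k"
    show "\<bar>sdiff h (D (2 * k)) y\<bar> \<le> 2 * B * h\<^sup>2"
    proof (rule sdiff_bound[OF Suc.prems(1) Suc.prems(1)])
      fix z assume "\<bar>z - y\<bar> \<le> \<bar>h\<bar>"
      then show "\<bar>D (Suc (Suc (2 * k))) z\<bar> \<le> B" using Suc.prems(2)[of z] y h by simp
    qed
  qed
  then show ?case by (simp add: funpow_swap1 power2_eq_square mult_ac)
qed

text \<open>\<open>smooth\<close> asks for all derivatives as one sequence. A set closed under
  differentiation supplies it by iterating a choice of derivative inside the set.\<close>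

lemma smooth_of_closed:
  assumes cl: "\<And>f. f \<in> S \<Longrightarrow> \<exists>f'\<in>S. \<forall>x. (f has_vector_derivative f' x) (at x)" and f: "f \<in> S"
  shows "smooth f"
proof -
  obtain d where d: "\<And>f. f \<in> S \<Longrightarrow> d f \<in> S" "\<And>f x. f \<in> S \<Longrightarrow> (f has_vector_derivative d f x) (at x)"
    using cl by metis
  have "(d ^^ k) f \<in> S" for k by (induction k) (auto simp: f d)
  then show ?thesis unfolding smooth_def using d by (intro exI[of _ "\<lambda>k. (d ^^ k) f"]) auto
qed

text \<open>An algebra that contains \<open>exp (c * \<psi>)\<close> and is closed under differentiation.\<close>
inductive_set exp_algebra :: "(nat \<Rightarrow> real \<Rightarrow> complex) \<Rightarrow> complex \<Rightarrow> (real \<Rightarrow> complex) set"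
  for D c where
  "D k \<in> exp_algebra D c"
| "(\<lambda>x. exp (c * D 0 x)) \<in> exp_algebra D c"
| "(\<lambda>x. a) \<in> exp_algebra D c"
| "f \<in> exp_algebra D c \<Longrightarrow> g \<in> exp_algebra D c \<Longrightarrow> (\<lambda>x. f x + g x) \<in> exp_algebra D c"
| "f \<in> exp_algebra D c \<Longrightarrow> g \<in> exp_algebra D c \<Longrightarrow> (\<lambda>x. f x * g x) \<in> exp_algebra D c"

lemma smooth_exp:
  fixes \<psi> :: "real \<Rightarrow> complex"
  assumes "smooth \<psi>" shows "smooth (\<lambda>x. exp (c * \<psi> x))"
proof -
  obtain D where D: "D 0 = \<psi>" "\<And>k x. (D k has_vector_derivative D (Suc k) x) (at x)"
    using assms unfolding smooth_def by blast
  have "\<exists>f'\<in>exp_algebra D c. \<forall>x. (f has_vector_derivative f' x) (at x)" if "f \<in> exp_algebra D c" for f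
    using that
  proof induction
    case (1 k)
    show ?case by (rule bexI[of _ "D (Suc k)"]) (auto intro: D exp_algebra.intros)
  next
    case 2
    show ?case
    proof (rule bexI[of _ "\<lambda>x. (c * D (Suc 0) x) * exp (c * D 0 x)"], intro allI)
      fix x
      have "((\<lambda>x. c * D 0 x) has_vector_derivative c * D (Suc 0) x) (at x)"
        using has_vector_derivative_mult_right[OF D(2)[of 0 x]] by simp
      from field_vector_diff_chain_at[OF this DERIV_exp]
      show "((\<lambda>x. exp (c * D 0 x)) has_vector_derivative c * D (Suc 0) x * exp (c * D 0 x)) (at x)"
        by (simp add: o_def)
    qed (intro exp_algebra.intros)
  next
    case (3 a)
    show ?case by (rule bexI[of _ "\<lambda>x. 0"]) (auto intro: exp_algebra.intros)
  next
    case (4 f g)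
    then obtain f' g' where "f' \<in> exp_algebra D c" "g' \<in> exp_algebra D c"
      "\<And>x. (f has_vector_derivative f' x) (at x)" "\<And>x. (g has_vector_derivative g' x) (at x)" by blast
    then show ?case
      by (intro bexI[of _ "\<lambda>x. f' x + g' x"]) (auto intro!: has_vector_derivative_add exp_algebra.intros)
  next
    case (5 f g)
    then obtain f' g' where "f' \<in> exp_algebra D c" "g' \<in> exp_algebra D c"
      "\<And>x. (f has_vector_derivative f' x) (at x)" "\<And>x. (g has_vector_derivative g' x) (at x)" by blast
    then show ?case
      by (intro bexI[of _ "\<lambda>x. f x * g' x + f' x * g x"])
        (auto intro!: has_vector_derivative_mult exp_algebra.intros 5)
  qed
  then have "smooth (\<lambda>x. exp (c * D 0 x))" by (rule smooth_of_closed) (auto intro: exp_algebra.intros)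
  then show ?thesis by (simp add: D)
qed

text \<open>The k-fold second difference at 0 of the real part of the characteristic function is E
  (2 - 2 cos (h X))^k. Smoothness bounds it by a multiple of h^(2 k), and with h = 1 / m this is the
  bound that \<open>even_moment_from_cos\<close> needs.\<close>

lemma smooth_char_moments:
  assumes "real_distribution N" and sm: "smooth (char N)"
  shows "integrable N (\<lambda>x. x ^ (2 * k))"
proof -
  interpret real_distribution N by fact
  obtain D where D: "D 0 = char N" "\<And>k x. (D k has_vector_derivative D (Suc k) x) (at x)"
    using sm unfolding smooth_def by blast
  define D' where "D' m x = Re (D m x)" for m x
  have D': "(D' m has_real_derivative D' (Suc m) x) (at x)" for m x
    unfolding D'_def[abs_def] has_real_derivative_iff_has_vector_derivative
    using bounded_linear.has_vector_derivative[OF bounded_linear_Re D(2)[of m x]] by simp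
  have cosint: "integrable N (\<lambda>x. cos (a * x) * (2 - 2 * cos (h * x)) ^ j)" for a h j
  proof (rule integrable_const_bound[of _ "4 ^ j"])
    have "\<bar>cos (a * x)\<bar> * (2 - 2 * cos (h * x)) ^ j \<le> 1 * 4 ^ j" for x
    proof (intro mult_mono power_mono)
      show "2 - 2 * cos (h * x) \<le> 4" using cos_ge_minus_one[of "h * x"] by linarith
    qed auto
    then show "AE x in N. norm (cos (a * x) * (2 - 2 * cos (h * x)) ^ j) \<le> 4 ^ j"
      by (intro AE_I2) (simp add: abs_mult)
  qed simp
  \<comment> \<open>The induction needs general a because \<open>sdiff\<close> evaluates at a + h
    and a - h; the moment bound takes a = 0, where the cosine factor is 1.\<close>
  have pow: "(sdiff h ^^ j) (D' 0) a = (LINT x|N. cos (a * x) * (2 - 2 * cos (h * x)) ^ j)" for h j a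
  proof (induction j arbitrary: a)
    case 0
    have "D' 0 a = Re (CLINT x|N. iexp (a * x))" by (simp add: D'_def D char_def)
    also have "\<dots> = (LINT x|N. Re (iexp (a * x)))" by (subst integral_Re) (auto intro: integrable_iexp)
    also have "\<dots> = (LINT x|N. cos (a * x))" by (simp add: Re_exp)
    finally show ?case by simp
  next
    case (Suc j)
    have "(sdiff h ^^ Suc j) (D' 0) a = (LINT x|N. 2 * (cos (a * x) * (2 - 2 * cos (h * x)) ^ j)
      - cos ((a + h) * x) * (2 - 2 * cos (h * x)) ^ j - cos ((a - h) * x) * (2 - 2 * cos (h * x)) ^ j)"
      unfolding funpow.simps o_def sdiff_def[of h "(sdiff h ^^ j) (D' 0)"] Suc by (simp add: cosint)
    also have "\<dots> = (LINT x|N. cos (a * x) * (2 - 2 * cos (h * x)) ^ Suc j)"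
      by (intro Bochner_Integration.integral_cong refl)
        (simp add: distrib_right left_diff_distrib cos_add cos_diff, simp add: algebra_simps)
    finally show ?case .
  qed
  \<comment> \<open>k second differences at 0 with steps of length at most 1 stay inside [-k, k], so
    a bound of the derivative of order 2 k on this interval is enough.\<close>
  have "continuous_on {- real k..real k} (D' (2 * k))"
    by (intro continuous_at_imp_continuous_on ballI DERIV_isCont[OF D'])
  then have "compact (D' (2 * k) ` {- real k..real k})" by (intro compact_continuous_image) auto
  then obtain B where B: "\<And>y. y \<in> D' (2 * k) ` {- real k..real k} \<Longrightarrow> norm y \<le> B"
    using compact_imp_bounded bounded_iff by metis
  show ?thesis
  proof (rule even_moment_from_cos)
    show "sets N = sets borel" by simp
    show "\<forall>\<^sub>F m in sequentially.
      (\<integral>\<^sup>+x. ennreal (((real m)\<^sup>2 * (2 - 2 * cos (x / real m))) ^ k) \<partial>N) \<le> ennreal (2 ^ k * B)"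
      using eventually_gt_at_top[of 0]
    proof eventually_elim
      case (elim m)
      define h where "h = 1 / real m"
      have h: "\<bar>h\<bar> \<le> 1" "real m * h = 1" using elim by (auto simp: h_def)
      have "(\<integral>\<^sup>+x. ennreal (((real m)\<^sup>2 * (2 - 2 * cos (x / real m))) ^ k) \<partial>N)
        = (\<integral>\<^sup>+x. ennreal (real m ^ (2 * k) * (cos (0 * x) * (2 - 2 * cos (h * x)) ^ k)) \<partial>N)"
        by (intro nn_integral_cong) (simp add: power_mult_distrib power_mult h_def)
      also have "\<dots> = ennreal (LINT x|N. real m ^ (2 * k) * (cos (0 * x) * (2 - 2 * cos (h * x)) ^ k))"
        by (intro nn_integral_eq_integral integrable_mult_right cosint AE_I2) auto
      also have "(LINT x|N. real m ^ (2 * k) * (cos (0 * x) * (2 - 2 * cos (h * x)) ^ k))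
        = real m ^ (2 * k) * (sdiff h ^^ k) (D' 0) 0" unfolding pow by (rule integral_mult_right_zero)
      also have "\<dots> \<le> real m ^ (2 * k) * (2 ^ k * B * h ^ (2 * k))"
      proof (intro mult_left_mono)
        have "\<bar>(sdiff h ^^ k) (D' 0) 0\<bar> \<le> 2 ^ k * B * h ^ (2 * k)"
          by (rule sdiff_pow_bound[where D = D' and R = 0]) (use B D' h in \<open>auto simp: abs_le_iff\<close>)
        then show "(sdiff h ^^ k) (D' 0) 0 \<le> 2 ^ k * B * h ^ (2 * k)" by linarith
      qed simp
      also have "\<dots> = 2 ^ k * B * (real m * h) ^ (2 * k)" by (simp add: power_mult_distrib)
      finally show ?case by (simp add: h ennreal_leI)
    qed
  qed
qed

section \<open>The Levy triplet\<close>

lemma abs_sin_minus_self: "\<bar>sin x - x\<bar> \<le> x\<^sup>2 / 2" for x :: real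
proof -
  have "cmod (iexp x - (\<Sum>k\<le>1. (\<i> * x) ^ k / fact k)) \<le> \<bar>x\<bar> ^ Suc 1 / fact (Suc 1)"
    by (rule iexp_approx1)
  moreover have "\<bar>sin x - x\<bar> = \<bar>Im (iexp x - (\<Sum>k\<le>1. (\<i> * x) ^ k / fact k))\<bar>"
    by (simp add: Im_exp)
  ultimately show ?thesis using abs_Im_le_cmod[of "iexp x - (\<Sum>k\<le>1. (\<i> * x) ^ k / fact k)"]
    by (simp add: numeral_2_eq_2)
qed

text \<open>Convergence of k a_k forces a_k to 0, and the error k a_k^2 / 2 is the product of a
  convergent and a null sequence.\<close>

lemma tendsto_scaled_sin:
  assumes "(\<lambda>k. real k * a k) \<longlonglongrightarrow> L"
  shows "(\<lambda>k. real k * sin (a k)) \<longlonglongrightarrow> L"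
proof -
  have "(\<lambda>k. (real k * a k) * inverse (real k)) \<longlonglongrightarrow> L * 0"
    by (intro tendsto_mult assms lim_inverse_n)
  then have a0: "(\<lambda>k. (real k * a k) * inverse (real k)) \<longlonglongrightarrow> 0" by simp
  have "(\<lambda>k. real k * a k * ((real k * a k) * inverse (real k)) / 2) \<longlonglongrightarrow> L * 0 / 2"
    by (intro tendsto_intros assms a0) simp
  then have lim: "(\<lambda>k. real k * a k * ((real k * a k) * inverse (real k)) / 2) \<longlonglongrightarrow> 0" by simp
  have "(\<lambda>k. real k * sin (a k) - real k * a k) \<longlonglongrightarrow> 0"
  proof (rule Lim_null_comparison[OF _ lim])
    have "norm (real k * sin (a k) - real k * a k) \<le> real k * a k * ((real k * a k) * inverse (real k)) / 2" for k
    proof -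
      have "norm (real k * sin (a k) - real k * a k) = real k * \<bar>sin (a k) - a k\<bar>"
        by (simp add: right_diff_distrib[symmetric] abs_mult)
      also have "\<dots> \<le> real k * ((a k)\<^sup>2 / 2)" by (intro mult_left_mono abs_sin_minus_self) auto
      also have "\<dots> = real k * a k * ((real k * a k) * inverse (real k)) / 2"
        by (cases "k = 0") (auto simp: power2_eq_square)
      finally show ?thesis .
    qed
    then show "\<forall>\<^sub>F k in sequentially. norm (real k * sin (a k) - real k * a k)
      \<le> real k * a k * ((real k * a k) * inverse (real k)) / 2" by simp
  qed
  from tendsto_add[OF this assms] show ?thesis by simp
qed

text \<open>Needed for Fubini. By Markov's inequality the sets where min (y^2) 1 is at least 1 / (i
  + 1) have finite measure; they cover everything but 0, and {0} is null.\<close>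

lemma levy_measure_sigma_finite:
  assumes "levy_measure \<nu>" shows "sigma_finite_measure \<nu>"
proof
  have [measurable_cong]: "sets \<nu> = sets borel" and 0: "emeasure \<nu> {0} = 0"
    and int: "integrable \<nu> (\<lambda>y. min (y\<^sup>2) 1)" using assms by (auto simp: levy_measure_def)
  have sp: "space \<nu> = UNIV" using sets_eq_imp_space_eq[of \<nu> borel] assms by (simp add: levy_measure_def)
  define A where "A i = {y :: real. 1 / real (Suc i) \<le> min (y\<^sup>2) 1}" for i
  have fin: "emeasure \<nu> (A i) \<noteq> \<infinity>" for i
    using integral_Markov_inequality[OF int, of "1 / real (Suc i)"]
    by (auto simp: A_def sp top_unique ennreal_mult_less_top intro!: AE_I2)
  have meas: "A i \<in> sets \<nu>" for i unfolding A_def by measurable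
  have cov: "insert {0} (range A) \<subseteq> sets \<nu>" using meas assms by (auto simp: levy_measure_def)
  have un: "\<Union> (insert {0} (range A)) = space \<nu>"
  proof -
    have "\<exists>i. y \<in> A i" if "y \<noteq> 0" for y :: real
    proof -
      have "0 < min (y\<^sup>2) 1" using that by simp
      then obtain i where "inverse (real (Suc i)) < min (y\<^sup>2) 1" using reals_Archimedean by blast
      then show ?thesis by (auto simp: A_def inverse_eq_divide intro!: exI[of _ i])
    qed
    then show ?thesis by (auto simp: sp)
  qed
  show "\<exists>A. countable A \<and> A \<subseteq> sets \<nu> \<and> \<Union> A = space \<nu> \<and> (\<forall>a\<in>A. emeasure \<nu> a \<noteq> \<infinity>)"
    by (rule exI[of _ "insert {0} (range A)"]) (use cov un fin 0 in \<open>auto\<close>)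
qed

lemma levy_khintchine_integrable:
  assumes "levy_measure \<nu>"
  shows "complex_integrable \<nu> (\<lambda>y. 1 - iexp (y * \<xi>) + \<i> * complex_of_real (y * \<xi> * indicator {0<..<1} \<bar>y\<bar>))"
proof -
  have [measurable_cong]: "sets \<nu> = sets borel"
    and int: "integrable \<nu> (\<lambda>y. min (y\<^sup>2) 1)" using assms by (auto simp: levy_measure_def)
  show ?thesis
  proof (rule Bochner_Integration.integrable_bound)
    \<comment> \<open>For |y| < 1 the compensated integrand is a Taylor remainder of size \<xi>^2
      y^2 / 2; for |y| >= 1 it is at most 2. The constant covers both.\<close>
    show "integrable \<nu> (\<lambda>y. (\<xi>\<^sup>2 + 2) * min (y\<^sup>2) 1)" by (intro integrable_mult_right int)
    have "cmod (1 - iexp (y * \<xi>) + \<i> * complex_of_real (y * \<xi> * indicator {0<..<1} \<bar>y\<bar>))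
        \<le> (\<xi>\<^sup>2 + 2) * min (y\<^sup>2) 1" for y
    proof (cases "\<bar>y\<bar> < 1")
      case True
      have "cmod (iexp (y * \<xi>) - (\<Sum>k\<le>1. (\<i> * (y * \<xi>)) ^ k / fact k)) \<le> \<bar>y * \<xi>\<bar> ^ Suc 1 / fact (Suc 1)"
        using iexp_approx1[of "y * \<xi>" 1] by simp
      moreover have "1 - iexp (y * \<xi>) + \<i> * complex_of_real (y * \<xi> * indicator {0<..<1} \<bar>y\<bar>)
          = - (iexp (y * \<xi>) - (\<Sum>k\<le>1. (\<i> * (y * \<xi>)) ^ k / fact k))"
        using True by (cases "y = 0") (auto simp: indicator_def)
      moreover have "\<bar>y * \<xi>\<bar> ^ Suc 1 / fact (Suc 1) = y\<^sup>2 * \<xi>\<^sup>2 / 2"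
        by (simp add: numeral_2_eq_2 abs_mult power2_eq_square mult_ac)
      ultimately have "cmod (1 - iexp (y * \<xi>) + \<i> * complex_of_real (y * \<xi> * indicator {0<..<1} \<bar>y\<bar>))
        \<le> y\<^sup>2 * \<xi>\<^sup>2 / 2" by (simp only: norm_minus_cancel)
      also have "\<dots> \<le> (\<xi>\<^sup>2 + 2) * y\<^sup>2" by (simp add: algebra_simps)
      also have "y\<^sup>2 = min (y\<^sup>2) 1" using True by (simp add: abs_square_le_1 less_imp_le min_def)
      finally show ?thesis by simp
    next
      case False
      then have "1 \<le> y\<^sup>2" by (simp add: abs_square_less_1[symmetric] not_less[symmetric])
      then have "min (y\<^sup>2) 1 = 1" by simp
      moreover have "cmod (1 - iexp (y * \<xi>)) \<le> 2"
        using norm_triangle_ineq4[of 1 "iexp (y * \<xi>)"] by simp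
      ultimately show ?thesis using False by (simp add: indicator_def) (smt (verit) zero_le_power2)
    qed
    then show "AE y in \<nu>. norm (1 - iexp (y * \<xi>) + \<i> * complex_of_real (y * \<xi> * indicator {0<..<1} \<bar>y\<bar>))
        \<le> norm ((\<xi>\<^sup>2 + 2) * min (y\<^sup>2) 1)"
      by (intro AE_I2) (metis abs_ge_self order_trans real_norm_def)
  qed measurable
qed

lemma Re_levy_khintchine:
  assumes "levy_measure \<nu>"
  shows "integrable \<nu> (\<lambda>y. 1 - cos (y * \<xi>))"
    and "Re (levy_khintchine b s2 \<nu> \<xi>) = s2 * \<xi>\<^sup>2 / 2 + (LINT y|\<nu>. 1 - cos (y * \<xi>))"
    and "integrable \<nu> (\<lambda>y. y * \<xi> * indicator {0<..<1} \<bar>y\<bar> - sin (y * \<xi>))"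
    and "Im (levy_khintchine b s2 \<nu> \<xi>) = - b * \<xi> + (LINT y|\<nu>. y * \<xi> * indicator {0<..<1} \<bar>y\<bar> - sin (y * \<xi>))"
proof -
  note int = levy_khintchine_integrable[OF assms, of \<xi>]
  have R: "Re (1 - iexp (y * \<xi>) + \<i> * complex_of_real (y * \<xi> * indicator {0<..<1} \<bar>y\<bar>)) = 1 - cos (y * \<xi>)" for y
    by (simp add: Re_exp)
  have I: "Im (1 - iexp (y * \<xi>) + \<i> * complex_of_real (y * \<xi> * indicator {0<..<1} \<bar>y\<bar>))
      = y * \<xi> * indicator {0<..<1} \<bar>y\<bar> - sin (y * \<xi>)" for y
    by (simp add: Im_exp)
  show "integrable \<nu> (\<lambda>y. 1 - cos (y * \<xi>))" using integrable_Re[OF int] unfolding R .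
  show "integrable \<nu> (\<lambda>y. y * \<xi> * indicator {0<..<1} \<bar>y\<bar> - sin (y * \<xi>))" using integrable_Im[OF int] unfolding I .
  show "Re (levy_khintchine b s2 \<nu> \<xi>) = s2 * \<xi>\<^sup>2 / 2 + (LINT y|\<nu>. 1 - cos (y * \<xi>))"
    unfolding levy_khintchine_def using integral_Re[OF int] unfolding R by simp
  show "Im (levy_khintchine b s2 \<nu> \<xi>) = - b * \<xi> + (LINT y|\<nu>. y * \<xi> * indicator {0<..<1} \<bar>y\<bar> - sin (y * \<xi>))"
    unfolding levy_khintchine_def using integral_Im[OF int] unfolding I by simp
qed

text \<open>A finite second moment of the law bounds Re \<psi> near 0 by a multiple of \<xi>^2, and
  Fatou's lemma turns this into a second moment of \<nu>. The mean is the limit of k times the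
  imaginary part of the characteristic function at 1 / k, computed once from the law and once from
  the exponent.\<close>

lemma levy_second_moment_and_mean:
  assumes triplet: "levy_triplet \<psi> b s2 \<nu>" and N: "real_distribution N" and t: "t > 0"
    and char: "\<And>\<xi>. char N \<xi> = exp (- complex_of_real t * \<psi> \<xi>)"
    and int2: "integrable N (\<lambda>x. x\<^sup>2)"
  shows "integrable \<nu> (\<lambda>y. y\<^sup>2)"
    and "(LINT x|N. x) = t * (b + (LINT y|\<nu>. y * indicator {1..} \<bar>y\<bar>))"
proof -
  interpret real_distribution N by fact
  have lm: "levy_measure \<nu>" and s2: "s2 \<ge> 0" and \<psi>: "\<And>\<xi>. \<psi> \<xi> = levy_khintchine b s2 \<nu> \<xi>"
    using triplet by (auto simp: levy_triplet_def)
  have sets[measurable_cong]: "sets \<nu> = sets borel" using lm by (auto simp: levy_measure_def)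
  note LK = Re_levy_khintchine[OF lm]
  define s where "s = (LINT x|N. x\<^sup>2)"
  have s0: "s \<ge> 0" unfolding s_def by (intro integral_nonneg_AE) auto
  have Re0: "Re (\<psi> \<xi>) \<ge> 0" for \<xi>
    unfolding \<psi> LK(2) using s2 by (intro add_nonneg_nonneg integral_nonneg_AE) auto
  have char_eq: "char N \<xi> = (CLINT x|N. iexp (\<xi> * x))" for \<xi> by (simp add: char_def)
  have iint: "complex_integrable N (\<lambda>x. iexp (\<xi> * x))" for \<xi> by (rule integrable_iexp) auto
  have Rechar: "Re (char N \<xi>) = (LINT x|N. cos (\<xi> * x))" for \<xi>
    unfolding char_eq integral_Re[OF iint, symmetric] by (simp add: Re_exp)
  have Imchar: "Im (char N \<xi>) = (LINT x|N. sin (\<xi> * x))" for \<xi>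
    unfolding char_eq integral_Im[OF iint, symmetric] by (simp add: Im_exp)
  have cosb: "1 - z\<^sup>2 / 2 \<le> cos z" for z :: real
  proof -
    have "(sin (z / 2))\<^sup>2 \<le> (z / 2)\<^sup>2" using abs_sin_x_le_abs_x[of "z / 2"] by (metis abs_le_square_iff)
    then show ?thesis using cos_double_sin[of "z / 2"] by (simp add: power_divide)
  qed
  \<comment> \<open>The restriction on \<xi> keeps z = \<xi>^2 s / 2 at most 1/2, where the
    logarithm can be taken and - ln (1 - z) <= z + 2 z^2 <= 2 z.\<close>
  have Re_bound: "Re (\<psi> \<xi>) \<le> \<xi>\<^sup>2 * s / t" if \<xi>: "\<xi>\<^sup>2 * s \<le> 1" for \<xi>
  proof -
    have "1 - \<xi>\<^sup>2 * s / 2 = (LINT x|N. 1 - \<xi>\<^sup>2 / 2 * x\<^sup>2)"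
      using int2 by (simp add: s_def prob_space[simplified])
    also have "\<dots> \<le> (LINT x|N. cos (\<xi> * x))"
    proof (intro integral_mono)
      show "integrable N (\<lambda>x. cos (\<xi> * x))" using integrable_Re[OF iint[of \<xi>]] by (simp add: Re_exp)
      show "1 - \<xi>\<^sup>2 / 2 * x\<^sup>2 \<le> cos (\<xi> * x)" for x using cosb[of "\<xi> * x"] by (simp add: power_mult_distrib)
    qed (use int2 in auto)
    also have "\<dots> \<le> cmod (char N \<xi>)" unfolding Rechar[symmetric] by (rule complex_Re_le_cmod)
    also have "\<dots> = exp (- (t * Re (\<psi> \<xi>)))" unfolding char norm_exp_eq_Re by simp
    finally have 1: "1 - \<xi>\<^sup>2 * s / 2 \<le> exp (- (t * Re (\<psi> \<xi>)))" .
    define z where "z = \<xi>\<^sup>2 * s / 2"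
    have z: "0 \<le> z" "z \<le> 1/2" using \<xi> s0 by (auto simp: z_def)
    have "- z - 2 * z\<^sup>2 \<le> ln (1 - z)" by (rule ln_one_minus_pos_lower_bound) (use z in auto)
    also have "\<dots> \<le> ln (exp (- (t * Re (\<psi> \<xi>))))" using 1 z by (subst ln_le_cancel_iff) (auto simp: z_def)
    finally have "t * Re (\<psi> \<xi>) \<le> z + 2 * z\<^sup>2" by simp
    also have "z + 2 * z\<^sup>2 \<le> 2 * z" using z mult_left_mono[of z "1/2" z] by (simp add: power2_eq_square)
    also have "2 * z = \<xi>\<^sup>2 * s" by (simp add: z_def)
    finally have "t * Re (\<psi> \<xi>) \<le> \<xi>\<^sup>2 * s" .
    then show ?thesis using t by (simp add: pos_le_divide_eq mult_ac)
  qed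
  have small: "\<forall>\<^sub>F k in sequentially. (1 / real k)\<^sup>2 * s \<le> 1"
  proof -
    obtain K :: nat where K: "s \<le> real K" using real_arch_simple by blast
    show ?thesis using eventually_ge_at_top[of "max 1 K"]
    proof eventually_elim
      case (elim k)
      have "s \<le> real k" using K elim by simp
      also have "\<dots> \<le> (real k)\<^sup>2" using elim by (intro self_le_power) auto
      finally show ?case using elim by (simp add: power_divide divide_le_eq)
    qed
  qed
  have "integrable \<nu> (\<lambda>y. y ^ (2 * 1))"
  proof (rule even_moment_from_cos[OF sets])
    show "\<forall>\<^sub>F k in sequentially. (\<integral>\<^sup>+x. ennreal (((real k)\<^sup>2 * (2 - 2 * cos (x / real k))) ^ 1) \<partial>\<nu>) \<le> ennreal (2 * s / t)"
      using small eventually_gt_at_top[of 0]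
    proof eventually_elim
      case (elim k)
      have "(\<integral>\<^sup>+x. ennreal (((real k)\<^sup>2 * (2 - 2 * cos (x / real k))) ^ 1) \<partial>\<nu>)
        = (\<integral>\<^sup>+x. ennreal (2 * (real k)\<^sup>2 * (1 - cos (x * (1 / real k)))) \<partial>\<nu>)"
        by (simp add: algebra_simps)
      also have "\<dots> = ennreal (LINT x|\<nu>. 2 * (real k)\<^sup>2 * (1 - cos (x * (1 / real k))))"
        by (intro nn_integral_eq_integral integrable_mult_right LK(1) AE_I2) auto
      also have "(LINT x|\<nu>. 2 * (real k)\<^sup>2 * (1 - cos (x * (1 / real k))))
        = 2 * (real k)\<^sup>2 * (LINT x|\<nu>. 1 - cos (x * (1 / real k)))" by (rule integral_mult_right_zero)
      also have "\<dots> \<le> 2 * (real k)\<^sup>2 * Re (\<psi> (1 / real k))"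
        unfolding \<psi> LK(2) using s2 by (intro mult_left_mono) auto
      also have "\<dots> \<le> 2 * (real k)\<^sup>2 * ((1 / real k)\<^sup>2 * s / t)"
        by (intro mult_left_mono Re_bound elim) auto
      also have "\<dots> = 2 * s / t" using elim by (simp add: power_divide)
      finally show ?case by (simp add: ennreal_leI)
    qed
  qed
  then show i2: "integrable \<nu> (\<lambda>y. y\<^sup>2)" by simp
  define \<mu>1 where "\<mu>1 = (LINT y|\<nu>. y * indicator {1..} \<bar>y\<bar>)"
  define v where "v k = Im (\<psi> (1 / real k))" for k :: nat
  have "(\<lambda>k. LINT y|\<nu>. real k * (y * (1 / real k) * indicator {0<..<1} \<bar>y\<bar> - sin (y * (1 / real k))))
    \<longlonglongrightarrow> (LINT y|\<nu>. y * indicator {0<..<1} \<bar>y\<bar> - y)"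
  \<comment> \<open>For |y| < 1 the scaled difference is a sine remainder of order y^2; for |y| >= 1
    it is at most |y| <= y^2. So the second moment just obtained dominates.\<close>
  proof (rule integral_dominated_convergence[where w = "\<lambda>y. 2 * y\<^sup>2"])
    show "integrable \<nu> (\<lambda>y. 2 * y\<^sup>2)" using i2 by simp
    show "AE y in \<nu>. (\<lambda>k. real k * (y * (1 / real k) * indicator {0<..<1} \<bar>y\<bar> - sin (y * (1 / real k))))
      \<longlonglongrightarrow> y * indicator {0<..<1} \<bar>y\<bar> - y"
    proof (rule AE_I2)
      fix y :: real
      have "\<forall>\<^sub>F k in sequentially. y = real k * (y * (1 / real k))"
        using eventually_gt_at_top[of 0] by eventually_elim simp
      then have "(\<lambda>k. real k * (y * (1 / real k))) \<longlonglongrightarrow> y" by (rule Lim_transform_eventually[OF tendsto_const])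
      from tendsto_diff[OF tendsto_mult[OF this tendsto_const] tendsto_scaled_sin[OF this]]
      show "(\<lambda>k. real k * (y * (1 / real k) * indicator {0<..<1} \<bar>y\<bar> - sin (y * (1 / real k))))
        \<longlonglongrightarrow> y * indicator {0<..<1} \<bar>y\<bar> - y" by (simp only: right_diff_distrib mult.assoc)
    qed
    show "AE y in \<nu>. norm (real k * (y * (1 / real k) * indicator {0<..<1} \<bar>y\<bar> - sin (y * (1 / real k)))) \<le> 2 * y\<^sup>2" for k
    proof (rule AE_I2)
      fix y :: real
      show "norm (real k * (y * (1 / real k) * indicator {0<..<1} \<bar>y\<bar> - sin (y * (1 / real k)))) \<le> 2 * y\<^sup>2"
      proof (cases "k = 0")
        case False
        then have k: "real k \<ge> 1" by simp
        show ?thesis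
        proof (cases "\<bar>y\<bar> < 1")
          case True
          have e: "y * (1 / real k) * indicator {0<..<1} \<bar>y\<bar> = y * (1 / real k)" using True by (auto simp: indicator_def)
          have "norm (real k * (y * (1 / real k) * indicator {0<..<1} \<bar>y\<bar> - sin (y * (1 / real k))))
            = real k * \<bar>sin (y * (1 / real k)) - y * (1 / real k)\<bar>" unfolding e by (simp add: abs_mult abs_minus_commute)
          also have "\<dots> \<le> real k * ((y * (1 / real k))\<^sup>2 / 2)" by (intro mult_left_mono abs_sin_minus_self) auto
          also have "\<dots> = y\<^sup>2 / (2 * real k)" using k by (simp add: power2_eq_square)
          also have "\<dots> \<le> y\<^sup>2 / 1" using k by (intro divide_left_mono) auto
          also have "\<dots> \<le> 2 * y\<^sup>2" by simp
          finally show ?thesis .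
        next
          case False
          have "norm (real k * (y * (1 / real k) * indicator {0<..<1} \<bar>y\<bar> - sin (y * (1 / real k))))
            = real k * \<bar>sin (y * (1 / real k))\<bar>" using False by (simp add: abs_mult indicator_def)
          also have "\<dots> \<le> real k * \<bar>y * (1 / real k)\<bar>" by (intro mult_left_mono abs_sin_x_le_abs_x) auto
          also have "\<dots> = \<bar>y\<bar> * 1" using k by (simp add: abs_mult)
          also have "\<bar>y\<bar> * 1 \<le> \<bar>y\<bar> * \<bar>y\<bar>" using False by (intro mult_left_mono) auto
          also have "\<dots> \<le> 2 * y\<^sup>2" by (simp add: power2_eq_square)
          finally show ?thesis .
        qed
      qed simp
    qed
  qed measurable
  then have "(\<lambda>k. - b + (LINT y|\<nu>. real k * (y * (1 / real k) * indicator {0<..<1} \<bar>y\<bar> - sin (y * (1 / real k)))))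
    \<longlonglongrightarrow> - b + (LINT y|\<nu>. y * indicator {0<..<1} \<bar>y\<bar> - y)" by (intro tendsto_add tendsto_const)
  moreover have "\<forall>\<^sub>F k in sequentially. - b + (LINT y|\<nu>. real k * (y * (1 / real k) * indicator {0<..<1} \<bar>y\<bar> - sin (y * (1 / real k))))
     = real k * v k"
    using eventually_gt_at_top[of 0]
    by eventually_elim (simp only: v_def \<psi> LK(4) integral_mult_right_zero, simp add: algebra_simps)
  moreover have "(LINT y|\<nu>. y * indicator {0<..<1} \<bar>y\<bar> - y) = - \<mu>1"
  proof -
    have "(LINT y|\<nu>. y * indicator {0<..<1} \<bar>y\<bar> - y) = (LINT y|\<nu>. - (y * indicator {1..} \<bar>y\<bar>))"
      by (intro Bochner_Integration.integral_cong refl) (auto simp: indicator_def)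
    then show ?thesis by (simp add: \<mu>1_def)
  qed
  ultimately have kv: "(\<lambda>k. real k * v k) \<longlonglongrightarrow> - b - \<mu>1"
    using Lim_transform_eventually by fastforce
  then have "(\<lambda>k. t * (real k * v k)) \<longlonglongrightarrow> t * (- b - \<mu>1)" by (intro tendsto_intros)
  then have "(\<lambda>k. real k * (t * v k)) \<longlonglongrightarrow> t * (- b - \<mu>1)" by (simp only: mult.left_commute)
  then have sinv: "(\<lambda>k. real k * sin (t * v k)) \<longlonglongrightarrow> t * (- b - \<mu>1)" by (rule tendsto_scaled_sin)
  \<comment> \<open>Im exp (- t \<psi>) equals - exp (- t Re \<psi>) sin (t Im \<psi>). This limit
    makes the exponential factor tend to 1, so that the sine alone decides.\<close>
  have Re_lim: "(\<lambda>k. Re (\<psi> (1 / real k))) \<longlonglongrightarrow> 0"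
  proof (rule tendsto_sandwich[OF _ _ tendsto_const])
    show "\<forall>\<^sub>F k in sequentially. 0 \<le> Re (\<psi> (1 / real k))" using Re0 by simp
    show "\<forall>\<^sub>F k in sequentially. Re (\<psi> (1 / real k)) \<le> (1 / real k)\<^sup>2 * s / t"
      using small by eventually_elim (rule Re_bound)
    have "(\<lambda>k. (1 / real k)\<^sup>2 * s / t) \<longlonglongrightarrow> 0\<^sup>2 * s / t"
      using t by (intro tendsto_intros lim_1_over_n) auto
    then show "(\<lambda>k. (1 / real k)\<^sup>2 * s / t) \<longlonglongrightarrow> 0" by simp
  qed
  have "(\<lambda>k. exp (- (t * Re (\<psi> (1 / real k)))) * (real k * sin (t * v k))) \<longlonglongrightarrow> exp (- (t * 0)) * (t * (- b - \<mu>1))"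
    by (intro tendsto_intros Re_lim sinv)
  then have "(\<lambda>k. - (exp (- (t * Re (\<psi> (1 / real k)))) * (real k * sin (t * v k)))) \<longlonglongrightarrow> - (t * (- b - \<mu>1))"
    by (intro tendsto_minus) simp
  moreover have "- (exp (- (t * Re (\<psi> (1 / real k)))) * (real k * sin (t * v k))) = real k * Im (char N (1 / real k))" for k
    unfolding char Im_exp v_def by simp
  ultimately have "(\<lambda>k. real k * Im (char N (1 / real k))) \<longlonglongrightarrow> t * (b + \<mu>1)"
    by (simp add: algebra_simps)
  moreover have "(\<lambda>k. real k * Im (char N (1 / real k))) \<longlonglongrightarrow> (LINT x|N. x)"
  proof -
    have "(\<lambda>k. LINT x|N. real k * sin (1 / real k * x)) \<longlonglongrightarrow> (LINT x|N. x)"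
    proof (rule integral_dominated_convergence[where w = "\<lambda>x. 1 + x\<^sup>2"])
      show "integrable N (\<lambda>x. 1 + x\<^sup>2)" using int2 by simp
      show "AE x in N. (\<lambda>k. real k * sin (1 / real k * x)) \<longlonglongrightarrow> x"
      proof (rule AE_I2)
        fix y :: real
        have "\<forall>\<^sub>F k in sequentially. y = real k * (1 / real k * y)"
          using eventually_gt_at_top[of 0] by eventually_elim simp
        then have "(\<lambda>k. real k * (1 / real k * y)) \<longlonglongrightarrow> y" by (rule Lim_transform_eventually[OF tendsto_const])
        then show "(\<lambda>k. real k * sin (1 / real k * y)) \<longlonglongrightarrow> y" by (rule tendsto_scaled_sin)
      qed
      show "AE x in N. norm (real k * sin (1 / real k * x)) \<le> 1 + x\<^sup>2" for k
      proof (rule AE_I2)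
        fix x :: real
        have "norm (real k * sin (1 / real k * x)) \<le> real k * \<bar>1 / real k * x\<bar>"
          unfolding real_norm_def abs_mult abs_of_nat by (intro mult_left_mono order_trans[OF abs_sin_x_le_abs_x]) (auto simp: abs_mult)
        also have "\<dots> \<le> \<bar>x\<bar>" by (cases "k = 0") (auto simp: abs_mult)
        also have "\<dots> \<le> 1 + x\<^sup>2"
          using zero_le_power2[of "\<bar>x\<bar> - 1"] by (simp add: power2_diff)
        finally show "norm (real k * sin (1 / real k * x)) \<le> 1 + x\<^sup>2" .
      qed
    qed measurable
    then show ?thesis unfolding Imchar integral_mult_right_zero .
  qed
  ultimately show "(LINT x|N. x) = t * (b + (LINT y|\<nu>. y * indicator {1..} \<bar>y\<bar>))"
    unfolding \<mu>1_def by (rule LIMSEQ_unique[THEN sym])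
qed

section \<open>The weak generator on quadratic polynomials\<close>

lemma compact_support_integrable:
  fixes F :: "real \<Rightarrow> real"
  assumes "continuous_on UNIV F" "\<And>x. \<bar>x\<bar> > R \<Longrightarrow> F x = 0"
  shows "integrable lborel F"
proof -
  have "integrable lborel (\<lambda>x. indicator {-R..R} x *\<^sub>R F x)"
    by (rule borel_integrable_compact) (auto intro: continuous_on_subset[OF assms(1)])
  also have "(\<lambda>x. indicator {-R..R} x *\<^sub>R F x) = F"
  proof
    fix x
    show "indicator {-R..R} x *\<^sub>R F x = F x" using assms(2)[of x] by (cases "\<bar>x\<bar> > R") (auto simp: indicator_def)
  qed
  finally show ?thesis .
qed

lemma compact_support_integral_deriv:
  fixes F :: "real \<Rightarrow> real"
  assumes d: "\<And>x. (F has_real_derivative F' x) (at x)" and c: "continuous_on UNIV F'"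
    and z: "\<And>x. \<bar>x\<bar> > R \<Longrightarrow> F x = 0" "\<And>x. \<bar>x\<bar> > R \<Longrightarrow> F' x = 0"
  shows "(LINT x|lborel. F' x) = 0"
proof -
  \<comment> \<open>The endpoints must lie strictly outside the support, also when R is
    negative.\<close>
  define r where "r = \<bar>R\<bar> + 1"
  have "(LINT x|lborel. F' x * indicator {-r..r} x) = F r - F (-r)"
    by (rule integral_FTC_Icc_real) (use c d in \<open>auto simp: r_def continuous_on_eq_continuous_at\<close>)
  also have "(\<lambda>x. F' x * indicator {-r..r} x) = F'"
  proof
    fix x
    show "F' x * indicator {-r..r} x = F' x" using z(2)[of x] by (cases "\<bar>x\<bar> > R") (auto simp: indicator_def r_def)
  qed
  finally show ?thesis using z(1)[of r] z(1)[of "-r"] by (simp add: r_def)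
qed

lemma test_function_derivatives:
  assumes "\<phi> \<in> test_functions"
  obtains R B where "R \<ge> 0" "B \<ge> 0"
    "\<And>x. (\<phi> has_real_derivative deriv \<phi> x) (at x)"
    "\<And>x. (deriv \<phi> has_real_derivative deriv (deriv \<phi>) x) (at x)"
    "continuous_on UNIV (deriv (deriv \<phi>))"
    "\<And>x. \<bar>x\<bar> > R \<Longrightarrow> \<phi> x = 0" "\<And>x. \<bar>x\<bar> > R \<Longrightarrow> deriv \<phi> x = 0" "\<And>x. \<bar>x\<bar> > R \<Longrightarrow> deriv (deriv \<phi>) x = 0"
    "\<And>x. \<bar>\<phi> x\<bar> \<le> B" "\<And>x. \<bar>deriv (deriv \<phi>) x\<bar> \<le> B"
proof -
  from assms obtain D R0 where D: "D 0 = \<phi>" "\<And>k x. (D k has_vector_derivative D (Suc k) x) (at x)"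
    and R0: "\<And>x. \<bar>x\<bar> > R0 \<Longrightarrow> \<phi> x = 0" unfolding test_functions_def smooth_def by blast
  define R where "R = max R0 0"
  have D': "(D k has_real_derivative D (Suc k) x) (at x)" for k x
    using D(2) by (simp add: has_real_derivative_iff_has_vector_derivative)
  have deriv_D: "deriv (D k) = D (Suc k)" for k using DERIV_imp_deriv[OF D'] by (simp add: fun_eq_iff)
  have cont: "continuous_on UNIV (D k)" for k
    by (intro continuous_at_imp_continuous_on ballI DERIV_isCont[OF D'])
  have zero: "D k x = 0" if "\<bar>x\<bar> > R" for k x
    using that
  proof (induction k arbitrary: x)
    case 0 then show ?case using R0[of x] by (simp add: D R_def)
  next
    case (Suc k)
    \<comment> \<open>A function that vanishes on an open set has vanishing derivative there, so all
      derivatives share one support radius.\<close>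
    have op: "open {x :: real. \<bar>x\<bar> > R}" by (intro open_Collect_less continuous_intros)
    have "\<forall>\<^sub>F y in nhds x. D k y = 0"
      using eventually_nhds_in_open[OF op, of x] Suc by (auto elim!: eventually_mono)
    then have "(D k has_real_derivative 0) (at x)"
      by (subst DERIV_cong_ev[OF refl _ refl]) auto
    then show ?case using DERIV_unique[OF D'] by blast
  qed
  have bound: "\<exists>B. \<forall>x. \<bar>D k x\<bar> \<le> B" for k
  proof -
    have "compact (D k ` {-R..R})" by (intro compact_continuous_image continuous_on_subset[OF cont]) auto
    then obtain B where B: "\<And>y. y \<in> D k ` {-R..R} \<Longrightarrow> norm y \<le> B" using compact_imp_bounded bounded_iff by metis
    have "\<bar>D k x\<bar> \<le> max B 0" for x
    proof (cases "\<bar>x\<bar> > R")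
      case False
      then have "D k x \<in> D k ` {-R..R}" by (intro imageI) (auto simp: abs_le_iff)
      from B[OF this] show ?thesis by simp
    qed (simp add: zero)
    then show ?thesis by blast
  qed
  obtain B0 B2 where B: "\<And>x. \<bar>D 0 x\<bar> \<le> B0" "\<And>x. \<bar>D 2 x\<bar> \<le> B2" using bound by metis
  have e: "deriv \<phi> = D 1" "deriv (deriv \<phi>) = D 2" using deriv_D[of 0] deriv_D[of 1] by (simp_all add: D numeral_2_eq_2)
  show thesis
  proof (rule that[of R "max B0 B2"])
    show "R \<ge> 0" by (simp add: R_def)
    show "max B0 B2 \<ge> 0" using B(1)[of 0] by simp
    show "\<bar>\<phi> x\<bar> \<le> max B0 B2" "\<bar>deriv (deriv \<phi>) x\<bar> \<le> max B0 B2" for x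
      using B(1)[of x] B(2)[of x] by (auto simp: D deriv_D e numeral_2_eq_2)
  qed (use D'[of 0] D'[of 1] cont[of 2] zero[of _ 0] zero[of _ 1] zero[of _ 2] in \<open>simp_all add: D deriv_D e numeral_2_eq_2\<close>)
qed

text \<open>Pairings of a quadratic g with the pieces of the adjoint generator. In the last three
  the second moment of \<phi> does not appear, because g (x + y) - g x and the derivative of g are
  affine in x.\<close>

lemma quadratic_test_integrals:
  fixes a b c y :: real
  assumes \<phi>: "\<phi> \<in> test_functions"
  defines "I0 \<equiv> LINT x|lborel. \<phi> x" and "I1 \<equiv> LINT x|lborel. x * \<phi> x"
  defines "g \<equiv> \<lambda>x. a * x\<^sup>2 + b * x + c"
  shows "integrable lborel (\<lambda>x. g x * \<phi> (x - y))"
    and "integrable lborel (\<lambda>x. g x * deriv \<phi> x)"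
    and "integrable lborel (\<lambda>x. g x * deriv (deriv \<phi>) x)"
    and "(LINT x|lborel. g x * deriv \<phi> x) = - (2 * a * I1 + b * I0)"
    and "(LINT x|lborel. g x * deriv (deriv \<phi>) x) = 2 * a * I0"
    and "(LINT x|lborel. g x * \<phi> (x - y)) - (LINT x|lborel. g x * \<phi> x) = a * y\<^sup>2 * I0 + y * (2 * a * I1 + b * I0)"
proof -
  obtain R B where d: "\<And>x. (\<phi> has_real_derivative deriv \<phi> x) (at x)"
    "\<And>x. (deriv \<phi> has_real_derivative deriv (deriv \<phi>) x) (at x)"
    and c: "continuous_on UNIV (deriv (deriv \<phi>))"
    and z: "\<And>x. \<bar>x\<bar> > R \<Longrightarrow> \<phi> x = 0" "\<And>x. \<bar>x\<bar> > R \<Longrightarrow> deriv \<phi> x = 0" "\<And>x. \<bar>x\<bar> > R \<Longrightarrow> deriv (deriv \<phi>) x = 0"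
    using test_function_derivatives[OF \<phi>] by metis
  have c0: "continuous_on UNIV \<phi>" and c1: "continuous_on UNIV (deriv \<phi>)"
    by (intro continuous_at_imp_continuous_on ballI DERIV_isCont[OF d(1)] DERIV_isCont[OF d(2)])+
  have cq: "continuous_on UNIV (\<lambda>x. A * x\<^sup>2 + B * x + C)" for A B C :: real by (intro continuous_intros)
  have int: "integrable lborel (\<lambda>x. (A * x\<^sup>2 + B * x + C) * u x)"
    if "continuous_on UNIV u" "\<And>x. \<bar>x\<bar> > r \<Longrightarrow> u x = 0" for A B C r and u :: "real \<Rightarrow> real"
    using that by (intro compact_support_integrable[of _ r] continuous_on_mult cq) auto
  have csh: "continuous_on UNIV (\<lambda>x. \<phi> (x - y))" for y
    by (rule continuous_on_compose2[OF c0]) (auto intro!: continuous_intros)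
  have zsh: "\<phi> (x - y) = 0" if "\<bar>x\<bar> > R + \<bar>y\<bar>" for x y using that by (intro z(1)) linarith
  show "integrable lborel (\<lambda>x. g x * \<phi> (x - y))" for y
    unfolding g_def by (rule int[OF csh zsh])
  show "integrable lborel (\<lambda>x. g x * deriv \<phi> x)" unfolding g_def by (rule int[OF c1 z(2)])
  show "integrable lborel (\<lambda>x. g x * deriv (deriv \<phi>) x)" unfolding g_def by (rule int[OF c z(3)])
  have i0: "integrable lborel \<phi>" proof -
    have "integrable lborel (\<lambda>x. (0 * x\<^sup>2 + 0 * x + 1) * \<phi> x)" by (rule int[OF c0 z(1)])
    then show ?thesis by simp
  qed
  have i1: "integrable lborel (\<lambda>x. x * \<phi> x)" proof -
    have "integrable lborel (\<lambda>x. (0 * x\<^sup>2 + 1 * x + 0) * \<phi> x)" by (rule int[OF c0 z(1)])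
    then show ?thesis by simp
  qed
  have i2: "integrable lborel (\<lambda>x. g x * \<phi> x)" unfolding g_def by (rule int[OF c0 z(1)])
  have parts: "(LINT x|lborel. (A * x\<^sup>2 + B * x + C) * u' x) = - (LINT x|lborel. (2 * A * x + B) * u x)"
    if u: "\<And>x. (u has_real_derivative u' x) (at x)" "continuous_on UNIV u'"
      "\<And>x. \<bar>x\<bar> > R \<Longrightarrow> u x = 0" "\<And>x. \<bar>x\<bar> > R \<Longrightarrow> u' x = 0" for A B C u u'
  proof -
    have cu: "continuous_on UNIV u" by (intro continuous_at_imp_continuous_on ballI DERIV_isCont[OF u(1)])
    have ia: "integrable lborel (\<lambda>x. (2 * A * x + B) * u x)" proof -
      have "integrable lborel (\<lambda>x. (0 * x\<^sup>2 + (2 * A) * x + B) * u x)" by (rule int[OF cu u(3)])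
      then show ?thesis by simp
    qed
    have ib: "integrable lborel (\<lambda>x. (A * x\<^sup>2 + B * x + C) * u' x)" by (rule int[OF u(2,4)])
    have "(LINT x|lborel. (2 * A * x + B) * u x + (A * x\<^sup>2 + B * x + C) * u' x) = 0"
    proof (rule compact_support_integral_deriv[where F = "\<lambda>x. (A * x\<^sup>2 + B * x + C) * u x" and R = R])
      show "((\<lambda>x. (A * x\<^sup>2 + B * x + C) * u x) has_real_derivative
        (2 * A * x + B) * u x + (A * x\<^sup>2 + B * x + C) * u' x) (at x)" for x
        by (rule derivative_eq_intros u refl)+ (simp add: algebra_simps)
      show "continuous_on UNIV (\<lambda>x. (2 * A * x + B) * u x + (A * x\<^sup>2 + B * x + C) * u' x)"
        by (intro continuous_on_add continuous_on_mult continuous_on_power continuous_on_const continuous_on_id cu u)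
    qed (use u in auto)
    then show ?thesis using ia ib by simp
  qed
  show g1: "(LINT x|lborel. g x * deriv \<phi> x) = - (2 * a * I1 + b * I0)"
  proof -
    have "(LINT x|lborel. g x * deriv \<phi> x) = - (LINT x|lborel. (2 * a * x + b) * \<phi> x)"
      unfolding g_def by (rule parts[OF d(1) c1 z(1,2)])
    also have "(LINT x|lborel. (2 * a * x + b) * \<phi> x) = (LINT x|lborel. 2 * a * (x * \<phi> x) + b * \<phi> x)"
      by (simp add: algebra_simps)
    finally show ?thesis using i0 i1 by (simp add: I0_def I1_def)
  qed
  show "(LINT x|lborel. g x * deriv (deriv \<phi>) x) = 2 * a * I0"
  proof -
    have "(LINT x|lborel. g x * deriv (deriv \<phi>) x) = - (LINT x|lborel. (2 * a * x + b) * deriv \<phi> x)"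
      unfolding g_def by (rule parts[OF d(2) c z(2,3)])
    also have "(LINT x|lborel. (2 * a * x + b) * deriv \<phi> x) = (LINT x|lborel. (0 * x\<^sup>2 + (2 * a) * x + b) * deriv \<phi> x)"
      by simp
    also have "\<dots> = - (LINT x|lborel. (2 * 0 * x + 2 * a) * \<phi> x)"
      by (rule parts[OF d(1) c1 z(1,2)])
    also have "- \<dots> = (LINT x|lborel. (2 * a) * \<phi> x)" by simp
    finally show ?thesis by (simp add: I0_def)
  qed
  show "(LINT x|lborel. g x * \<phi> (x - y)) - (LINT x|lborel. g x * \<phi> x) = a * y\<^sup>2 * I0 + y * (2 * a * I1 + b * I0)" for y
  proof -
    have "(LINT x|lborel. g x * \<phi> (x - y)) = (LINT x|lborel. g (y + x) * \<phi> x)"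
      by (subst lborel_integral_real_affine[where c = 1 and t = y]) simp_all
    also have "\<dots> = (LINT x|lborel. g x * \<phi> x + (2 * a * y) * (x * \<phi> x) + (a * y\<^sup>2 + b * y) * \<phi> x)"
      by (intro Bochner_Integration.integral_cong refl) (simp add: g_def power2_eq_square algebra_simps)
    also have "\<dots> = (LINT x|lborel. g x * \<phi> x) + (2 * a * y) * I1 + (a * y\<^sup>2 + b * y) * I0"
      using i0 i1 i2 by (simp add: I0_def I1_def)
    finally show ?thesis by (simp add: algebra_simps)
  qed
qed

text \<open>Fubini lets the jump part be evaluated in x first. The coefficient of the first moment
  of the test function is then twice the expression in \<open>mean\<close>, hence 0, and what
  remains is a multiple of its integral.\<close>

lemma weak_generator_quadratic:
  assumes lm: "levy_measure \<nu>" and i2: "integrable \<nu> (\<lambda>y. y\<^sup>2)"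
    and mean: "\<alpha> * (b + (LINT y|\<nu>. y * indicator {1..} \<bar>y\<bar>)) = 0"
  shows "weak_generator_constant b s2 \<nu> (\<lambda>x. \<alpha> * x\<^sup>2 + \<beta> * x + \<gamma>)"
proof -
  interpret \<nu>: sigma_finite_measure \<nu> by (rule levy_measure_sigma_finite[OF lm])
  interpret P: pair_sigma_finite \<nu> "lborel :: real measure" ..
  have sets[measurable_cong]: "sets \<nu> = sets borel" using lm by (simp add: levy_measure_def)
  define g where "g x = \<alpha> * x\<^sup>2 + \<beta> * x + \<gamma>" for x
  define \<mu>1 where "\<mu>1 = (LINT y|\<nu>. y * indicator {1..} \<bar>y\<bar>)"
  define v where "v = (LINT y|\<nu>. y\<^sup>2)"
  have i1: "integrable \<nu> (\<lambda>y. y * indicator {1..} \<bar>y\<bar>)"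
  proof (rule Bochner_Integration.integrable_bound[OF i2])
    have "\<bar>y * indicator {1..} \<bar>y\<bar>\<bar> \<le> y\<^sup>2" for y :: real
    proof (cases "1 \<le> \<bar>y\<bar>")
      case True
      then have "\<bar>y\<bar> * 1 \<le> \<bar>y\<bar> * \<bar>y\<bar>" by (intro mult_left_mono) auto
      then show ?thesis using True by (simp add: power2_eq_square)
    qed auto
    then show "AE y in \<nu>. norm (y * indicator {1..} \<bar>y\<bar>) \<le> norm (y\<^sup>2)" by (intro AE_I2) simp
  qed measurable
  show ?thesis
    unfolding weak_generator_constant_def g_def[symmetric]
  \<comment> \<open>The formal value of the generator on the quadratic: the total drift b + \<mu>1
    acts on the linear term, v + s2 on the quadratic one.\<close>
  proof (intro exI[of _ "\<beta> * (b + \<mu>1) + \<alpha> * (v + s2)"] ballI)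
    fix \<phi> assume \<phi>: "\<phi> \<in> test_functions"
    obtain R B where R: "R \<ge> 0" "B \<ge> 0"
      and d: "\<And>x. (\<phi> has_real_derivative deriv \<phi> x) (at x)"
        "\<And>x. (deriv \<phi> has_real_derivative deriv (deriv \<phi>) x) (at x)"
      and c: "continuous_on UNIV (deriv (deriv \<phi>))"
      and z: "\<And>x. \<bar>x\<bar> > R \<Longrightarrow> \<phi> x = 0" "\<And>x. \<bar>x\<bar> > R \<Longrightarrow> deriv \<phi> x = 0" "\<And>x. \<bar>x\<bar> > R \<Longrightarrow> deriv (deriv \<phi>) x = 0"
      and B: "\<And>x. \<bar>\<phi> x\<bar> \<le> B" "\<And>x. \<bar>deriv (deriv \<phi>) x\<bar> \<le> B"
      using test_function_derivatives[OF \<phi>] by metis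
    have [measurable]: "\<phi> \<in> borel_measurable borel" "deriv \<phi> \<in> borel_measurable borel"
      by (intro borel_measurable_continuous_onI continuous_at_imp_continuous_on ballI DERIV_isCont[OF d(1)] DERIV_isCont[OF d(2)])+
    have [measurable]: "g \<in> borel_measurable borel" unfolding g_def[abs_def] by measurable
    define I0 where "I0 = (LINT x|lborel. \<phi> x)"
    define I1 where "I1 = (LINT x|lborel. x * \<phi> x)"
    note q = quadratic_test_integrals[OF \<phi>, of \<alpha> \<beta> \<gamma>, folded g_def I0_def I1_def]
    \<comment> \<open>Integrand of the adjoint jump part, with the reflection of \<nu> moved into
      the test function.\<close>
    define H where "H y x = \<phi> (x - y) - \<phi> x + y * deriv \<phi> x * indicator {0<..<1} \<bar>y\<bar>" for x y :: real
    have [measurable]: "(\<lambda>(y, x). g x * H y x) \<in> borel_measurable (\<nu> \<Otimes>\<^sub>M lborel)"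
      unfolding H_def by measurable
    have ig: "integrable lborel (\<lambda>x. g x * \<phi> x)" using q(1)[of 0] by simp
    have gH: "g x * H y x = g x * \<phi> (x - y) - g x * \<phi> x + y * indicator {0<..<1} \<bar>y\<bar> * (g x * deriv \<phi> x)" for x y
      by (simp add: H_def algebra_simps)
    have iH: "integrable lborel (\<lambda>x. g x * H y x)" for y
      unfolding gH by (intro Bochner_Integration.integrable_add Bochner_Integration.integrable_diff integrable_mult_right q ig)
    \<comment> \<open>Jumps of size below 1 are compensated to first order, so the linear term
      survives for |y| >= 1.\<close>
    have IH: "(LINT x|lborel. g x * H y x) = \<alpha> * I0 * y\<^sup>2 + (2 * \<alpha> * I1 + \<beta> * I0) * (y * indicator {1..} \<bar>y\<bar>)" for y
    proof -
      have "(LINT x|lborel. g x * H y x) = (LINT x|lborel. g x * \<phi> (x - y)) - (LINT x|lborel. g x * \<phi> x)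
        + y * indicator {0<..<1} \<bar>y\<bar> * (LINT x|lborel. g x * deriv \<phi> x)"
        unfolding gH using q(1)[of y] q(2) ig by simp
      also have "\<dots> = \<alpha> * I0 * y\<^sup>2 + (2 * \<alpha> * I1 + \<beta> * I0) * (y * (1 - indicator {0<..<1} \<bar>y\<bar>))"
        unfolding q(4,6) by (simp add: algebra_simps)
      also have "y * (1 - indicator {0<..<1} \<bar>y\<bar>) = y * indicator {1..} \<bar>y\<bar>" by (auto simp: indicator_def)
      finally show ?thesis .
    qed
    define G where "G = (\<bar>\<alpha>\<bar> + \<bar>\<beta>\<bar> + \<bar>\<gamma>\<bar>)"
    define K where "K = G * (1 + (R + 1)\<^sup>2) * B"
    have K0: "K \<ge> 0" using R by (simp add: K_def G_def)
    have gb: "\<bar>g x\<bar> \<le> G * (1 + x\<^sup>2)" for x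
    proof -
      have 1: "\<bar>x\<bar> \<le> 1 + x\<^sup>2" using zero_le_power2[of "\<bar>x\<bar> - 1/2"] by (simp add: power2_diff power_divide)
      have "\<bar>g x\<bar> \<le> \<bar>\<alpha> * x\<^sup>2\<bar> + \<bar>\<beta> * x\<bar> + \<bar>\<gamma>\<bar>" unfolding g_def by linarith
      also have "\<dots> \<le> \<bar>\<alpha>\<bar> * (1 + x\<^sup>2) + \<bar>\<beta>\<bar> * (1 + x\<^sup>2) + \<bar>\<gamma>\<bar> * (1 + x\<^sup>2)"
      proof (intro add_mono)
        show "\<bar>\<beta> * x\<bar> \<le> \<bar>\<beta>\<bar> * (1 + x\<^sup>2)" unfolding abs_mult by (intro mult_left_mono 1) auto
        show "\<bar>\<alpha> * x\<^sup>2\<bar> \<le> \<bar>\<alpha>\<bar> * (1 + x\<^sup>2)" unfolding abs_mult by (intro mult_left_mono) auto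
        show "\<bar>\<gamma>\<bar> \<le> \<bar>\<gamma>\<bar> * (1 + x\<^sup>2)" by (simp add: mult_le_cancel_left1)
      qed
      finally show ?thesis by (simp add: G_def algebra_simps)
    qed
    \<comment> \<open>Intervals around the supports of \<phi> (x - y) and \<phi> x; the margin 1
      leaves room for small jumps. Their total length 4 (R + 1) does not depend on y.\<close>
    define S where "S y x = indicator {y - (R + 1)..y + (R + 1)} x + (indicator {-(R + 1)..R + 1} x :: real)" for x y :: real
    \<comment> \<open>Both regimes give y^2. For |y| < 1 it is the Taylor remainder of \<phi>, with
      g bounded near the support; for |y| >= 1 it is the quadratic growth of g on |x| <= (R + 1)
      |y|. Integrating in x leaves a multiple of y^2, which \<nu> integrates.\<close>
    have bound: "\<bar>g x * H y x\<bar> \<le> K * y\<^sup>2 * S y x" for x y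
    proof (cases "\<bar>y\<bar> < 1")
      case True
      show ?thesis
      proof (cases "\<bar>x\<bar> \<le> R + 1")
        case False
        then have "H y x = 0" using True by (simp add: H_def z)
        then show ?thesis using K0 by (simp add: S_def)
      next
        case xR: True
        have H_eq: "H y x = \<phi> (x - y) - \<phi> x + y * deriv \<phi> x" using True by (cases "y = 0") (auto simp: H_def)
        have lip: "\<bar>deriv \<phi> w - deriv \<phi> x\<bar> \<le> B * \<bar>w - x\<bar>" for w
          using field_differentiable_bound[of UNIV "deriv \<phi>" "deriv (deriv \<phi>)" B w x] d(2) B(2) by auto
        have "norm ((\<phi> (x - y) - (x - y) * deriv \<phi> x) - (\<phi> x - x * deriv \<phi> x)) \<le> B * \<bar>y\<bar> * norm ((x - y) - x)"
        proof (rule field_differentiable_bound[of "closed_segment x (x - y)" "\<lambda>w. \<phi> w - w * deriv \<phi> x" "\<lambda>w. deriv \<phi> w - deriv \<phi> x"])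
          fix w assume w: "w \<in> closed_segment x (x - y)"
          show "((\<lambda>w. \<phi> w - w * deriv \<phi> x) has_field_derivative deriv \<phi> w - deriv \<phi> x) (at w within closed_segment x (x - y))"
            by (rule derivative_eq_intros has_field_derivative_at_within[OF d(1)] refl)+ simp
          have "\<bar>w - x\<bar> \<le> \<bar>y\<bar>" using segment_bound1[OF w] by (simp add: abs_minus_commute)
          then show "norm (deriv \<phi> w - deriv \<phi> x) \<le> B * \<bar>y\<bar>"
            using lip[of w] mult_left_mono[of "\<bar>w - x\<bar>" "\<bar>y\<bar>" B] R by simp
        qed auto
        then have Hb: "\<bar>H y x\<bar> \<le> B * y\<^sup>2" unfolding H_eq by (simp add: algebra_simps power2_eq_square)
        have "x\<^sup>2 \<le> (R + 1)\<^sup>2" using xR R by (simp add: abs_le_square_iff[symmetric])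
        then have "\<bar>g x\<bar> \<le> G * (1 + (R + 1)\<^sup>2)" using gb[of x] mult_left_mono[of "1 + x\<^sup>2" "1 + (R + 1)\<^sup>2" G] by (simp add: G_def)
        then have "\<bar>g x * H y x\<bar> \<le> (G * (1 + (R + 1)\<^sup>2)) * (B * y\<^sup>2)"
          unfolding abs_mult by (intro mult_mono Hb) (auto simp: G_def)
        also have "\<dots> = K * y\<^sup>2 * 1" by (simp add: K_def)
        also have "\<dots> \<le> K * y\<^sup>2 * S y x" using xR K0 by (intro mult_left_mono) (auto simp: S_def abs_le_iff)
        finally show ?thesis .
      qed
    next
      case False
      then have H_eq: "H y x = \<phi> (x - y) - \<phi> x" by (simp add: H_def)
      show ?thesis
      proof (cases "\<bar>x\<bar> \<le> R + \<bar>y\<bar>")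
        case xy: True
        have ysq: "1 \<le> y\<^sup>2" using False by (simp add: abs_square_less_1[symmetric] not_less[symmetric])
        have Hb: "\<bar>H y x\<bar> \<le> B * S y x"
        proof -
          have "\<bar>\<phi> w\<bar> \<le> B * indicator {-(R + 1)..R + 1} w" for w
            using B(1)[of w] z(1)[of w] R by (auto simp: indicator_def)
          from this[of x] this[of "x - y"]
          have "\<bar>H y x\<bar> \<le> B * indicator {-(R + 1)..R + 1} (x - y) + B * indicator {-(R + 1)..R + 1} x"
            unfolding H_eq by linarith
          also have "(indicator {-(R + 1)..R + 1} (x - y) :: real) = indicator {y - (R + 1)..y + (R + 1)} x"
            by (auto simp: indicator_def)
          finally show ?thesis by (simp add: S_def distrib_left)
        qed
        have "R * 1 \<le> R * \<bar>y\<bar>" using False R by (intro mult_left_mono) auto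
        then have "\<bar>x\<bar> \<le> (R + 1) * \<bar>y\<bar>" using xy by (simp add: distrib_right)
        then have "x\<^sup>2 \<le> ((R + 1) * \<bar>y\<bar>)\<^sup>2" by (intro abs_le_square_iff[THEN iffD1]) (use R in \<open>simp add: abs_mult\<close>)
        then have "x\<^sup>2 \<le> (R + 1)\<^sup>2 * y\<^sup>2" by (simp add: power_mult_distrib)
        then have "1 + x\<^sup>2 \<le> (1 + (R + 1)\<^sup>2) * y\<^sup>2" using ysq by (simp add: distrib_right)
        then have "\<bar>g x\<bar> \<le> G * ((1 + (R + 1)\<^sup>2) * y\<^sup>2)"
          using gb[of x] mult_left_mono[of "1 + x\<^sup>2" "(1 + (R + 1)\<^sup>2) * y\<^sup>2" G] by (simp add: G_def)
        then have "\<bar>g x * H y x\<bar> \<le> (G * ((1 + (R + 1)\<^sup>2) * y\<^sup>2)) * (B * S y x)"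
          unfolding abs_mult by (intro mult_mono Hb) (auto simp: G_def)
        also have "\<dots> = K * y\<^sup>2 * S y x" by (simp add: K_def mult_ac)
        finally show ?thesis .
      next
        case False
        then have "H y x = 0" unfolding H_eq using z(1)[of x] z(1)[of "x - y"] R by simp
        then show ?thesis using K0 by (simp add: S_def)
      qed
    qed
    have intS: "integrable lborel (S y)" "(LINT x|lborel. S y x) = 4 * (R + 1)" for y
      unfolding S_def[abs_def] using R by (auto simp: emeasure_lborel_Icc_eq)
    have Fub: "integrable (\<nu> \<Otimes>\<^sub>M lborel) (\<lambda>(y, x). g x * H y x)"
    proof (rule P.Fubini_integrable)
      show "integrable \<nu> (\<lambda>y. LINT x|lborel. norm (case (y, x) of (y, x) \<Rightarrow> g x * H y x))"
      proof (rule Bochner_Integration.integrable_bound)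
        show "integrable \<nu> (\<lambda>y. (K * (4 * (R + 1))) * y\<^sup>2)" using i2 by (intro integrable_mult_right)
        have "(LINT x|lborel. \<bar>g x * H y x\<bar>) \<le> (K * (4 * (R + 1))) * y\<^sup>2" for y
        proof -
          have "(LINT x|lborel. \<bar>g x * H y x\<bar>) \<le> (LINT x|lborel. K * y\<^sup>2 * S y x)"
            by (intro integral_mono integrable_mult_right intS bound integrable_abs iH)
          then show ?thesis by (simp add: intS mult_ac)
        qed
        then show "AE y in \<nu>. norm (LINT x|lborel. norm (case (y, x) of (y, x) \<Rightarrow> g x * H y x)) \<le> norm ((K * (4 * (R + 1))) * y\<^sup>2)"
          using R K0 by (intro AE_I2) simp
      qed measurable
      show "AE y in \<nu>. integrable lborel (\<lambda>x. case (y, x) of (y, x) \<Rightarrow> g x * H y x)" using iH by simp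
    qed measurable
    have A: "adjoint_generator b s2 \<nu> \<phi> x = - b * deriv \<phi> x + s2 / 2 * deriv (deriv \<phi>) x + (LINT y|\<nu>. H y x)" for x
      unfolding adjoint_generator_def levy_generator_def H_def
      by (subst integral_distr) (auto simp: measurable_cong_sets[OF sets refl])
    have gA: "g x * adjoint_generator b s2 \<nu> \<phi> x = (- b) * (g x * deriv \<phi> x) + s2 / 2 * (g x * deriv (deriv \<phi>) x) + (LINT y|\<nu>. g x * H y x)" for x
      unfolding A by (simp add: algebra_simps)
    have iF: "integrable lborel (\<lambda>x. LINT y|\<nu>. g x * H y x)"
      using P.integrable_snd[OF Fub] .
    have IF: "(LINT x|lborel. (LINT y|\<nu>. g x * H y x)) = \<alpha> * I0 * v + (2 * \<alpha> * I1 + \<beta> * I0) * \<mu>1"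
    proof -
      have "(LINT x|lborel. (LINT y|\<nu>. g x * H y x)) = (LINT y|\<nu>. (LINT x|lborel. g x * H y x))"
        by (rule P.Fubini_integral[OF Fub])
      then show ?thesis unfolding IH using i1 i2 by (simp add: v_def \<mu>1_def)
    qed
    show "integrable lborel (\<lambda>x. g x * adjoint_generator b s2 \<nu> \<phi> x) \<and>
      weak_generator b s2 \<nu> g \<phi> = (\<beta> * (b + \<mu>1) + \<alpha> * (v + s2)) * (LINT x|lborel. \<phi> x)"
    proof
      show "integrable lborel (\<lambda>x. g x * adjoint_generator b s2 \<nu> \<phi> x)"
        unfolding gA by (intro Bochner_Integration.integrable_add integrable_mult_right q iF)
      have "weak_generator b s2 \<nu> g \<phi> = (- b) * (LINT x|lborel. g x * deriv \<phi> x)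
         + s2 / 2 * (LINT x|lborel. g x * deriv (deriv \<phi>) x) + (LINT x|lborel. (LINT y|\<nu>. g x * H y x))"
        unfolding weak_generator_def gA using q(2,3) iF by simp
      also have "\<dots> = b * (2 * \<alpha> * I1 + \<beta> * I0) + s2 * \<alpha> * I0 + (\<alpha> * I0 * v + (2 * \<alpha> * I1 + \<beta> * I0) * \<mu>1)"
        unfolding q(4,5) IF by (simp add: algebra_simps)
      also have "\<dots> = 2 * I1 * (\<alpha> * (b + \<mu>1)) + (\<beta> * (b + \<mu>1) + \<alpha> * (v + s2)) * I0" by (simp add: algebra_simps)
      also have "\<alpha> * (b + \<mu>1) = 0" using mean by (simp add: \<mu>1_def)
      finally show "weak_generator b s2 \<nu> g \<phi> = (\<beta> * (b + \<mu>1) + \<alpha> * (v + s2)) * (LINT x|lborel. \<phi> x)" by (simp add: I0_def)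
    qed
  qed
qed

section \<open>The convolution equation\<close>

lemma levy_increment_distr:
  assumes "levy_process M X" "s \<ge> 0" "h \<ge> 0"
  shows "distr M borel (\<lambda>\<omega>. X (s + h) \<omega> - X s \<omega>) = distr M borel (X h)"
proof -
  have m[measurable]: "\<And>t. t \<ge> 0 \<Longrightarrow> X t \<in> borel_measurable M"
    and z: "AE \<omega> in M. X 0 \<omega> = 0" using assms(1) by (auto simp: levy_process_def)
  have "distr M borel (\<lambda>\<omega>. X (s + h) \<omega> - X s \<omega>) = distr M borel (\<lambda>\<omega>. X h \<omega> - X 0 \<omega>)"
    using assms by (simp add: levy_process_def stationary_increments_def)
  also have "\<dots> = distr M borel (X h)"
  proof (rule distr_cong_AE)
    show "AE \<omega> in M. X h \<omega> - X 0 \<omega> = X h \<omega>" using z by eventually_elim simp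
  qed (use m[of h] m[of 0] assms in auto)
  finally show ?thesis .
qed

lemma levy_joint_distr:
  assumes levy: "levy_process M X" and s: "s > 0" and h: "h > 0"
  shows "distr M (borel \<Otimes>\<^sub>M borel) (\<lambda>\<omega>. (X s \<omega>, X (s + h) \<omega> - X s \<omega>))
       = distr M borel (X s) \<Otimes>\<^sub>M distr M borel (X h)"
proof -
  interpret prob_space M using levy by (simp add: levy_process_def)
  have m: "\<And>t. t \<ge> 0 \<Longrightarrow> X t \<in> borel_measurable M"
    and z: "AE \<omega> in M. X 0 \<omega> = 0" using levy by (auto simp: levy_process_def)
  have [measurable]: "X 0 \<in> borel_measurable M" "X s \<in> borel_measurable M" "X (s + h) \<in> borel_measurable M"
    using m s h by auto
  \<comment> \<open>Sampling times 0, s, s + h, continued constantly; independence of the first two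
    increments asks for strict increase in the first two steps.\<close>
  define \<tau> where "\<tau> i = (if i = 0 then 0 else if i = Suc 0 then s else s + h)" for i :: nat
  have less2: "i < 2 \<Longrightarrow> i = 0 \<or> i = Suc 0" for i :: nat by auto
  have "independent_increments M X" using levy by (simp add: levy_process_def)
  then have "0 \<le> \<tau> 0 \<longrightarrow> (\<forall>i<2. \<tau> i < \<tau> (Suc i)) \<longrightarrow>
      indep_vars (\<lambda>_. borel) (\<lambda>i \<omega>. X (\<tau> (Suc i)) \<omega> - X (\<tau> i) \<omega>) {..<2}"
    unfolding independent_increments_def by blast
  then have iv: "indep_vars (\<lambda>_. borel) (\<lambda>i \<omega>. X (\<tau> (Suc i)) \<omega> - X (\<tau> i) \<omega>) {..<2::nat}"
    using s h less2 by (auto simp: \<tau>_def)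
  \<comment> \<open>Restriction to the singletons {0} and {1}, followed by evaluation, turns the
    independent family into an independent pair.\<close>
  have "indep_var borel ((\<lambda>f. f 0) \<circ> (\<lambda>\<omega>. restrict (\<lambda>i. X (\<tau> (Suc i)) \<omega> - X (\<tau> i) \<omega>) {0::nat}))
      borel ((\<lambda>f. f (Suc 0)) \<circ> (\<lambda>\<omega>. restrict (\<lambda>i. X (\<tau> (Suc i)) \<omega> - X (\<tau> i) \<omega>) {Suc 0}))"
    by (rule indep_var_compose[OF indep_var_restrict[OF iv]]) auto
  then have "indep_var borel (\<lambda>\<omega>. X s \<omega> - X 0 \<omega>) borel (\<lambda>\<omega>. X (s + h) \<omega> - X s \<omega>)"
    by (simp add: o_def \<tau>_def)
  then have "distr M borel (\<lambda>\<omega>. X s \<omega> - X 0 \<omega>) \<Otimes>\<^sub>M distr M borel (\<lambda>\<omega>. X (s + h) \<omega> - X s \<omega>)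
     = distr M (borel \<Otimes>\<^sub>M borel) (\<lambda>\<omega>. (X s \<omega> - X 0 \<omega>, X (s + h) \<omega> - X s \<omega>))"
    by (simp add: indep_var_distribution_eq)
  also have "\<dots> = distr M (borel \<Otimes>\<^sub>M borel) (\<lambda>\<omega>. (X s \<omega>, X (s + h) \<omega> - X s \<omega>))"
    by (rule distr_cong_AE) (use z in auto)
  also have "distr M borel (\<lambda>\<omega>. X s \<omega> - X 0 \<omega>) = distr M borel (X s)"
    by (rule distr_cong_AE) (use z in auto)
  finally show ?thesis using levy_increment_distr[OF levy, of s h] s h by simp
qed

section \<open>Finite moments at every time\<close>

lemma integrable_abs_power_add:
  fixes Y Z :: "'a \<Rightarrow> real"
  assumes [measurable]: "Y \<in> borel_measurable M" "Z \<in> borel_measurable M"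
    and "integrable M (\<lambda>\<omega>. \<bar>Y \<omega>\<bar> ^ n)" "integrable M (\<lambda>\<omega>. \<bar>Z \<omega>\<bar> ^ n)"
  shows "integrable M (\<lambda>\<omega>. \<bar>Y \<omega> + Z \<omega>\<bar> ^ n)"
proof (rule Bochner_Integration.integrable_bound)
  show "integrable M (\<lambda>\<omega>. 2 ^ n * (\<bar>Y \<omega>\<bar> ^ n + \<bar>Z \<omega>\<bar> ^ n))" using assms by simp
  have "\<bar>Y \<omega> + Z \<omega>\<bar> ^ n \<le> 2 ^ n * (\<bar>Y \<omega>\<bar> ^ n + \<bar>Z \<omega>\<bar> ^ n)" for \<omega>
    by (rule order_trans[OF power_mono[OF abs_triangle_ineq]]) (auto intro: power_add_le)
  then show "AE \<omega> in M. norm (\<bar>Y \<omega> + Z \<omega>\<bar> ^ n) \<le> norm (2 ^ n * (\<bar>Y \<omega>\<bar> ^ n + \<bar>Z \<omega>\<bar> ^ n))"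
    by (intro AE_I2) simp
qed simp

text \<open>Integer times are reached by adding increments distributed as X 1. From an integer k > t
  one descends: X k is X t plus an independent increment, so Fubini yields some y with E |X t + y|^n
  finite, and the constant y can be removed.\<close>

lemma levy_moment_transfer:
  assumes levy: "levy_process M X" and 1: "integrable M (\<lambda>\<omega>. \<bar>X 1 \<omega>\<bar> ^ n)" and t: "t > 0" and n: "n \<ge> 1"
  shows "integrable M (\<lambda>\<omega>. \<bar>X t \<omega>\<bar> ^ n)"
proof -
  interpret prob_space M using levy by (simp add: levy_process_def)
  have m: "\<And>t. t \<ge> 0 \<Longrightarrow> X t \<in> borel_measurable M"
    and z: "AE \<omega> in M. X 0 \<omega> = 0" using levy by (auto simp: levy_process_def)
  have nat: "integrable M (\<lambda>\<omega>. \<bar>X (real k) \<omega>\<bar> ^ n)" for k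
  proof (induction k)
    case 0
    have [measurable]: "X 0 \<in> borel_measurable M" using m by simp
    have "AE \<omega> in M. \<bar>X 0 \<omega>\<bar> ^ n = 0" using z by eventually_elim (use n in simp)
    then have "integrable M (\<lambda>\<omega>. \<bar>X 0 \<omega>\<bar> ^ n) \<longleftrightarrow> integrable M (\<lambda>\<omega>. 0 :: real)"
      by (intro integrable_cong_AE) auto
    then show ?case by simp
  next
    case (Suc k)
    have [measurable]: "X (real k) \<in> borel_measurable M" "X (real k + 1) \<in> borel_measurable M" "X 1 \<in> borel_measurable M"
      using m by auto
    have "integrable (distr M borel (X 1)) (\<lambda>x. \<bar>x\<bar> ^ n)" using 1 by (simp add: integrable_distr_eq)
    then have "integrable M (\<lambda>\<omega>. \<bar>X (real k + 1) \<omega> - X (real k) \<omega>\<bar> ^ n)"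
      unfolding levy_increment_distr[OF levy, of "real k" 1, simplified, symmetric] by (simp add: integrable_distr_eq)
    then have "integrable M (\<lambda>\<omega>. \<bar>X (real k) \<omega> + (X (real k + 1) \<omega> - X (real k) \<omega>)\<bar> ^ n)"
      by (intro integrable_abs_power_add Suc) measurable
    then show ?case by (simp add: add.commute)
  qed
  obtain k where k: "t < real k" using reals_Archimedean2 by blast
  define h where "h = real k - t"
  have h: "h > 0" using k by (simp add: h_def)
  have [measurable]: "X t \<in> borel_measurable M" "X (t + h) \<in> borel_measurable M" "X h \<in> borel_measurable M" using m t h by auto
  define \<mu> where "\<mu> = distr M borel (X t)"
  define \<mu>' where "\<mu>' = distr M borel (X h)"
  interpret \<mu>: prob_space \<mu> unfolding \<mu>_def by (rule prob_space_distr) simp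
  interpret \<mu>': prob_space \<mu>' unfolding \<mu>'_def by (rule prob_space_distr) simp
  interpret P: pair_sigma_finite \<mu> \<mu>' ..
  have [measurable_cong]: "sets \<mu> = sets borel" "sets \<mu>' = sets borel" by (simp_all add: \<mu>_def \<mu>'_def)
  have "integrable (distr M (borel \<Otimes>\<^sub>M borel) (\<lambda>\<omega>. (X t \<omega>, X (t + h) \<omega> - X t \<omega>))) (\<lambda>(x, y). \<bar>x + y\<bar> ^ n)"
    by (subst integrable_distr_eq) (measurable, use nat[of k] in \<open>simp add: h_def\<close>)
  then have "integrable (\<mu> \<Otimes>\<^sub>M \<mu>') (\<lambda>(x, y). \<bar>x + y\<bar> ^ n)"
    unfolding levy_joint_distr[OF levy t h] \<mu>_def \<mu>'_def .
  then have "AE y in \<mu>'. integrable \<mu> (\<lambda>x. \<bar>x + y\<bar> ^ n)" by (rule P.AE_integrable_snd)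
  then obtain y where y: "integrable \<mu> (\<lambda>x. \<bar>x + y\<bar> ^ n)"
    using \<mu>'.AE_const[of False] eventually_mono[of "\<lambda>y. integrable \<mu> (\<lambda>x. \<bar>x + y\<bar> ^ n)" "ae_filter \<mu>'" "\<lambda>_. False"] by blast
  have "integrable \<mu> (\<lambda>x. \<bar>(x + y) + (- y)\<bar> ^ n)"
    by (rule integrable_abs_power_add[OF _ _ y]) auto
  then show ?thesis by (simp add: \<mu>_def integrable_distr_eq)
qed

text \<open>A smooth exponent makes the characteristic function at time t smooth and so gives even
  moments there directly. In the other case the moment at time 1 is lowered to order n and
  transferred to t.\<close>

lemma levy_moments:
  assumes levy: "levy_process M X" and exponent: "characteristic_exponent M X \<psi>" and n: "n \<ge> 1" and t: "t > 0"
    and ab: "smooth \<psi> \<or> (\<exists>\<epsilon>>0. integrable M (\<lambda>\<omega>. \<bar>X 1 \<omega>\<bar> powr (real n + \<epsilon>)))"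
  shows "integrable M (\<lambda>\<omega>. \<bar>X t \<omega>\<bar> ^ n)"
  using ab
proof
  interpret prob_space M using levy by (simp add: levy_process_def)
  have [measurable]: "X t \<in> borel_measurable M" using levy t by (simp add: levy_process_def)
  assume sm: "smooth \<psi>"
  have "char (distr M borel (X t)) = (\<lambda>\<xi>. exp ((- complex_of_real t) * \<psi> \<xi>))"
    using exponent t by (simp add: characteristic_exponent_def fun_eq_iff)
  then have "smooth (char (distr M borel (X t)))" using smooth_exp[OF sm, of "- complex_of_real t"] by (simp only:)
  from smooth_char_moments[OF real_distribution_distr this, of n]
  have int: "integrable M (\<lambda>\<omega>. X t \<omega> ^ (2 * n))" by (simp add: integrable_distr_eq)
  show ?thesis
  proof (rule Bochner_Integration.integrable_bound)
    show "integrable M (\<lambda>\<omega>. 1 + X t \<omega> ^ (2 * n))" using int by simp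
    have "\<bar>x\<bar> ^ n \<le> 1 + x ^ (2 * n)" for x :: real
    proof -
      have "x ^ (2 * n) = (\<bar>x\<bar> ^ n)\<^sup>2" by (simp add: power_mult[symmetric] mult.commute[of n 2]) (simp add: power_mult)
      then show ?thesis using zero_le_power2[of "\<bar>x\<bar> ^ n - 1/2"] by (simp add: power2_diff power_divide)
    qed
    then show "AE \<omega> in M. norm (\<bar>X t \<omega>\<bar> ^ n) \<le> norm (1 + X t \<omega> ^ (2 * n))"
      by (intro AE_I2) (simp add: power_mult)
  qed simp
next
  interpret prob_space M using levy by (simp add: levy_process_def)
  have [measurable]: "X 1 \<in> borel_measurable M" using levy by (simp add: levy_process_def)
  assume "\<exists>\<epsilon>>0. integrable M (\<lambda>\<omega>. \<bar>X 1 \<omega>\<bar> powr (real n + \<epsilon>))"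
  then obtain \<epsilon> where \<epsilon>: "\<epsilon> > 0" "integrable M (\<lambda>\<omega>. \<bar>X 1 \<omega>\<bar> powr (real n + \<epsilon>))" by blast
  have "integrable M (\<lambda>\<omega>. \<bar>X 1 \<omega>\<bar> ^ n)"
  proof (rule Bochner_Integration.integrable_bound)
    show "integrable M (\<lambda>\<omega>. 1 + \<bar>X 1 \<omega>\<bar> powr (real n + \<epsilon>))" using \<epsilon> by simp
    have "\<bar>x\<bar> ^ n \<le> 1 + \<bar>x\<bar> powr (real n + \<epsilon>)" for x :: real
    proof (cases "\<bar>x\<bar> \<le> 1")
      case True
      then have "\<bar>x\<bar> ^ n \<le> 1" by (simp add: power_le_one)
      then show ?thesis by (simp add: add_increasing2)
    next
      case False
      then have "\<bar>x\<bar> ^ n = \<bar>x\<bar> powr real n" by (simp add: powr_realpow)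
      also have "\<dots> \<le> \<bar>x\<bar> powr (real n + \<epsilon>)" using False \<epsilon> by (intro powr_mono) auto
      finally show ?thesis by simp
    qed
    then show "AE \<omega> in M. norm (\<bar>X 1 \<omega>\<bar> ^ n) \<le> norm (1 + \<bar>X 1 \<omega>\<bar> powr (real n + \<epsilon>))"
      by (intro AE_I2) simp
  qed simp
  then show ?thesis by (rule levy_moment_transfer[OF levy _ t n])
qed

text \<open>After substituting z = x + y the integrand refers to u z itself, so null sets do not
  matter for any x. This allows f to be replaced by another version without changing its convolution
  at any point.\<close>

lemma conv_op_cong_AE:
  assumes [measurable]: "q \<in> borel_measurable borel" "u \<in> borel_measurable borel" "v \<in> borel_measurable borel"
    and "AE x in lborel. u x = v x"
  shows "conv_op q u x = conv_op q v x"
proof -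
  have eq: "conv_op q w x = (LINT z|lborel. q (z - x) * w z)" for w
    unfolding conv_op_def by (subst (2) lborel_integral_real_affine[where c = 1 and t = x]) simp_all
  have "AE z in lborel. q (z - x) * u z = q (z - x) * v z" using assms(4) by eventually_elim simp
  then show ?thesis unfolding eq by (intro integral_cong_AE) auto
qed

lemma natural_filtration_subalgebra:
  assumes "\<And>s. s \<ge> 0 \<Longrightarrow> X s \<in> borel_measurable M"
  shows "subalgebra M (natural_filtration M X t)"
  unfolding subalgebra_def natural_filtration_def
proof (intro conjI)
  have gen: "(\<Union>s\<in>{0..t}. {X s -` B \<inter> space M |B. B \<in> sets borel}) \<subseteq> sets M"
    using measurable_sets[OF assms] by auto
  then have pow: "(\<Union>s\<in>{0..t}. {X s -` B \<inter> space M |B. B \<in> sets borel}) \<subseteq> Pow (space M)"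
    using sets.sets_into_space by blast
  show "space (sigma (space M) (\<Union>s\<in>{0..t}. {X s -` B \<inter> space M |B. B \<in> sets borel})) = space M"
    by (rule space_measure_of[OF pow])
  show "sets (sigma (space M) (\<Union>s\<in>{0..t}. {X s -` B \<inter> space M |B. B \<in> sets borel})) \<subseteq> sets M"
    using sets.sigma_sets_subset[OF gen] sets_measure_of[OF pow] by simp
qed

lemma natural_filtration_measurable:
  assumes "\<And>s. s \<ge> 0 \<Longrightarrow> X s \<in> borel_measurable M" "0 \<le> t"
  shows "X t \<in> borel_measurable (natural_filtration M X t)"
proof (rule measurableI)
  have gen: "(\<Union>s\<in>{0..t}. {X s -` B \<inter> space M |B. B \<in> sets borel}) \<subseteq> Pow (space M)" by auto
  have sp: "space (natural_filtration M X t) = space M"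
    unfolding natural_filtration_def by (rule space_measure_of[OF gen])
  fix B :: "real set" assume "B \<in> sets borel"
  then have "X t -` B \<inter> space M \<in> (\<Union>s\<in>{0..t}. {X s -` B \<inter> space M |B. B \<in> sets borel})"
    using assms(2) by (intro UN_I[of t]) auto
  then show "X t -` B \<inter> space (natural_filtration M X t) \<in> sets (natural_filtration M X t)"
    unfolding sp unfolding natural_filtration_def using gen by (simp add: sigma_sets.Basic)
qed simp

text \<open>The conditional expectation is not computed: the martingale identity is paired with a
  bounded function of X t. Independence turns the pairing at time 2 t into one with
  \<open>conv_op p f\<close>, and positivity of p removes the density at the end.\<close>

lemma martingale_harmonic:
  assumes levy: "levy_process M X" and t: "t > 0"
    and p0: "\<And>x. 0 < p x" and p: "distributed M lborel (X t) (\<lambda>x. ennreal (p x))"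
    and ker: "kernel n p" and f: "pgrowth n f"
    and mart: "martingale M (natural_filtration M X) (\<lambda>t \<omega>. f (X t \<omega>) - (LINT \<omega>'|M. f (X t \<omega>')))"
  shows "\<exists>k. AE x in lborel. conv_op p f x = f x + k"
proof -
  interpret prob_space M using levy by (simp add: levy_process_def)
  have m: "\<And>t. t \<ge> 0 \<Longrightarrow> X t \<in> borel_measurable M" using levy by (auto simp: levy_process_def)
  have [measurable]: "X t \<in> borel_measurable M" "X (t + t) \<in> borel_measurable M" using m t by auto
  have [measurable]: "f \<in> borel_measurable borel" "p \<in> borel_measurable borel"
    using f ker by (auto simp: pgrowth_def kernel_def)
  define F where "F = natural_filtration M X t"
  interpret F: finite_measure_subalgebra M F
    by unfold_locales (simp add: F_def natural_filtration_subalgebra[OF m])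
  have XF[measurable]: "X t \<in> borel_measurable F" unfolding F_def by (rule natural_filtration_measurable[OF m]) (use t in auto)
  define c where "c s = (LINT \<omega>|M. f (X s \<omega>))" for s
  \<comment> \<open>The increase of the mean from time t to 2 t is the constant of the convolution
    equation.\<close>
  define k where "k = c (t + t) - c t"
  have Yint: "integrable M (\<lambda>\<omega>. f (X s \<omega>) - c s)" if "s \<ge> 0" for s
    using mart that by (simp add: martingale_def c_def)
  have fint: "integrable M (\<lambda>\<omega>. f (X s \<omega>))" if "s \<ge> 0" for s
    using Bochner_Integration.integrable_add[OF Yint[OF that] integrable_const[of "c s"]] by simp
  have cond: "AE \<omega> in M. real_cond_exp M F (\<lambda>\<omega>. f (X (t + t) \<omega>) - c (t + t)) \<omega> = f (X t \<omega>) - c t"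
    using mart t by (simp add: martingale_def c_def F_def)
  define \<mu> where "\<mu> = distr M borel (X t)"
  interpret \<mu>: prob_space \<mu> unfolding \<mu>_def by (rule prob_space_distr) simp
  interpret P: pair_sigma_finite \<mu> \<mu> ..
  have [measurable_cong]: "sets \<mu> = sets borel" by (simp add: \<mu>_def)
  have E: "(LINT \<omega>|M. g (X t \<omega>)) = (LINT x|lborel. p x * g x)" if "g \<in> borel_measurable borel" for g
    using distributed_integral[OF p, of g] that p0 by (simp add: less_imp_le)
  have E\<mu>: "(LINT x|\<mu>. g x) = (LINT x|lborel. p x * g x)" if [measurable]: "g \<in> borel_measurable borel" for g :: "real \<Rightarrow> real"
    unfolding E[OF that, symmetric] \<mu>_def by (rule integral_distr) auto
  define h where "h x = conv_op p f x - f x - k" for x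
  have Pf: "pgrowth n (conv_op p f)" by (rule pgrowth_conv_op[OF ker f])
  have ph: "pgrowth n h"
    unfolding h_def[abs_def] using pgrowth_add[OF pgrowth_add[OF Pf pgrowth_scale[OF f, of "-1"]] pgrowth_const[of n "-k"]]
    by (simp add: algebra_simps)
  have [measurable]: "h \<in> borel_measurable borel" "conv_op p f \<in> borel_measurable borel" using ph Pf by (auto simp: pgrowth_def)
  \<comment> \<open>Testing the martingale property against \<open>sgn h\<close> yields \<open>\<integral> p \<bar>h\<bar> = 0\<close>.\<close>
  define \<phi> where "\<phi> x = sgn (h x)" for x
  have [measurable]: "\<phi> \<in> borel_measurable borel" unfolding \<phi>_def[abs_def] by measurable
  have \<phi>1: "\<bar>\<phi> x\<bar> \<le> 1" for x by (simp add: \<phi>_def sgn_if)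
  have \<phi>int: "integrable M (\<lambda>\<omega>. \<phi> (X t \<omega>) * Z \<omega>)" if "integrable M Z" for Z
  proof (rule Bochner_Integration.integrable_bound[OF that])
    show "AE \<omega> in M. norm (\<phi> (X t \<omega>) * Z \<omega>) \<le> norm (Z \<omega>)"
      using \<phi>1 by (intro AE_I2) (simp add: abs_mult mult_left_le_one_le)
    show "(\<lambda>\<omega>. \<phi> (X t \<omega>) * Z \<omega>) \<in> borel_measurable M" using borel_measurable_integrable[OF that] by measurable
  qed
  have p\<phi>: "pgrowth n (\<lambda>x. \<phi> x * u x)" if u: "pgrowth n u" for u
  proof -
    obtain C where C: "C \<ge> 0" "\<And>x. \<bar>u x\<bar> \<le> C * (1 + \<bar>x\<bar>) ^ n" using pgrowthE[OF u] by blast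
    have "\<bar>\<phi> x * u x\<bar> \<le> C * (1 + \<bar>x\<bar>) ^ n" for x
      using mult_right_mono[OF \<phi>1[of x] abs_ge_zero[of "u x"]] C(2)[of x] by (simp add: abs_mult)
    moreover have "(\<lambda>x. \<phi> x * u x) \<in> borel_measurable borel" using pgrowth_measurable[OF u] by measurable
    ultimately show ?thesis unfolding pgrowth_def by blast
  qed
  have pint: "integrable lborel (\<lambda>x. p x * (\<phi> x * u x))" if "pgrowth n u" for u
    using conv_op_integrable[OF ker p\<phi>[OF that], of 0] by simp
  have "(LINT \<omega>|M. \<phi> (X t \<omega>) * (f (X (t + t) \<omega>) - c (t + t)))
     = (LINT \<omega>|M. \<phi> (X t \<omega>) * real_cond_exp M F (\<lambda>\<omega>. f (X (t + t) \<omega>) - c (t + t)) \<omega>)"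
  proof (rule F.real_cond_exp_intg(2)[symmetric])
    show "integrable M (\<lambda>\<omega>. \<phi> (X t \<omega>) * (f (X (t + t) \<omega>) - c (t + t)))"
      using t by (intro \<phi>int Yint) simp
  qed measurable
  also have "\<dots> = (LINT \<omega>|M. \<phi> (X t \<omega>) * (f (X t \<omega>) - c t))"
    by (rule integral_cong_AE) (use cond in \<open>auto elim!: eventually_mono\<close>)
  finally have mart_eq: "(LINT \<omega>|M. \<phi> (X t \<omega>) * (f (X (t + t) \<omega>) - c (t + t)))
     = (LINT \<omega>|M. \<phi> (X t \<omega>) * (f (X t \<omega>) - c t))" .
  have split: "(LINT \<omega>|M. \<phi> (X t \<omega>) * (f (X s \<omega>) - c s))
     = (LINT \<omega>|M. \<phi> (X t \<omega>) * f (X s \<omega>)) - c s * (LINT \<omega>|M. \<phi> (X t \<omega>))" if "s \<ge> 0" for s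
  proof -
    have "(LINT \<omega>|M. \<phi> (X t \<omega>) * (f (X s \<omega>) - c s)) = (LINT \<omega>|M. \<phi> (X t \<omega>) * f (X s \<omega>) - c s * (\<phi> (X t \<omega>) * 1))"
      by (simp add: algebra_simps)
    then show ?thesis using \<phi>int[OF fint[OF that]] \<phi>int[of "\<lambda>_. 1"] by simp
  qed
  have joint: "(LINT \<omega>|M. \<phi> (X t \<omega>) * f (X (t + t) \<omega>)) = (LINT x|lborel. p x * (\<phi> x * conv_op p f x))"
  proof -
    have jm: "(\<lambda>\<omega>. (X t \<omega>, X (t + t) \<omega> - X t \<omega>)) \<in> M \<rightarrow>\<^sub>M borel \<Otimes>\<^sub>M borel" by measurable
    have D: "distr M (borel \<Otimes>\<^sub>M borel) (\<lambda>\<omega>. (X t \<omega>, X (t + t) \<omega> - X t \<omega>)) = \<mu> \<Otimes>\<^sub>M \<mu>"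
      unfolding \<mu>_def by (rule levy_joint_distr[OF levy t t])
    \<comment> \<open>Integrability for Fubini is pulled back from M, where f (X (t + t)) is
      integrable by the martingale hypothesis.\<close>
    have "integrable (distr M (borel \<Otimes>\<^sub>M borel) (\<lambda>\<omega>. (X t \<omega>, X (t + t) \<omega> - X t \<omega>))) (\<lambda>(x, y). \<phi> x * f (x + y))"
      by (subst integrable_distr_eq) (measurable, use \<phi>int[OF fint[of "t + t"]] t in simp)
    then have int: "integrable (\<mu> \<Otimes>\<^sub>M \<mu>) (\<lambda>(x, y). \<phi> x * f (x + y))" unfolding D .
    have "(LINT \<omega>|M. \<phi> (X t \<omega>) * f (X (t + t) \<omega>))
       = (LINT z|distr M (borel \<Otimes>\<^sub>M borel) (\<lambda>\<omega>. (X t \<omega>, X (t + t) \<omega> - X t \<omega>)). (\<lambda>(x, y). \<phi> x * f (x + y)) z)"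
      by (subst integral_distr[OF jm]) simp_all
    also have "\<dots> = (LINT x|\<mu>. (LINT y|\<mu>. \<phi> x * f (x + y)))"
      unfolding D using P.integral_fst'[OF int] by simp
    also have "\<dots> = (LINT x|\<mu>. \<phi> x * conv_op p f x)"
    proof (intro Bochner_Integration.integral_cong refl)
      fix x
      have "(LINT y|\<mu>. f (x + y)) = conv_op p f x" unfolding conv_op_def by (rule E\<mu>) measurable
      then show "(LINT y|\<mu>. \<phi> x * f (x + y)) = \<phi> x * conv_op p f x" by simp
    qed
    also have "\<dots> = (LINT x|lborel. p x * (\<phi> x * conv_op p f x))" by (rule E\<mu>) measurable
    finally show ?thesis .
  qed
  have "(LINT x|lborel. p x * \<bar>h x\<bar>) = (LINT x|lborel. p x * (\<phi> x * conv_op p f x) - p x * (\<phi> x * f x) - k * (p x * (\<phi> x * 1)))"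
    by (intro Bochner_Integration.integral_cong refl) (simp add: \<phi>_def abs_sgn h_def algebra_simps)
  also have "\<dots> = (LINT x|lborel. p x * (\<phi> x * conv_op p f x)) - (LINT x|lborel. p x * (\<phi> x * f x)) - k * (LINT x|lborel. p x * (\<phi> x * 1))"
    using pint[OF Pf] pint[OF f] pint[OF pgrowth_const[of n 1]] by simp
  also have "\<dots> = 0"
    using mart_eq unfolding split[of "t + t", OF less_imp_le, OF add_pos_pos[OF t t]] split[of t, OF less_imp_le, OF t] joint
      E[of "\<lambda>x. \<phi> x * f x", simplified] E[of \<phi>, simplified]
    by (simp add: k_def algebra_simps)
  finally have z: "(LINT x|lborel. p x * \<bar>h x\<bar>) = 0" .
  have "integrable lborel (\<lambda>x. p x * \<bar>h x\<bar>)"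
    using pint[OF ph] by (simp add: \<phi>_def abs_sgn mult.commute)
  then have "AE x in lborel. p x * \<bar>h x\<bar> = 0"
    using integral_nonneg_eq_0_iff_AE[of lborel "\<lambda>x. p x * \<bar>h x\<bar>"] z p0 by (auto simp: less_imp_le)
  then have "AE x in lborel. conv_op p f x = f x + k"
  proof eventually_elim
    case (elim x)
    then show ?case using p0[of x] by (simp add: h_def)
  qed
  then show ?thesis by blast
qed

theorem theorem3p2:
  fixes M :: "'a measure" and X :: "real \<Rightarrow> 'a \<Rightarrow> real"
    and \<psi> :: "real \<Rightarrow> complex" and b s2 :: real and \<nu> :: "real measure"
    and p :: "real \<Rightarrow> real \<Rightarrow> real" and n :: nat
    and f :: "real \<Rightarrow> real" and c0 :: real
  assumes levy: "levy_process M X"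
    and exponent: "characteristic_exponent M X \<psi>"
    and triplet: "levy_triplet \<psi> b s2 \<nu>"
    and density: "\<And>t. t > 0 \<Longrightarrow>
          (\<forall>x. p t x \<ge> 0) \<and> distributed M lborel (X t) (\<lambda>x. ennreal (p t x))"
    and density_pos: "\<exists>t>0. \<forall>x. p t x > 0"
    and n: "n \<ge> 2"
    and cases_a_b: "smooth \<psi> \<or>
          ((\<forall>t>0. p t \<in> Cb1) \<and> (\<exists>\<epsilon>>0. integrable M (\<lambda>\<omega>. \<bar>X 1 \<omega>\<bar> powr (real n + \<epsilon>))))"
    and f_borel: "f \<in> borel_measurable borel"
    and c0: "c0 > 0"
    and f_growth: "\<And>x. \<bar>f x\<bar> \<le> c0 * (1 + \<bar>x\<bar> ^ n)"
    and mart: "martingale M (natural_filtration M X)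
          (\<lambda>t \<omega>. f (X t \<omega>) - (LINT \<omega>'|M. f (X t \<omega>')))"
  shows "\<exists>g. continuous_on UNIV g \<and> (AE x in lborel. f x = g x) \<and>
           weak_generator_constant b s2 \<nu> g \<and>
           (\<exists>\<alpha> \<beta> \<gamma>. \<forall>x. g x = \<alpha> * x\<^sup>2 + \<beta> * x + \<gamma>)"
proof -
  interpret prob_space M using levy by (simp add: levy_process_def)
  obtain t where t: "t > 0" and pos: "\<And>x. p t x > 0" using density_pos by blast
  have dist: "distributed M lborel (X t) (\<lambda>x. ennreal (p t x))" using density[OF t] by blast
  have [measurable]: "X t \<in> borel_measurable M" using levy t by (simp add: levy_process_def)
  have pm[measurable]: "p t \<in> borel_measurable borel"
    using distributed_real_measurable[OF _ dist] pos by (simp add: less_imp_le)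
  have mom: "integrable M (\<lambda>\<omega>. \<bar>X t \<omega>\<bar> ^ n)"
    by (rule levy_moments[OF levy exponent _ t]) (use n cases_a_b in auto)
  have mom1: "integrable M (\<lambda>\<omega>. (1 + \<bar>X t \<omega>\<bar>) ^ n)"
    using integrable_abs_power_add[of "\<lambda>\<omega>. 1" M "\<lambda>\<omega>. \<bar>X t \<omega>\<bar>" n] mom by simp
  have ker: "kernel n (p t)"
    unfolding kernel_def using pos pm distributed_integrable[OF dist, of "\<lambda>y. (1 + \<bar>y\<bar>) ^ n"] mom1
    by (auto simp: less_imp_le)
  have E: "(LINT x|lborel. p t x * g x) = (LINT \<omega>|M. g (X t \<omega>))" if "g \<in> borel_measurable borel" for g
    using distributed_integral[OF dist, of g] that pos by (simp add: less_imp_le)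
  have total: "(LINT x|lborel. p t x) = 1" using E[of "\<lambda>_. 1"] by (simp add: prob_space)
  have pf: "pgrowth n f"
    unfolding pgrowth_def
  proof (intro conjI f_borel exI[of _ "2 * c0"] allI)
    fix x :: real
    have "1 + \<bar>x\<bar> ^ n \<le> 2 * (1 + \<bar>x\<bar>) ^ n"
      using power_mono[of "\<bar>x\<bar>" "1 + \<bar>x\<bar>" n] one_le_power[of "1 + \<bar>x\<bar>" n] by linarith
    from mult_left_mono[OF this less_imp_le[OF c0]] show "\<bar>f x\<bar> \<le> 2 * c0 * (1 + \<bar>x\<bar>) ^ n"
      using f_growth[of x] by simp
  qed
  obtain k where k: "AE x in lborel. conv_op (p t) f x = f x + k"
    using martingale_harmonic[OF levy t pos dist ker pf mart] by blast
  \<comment> \<open>g agrees with f almost everywhere, hence both have the same convolution at every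
    point, and the equation for g holds everywhere by its definition.\<close>
  define g where "g x = conv_op (p t) f x - k" for x
  have pg: "pgrowth n g"
    using pgrowth_add[OF pgrowth_conv_op[OF ker pf] pgrowth_const[of n "- k"]] by (simp add: g_def[abs_def])
  have fg: "AE x in lborel. f x = g x" using k by eventually_elim (simp add: g_def)
  have harm: "conv_op (p t) g x = g x + k" for x
    using conv_op_cong_AE[OF pm f_borel pgrowth_measurable[OF pg] fg, of x] by (simp add: g_def[of x])
  obtain \<alpha> \<beta> \<gamma> where g: "\<And>x. g x = \<alpha> * x\<^sup>2 + \<beta> * x + \<gamma>"
    using harmonic_quadratic[OF ker total pos n pg harm] by blast
  have g_fun: "g = (\<lambda>x. \<alpha> * x\<^sup>2 + \<beta> * x + \<gamma>)" using g by (rule ext)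
  have mean0: "\<alpha> * (LINT y|lborel. p t y * y) = 0"
    by (rule quadratic_harmonic(1)[OF ker total n]) (rule harm[unfolded g_fun])
  have mean_eq: "(LINT y|lborel. p t y * y) = (LINT x|distr M borel (X t). x)"
    by (subst integral_distr) (auto simp: E)
  have sq: "integrable (distr M borel (X t)) (\<lambda>x. x\<^sup>2)"
  proof -
    have "integrable M (\<lambda>\<omega>. (X t \<omega>)\<^sup>2)"
    proof (rule Bochner_Integration.integrable_bound[OF mom1])
      have "x\<^sup>2 \<le> (1 + \<bar>x\<bar>) ^ n" for x :: real
      proof -
        have "x\<^sup>2 \<le> (1 + \<bar>x\<bar>)\<^sup>2" by (simp add: abs_le_square_iff[symmetric])
        also have "\<dots> \<le> (1 + \<bar>x\<bar>) ^ n" using n by (intro power_increasing) auto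
        finally show ?thesis .
      qed
      then show "AE \<omega> in M. norm ((X t \<omega>)\<^sup>2) \<le> norm ((1 + \<bar>X t \<omega>\<bar>) ^ n)" by (intro AE_I2) simp
    qed simp
    then show ?thesis by (simp add: integrable_distr_eq)
  qed
  have char: "char (distr M borel (X t)) \<xi> = exp (- complex_of_real t * \<psi> \<xi>)" for \<xi>
    using exponent t by (simp add: characteristic_exponent_def)
  have rd: "real_distribution (distr M borel (X t))" by (rule real_distribution_distr) measurable
  note lev = levy_second_moment_and_mean[OF triplet rd t char sq]
  \<comment> \<open>The mean of X t is t times the bracket, so t > 0 turns \<alpha> E X_t = 0 into
    the drift condition of \<open>weak_generator_quadratic\<close>.\<close>
  have "\<alpha> * (b + (LINT y|\<nu>. y * indicator {1..} \<bar>y\<bar>)) = 0"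
    using mean0[unfolded mean_eq lev(2)] t by simp
  moreover have "levy_measure \<nu>" using triplet by (simp add: levy_triplet_def)
  ultimately have "weak_generator_constant b s2 \<nu> g"
    unfolding g_fun using lev(1) by (intro weak_generator_quadratic) auto
  moreover have "continuous_on UNIV g" unfolding g_fun by (intro continuous_intros)
  ultimately show ?thesis using fg g by blast
qed

end
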